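(* Let $\Omega\subset\mathbb{H}^n$ be open and bounded, $1<p\le q<\infty$, $0<s\le t<1$, $a$ satisfying (A1) and (A2) with $tq\le sp+\alpha$, let $\Omega'\Subset\Omega$, and let $u\in\mathcal{A}(\Omega)\cap L^{q-1}_{sp}(\mathbb{H}^n)$ be a weak solution with $u\in L^\infty(\Omega')$. Fix a ball $B_{2r}(\xi_0)\subset\Omega'$ with $0<r\le1$ and define $$\omega(r_0)=2\sup_{B_r}|u|+\Big(r^{sp}\int_{\mathbb{H}^n\setminus B_r}\frac{|u|^{p-1}+|u|^{q-1}}{\|\xi_0^{-1}\circ\xi\|^{Q+sp}_{\mathbb{H}^n}}d\xi\Big)^{\frac1{p-1}}+\Big(r^{tq}\int_{\mathbb{H}^n\setminus B_r}\frac{|u|^{q-1}}{\|\xi_0^{-1}\circ\xi\|^{Q+tq}_{\mathbb{H}^n}}d\xi\Big)^{\frac1{q-1}},$$ where $B_r=B_r(\xi_0)$. Then there exist $\sigma\in(0,1/4]$ and $\beta\in(0,\frac{sp}{q-1})$, depending only on $n,p,q,s,t,\alpha,[a]_\alpha,\|a\|_{L^\infty},\|u\|_{L^\infty(\Omega')}$, such that, setting $r_j=\sigma^jr$, $B_j=B_{r_j}(\xi_0)$ and $\omega(r_j)=\sigma^{j\beta}\omega(r_0)$, $$\operatorname*{osc}_{B_j}u=\sup_{B_j}u-\inf_{B_j}u\le\omega(r_j)\qquad\text{for every }j\in\mathbb{N}\cup\{0\}.$$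
   Context: $\mathbb{H}^n$ ($n\ge1$) is $\mathbb{R}^{2n+1}$ with group law $\xi\circ\eta=(x_1+y_1,\dots,x_{2n}+y_{2n},\tau+\tau'+\frac12\sum_{i=1}^n(x_iy_{n+i}-x_{n+i}y_i))$ and Lebesgue measure; $\|\xi\|_{\mathbb{H}^n}=((\sum_{i=1}^{2n}x_i^2)^2+\tau^2)^{1/4}$; $Q=2n+2$; balls via the Carnot–Carathéodory distance (equivalent to $\|\xi^{-1}\circ\eta\|_{\mathbb{H}^n}$). Sup/inf are essential. (A1): $a:\mathbb{H}^n\times\mathbb{H}^n\to[0,\infty)$ measurable, $0\le a(\xi,\eta)=a(\eta,\xi)\le\|a\|_{L^\infty}<\infty$. (A2): $|a(\xi,\eta)-a(\xi',\eta')|\le[a]_\alpha(\|\xi'^{-1}\circ\xi\|_{\mathbb{H}^n}+\|\eta'^{-1}\circ\eta\|_{\mathbb{H}^n})^\alpha$, $\alpha\in(0,1]$. $J_l(\tau)=|\tau|^{l-2}\tau$; $H(\xi,\eta,\tau)=\frac{\tau^p}{\|\eta^{-1}\circ\xi\|^{sp}_{\mathbb{H}^n}}+a(\xi,\eta)\frac{\tau^q}{\|\eta^{-1}\circ\xi\|^{tq}_{\mathbb{H}^n}}$; $\mathcal{C}_\Omega=(\mathbb{H}^n\times\mathbb{H}^n)\setminus((\mathbb{H}^n\setminus\Omega)\times(\mathbb{H}^n\setminus\Omega))$; $\mathcal{A}(\Omega)=\{u$ measurable: $u|_\Omega\in L^p(\Omega)$, $\iint_{\mathcal{C}_\Omega}H(\xi,\eta,|u(\xi)-u(\eta)|)\|\eta^{-1}\circ\xi\|^{-Q}_{\mathbb{H}^n}d\xi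 d\eta<\infty\}$; $L^{q-1}_{sp}(\mathbb{H}^n)=\{u\in L^{q-1}_{loc}:\int|u|^{q-1}(1+\|\xi\|_{\mathbb{H}^n})^{-Q-sp}d\xi<\infty\}$. A weak solution is $u\in\mathcal{A}(\Omega)$ with $\iint_{\mathcal{C}_\Omega}\Big[\frac{J_p(u(\xi)-u(\eta))(\varphi(\xi)-\varphi(\eta))}{\|\eta^{-1}\circ\xi\|^{Q+sp}_{\mathbb{H}^n}}+a(\xi,\eta)\frac{J_q(u(\xi)-u(\eta))(\varphi(\xi)-\varphi(\eta))}{\|\eta^{-1}\circ\xi\|^{Q+tq}_{\mathbb{H}^n}}\Big]d\xi d\eta=0$ for all $\varphi\in\mathcal{A}(\Omega)$ vanishing a.e. outside $\Omega$. *)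

theory Defs
  imports "HOL-Probability.Probability"
begin

text \<open>Points of the Heisenberg group H^n are triples (x, y, tau) with x, y in R^n, tau in R;
  x = (x_1..x_n), y = (x_{n+1}..x_{2n}); n = CARD('n).\<close>
type_synonym 'n heis = "(real^'n) \<times> (real^'n) \<times> real"

definition hmult :: "'n::finite heis \<Rightarrow> 'n heis \<Rightarrow> 'n heis" where
  "hmult \<xi> \<eta> = (case \<xi> of (x, y, \<tau>) \<Rightarrow> case \<eta> of (x', y', \<tau>') \<Rightarrow>
     (x + x', y + y', \<tau> + \<tau>' + (1/2) * (\<Sum>i\<in>UNIV. x$i * y'$i - y$i * x'$i)))"

definition hinv :: "'n::finite heis \<Rightarrow> 'n heis" where
  "hinv \<xi> = (case \<xi> of (x, y, \<tau>) \<Rightarrow> (-x, -y, -\<tau>))"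

definition hnorm :: "'n::finite heis \<Rightarrow> real" where
  "hnorm \<xi> = (case \<xi> of (x, y, \<tau>) \<Rightarrow> ((norm x ^ 2 + norm y ^ 2) ^ 2 + \<tau> ^ 2) powr (1/4))"

definition kern :: "'n::finite heis \<Rightarrow> 'n heis \<Rightarrow> real" where
  "kern \<xi> \<eta> = hnorm (hmult (hinv \<eta>) \<xi>)"

definition hdim :: "'n::finite itself \<Rightarrow> real" where
  "hdim _ = 2 * real CARD('n) + 2"

text \<open>Horizontal vector at point xi with coefficients h = (a, b):
  sum_j a_j X_j + b_j X_{n+j}, where X_j = d_{x_j} - x_{n+j}/2 d_tau, X_{n+j} = d_{x_{n+j}} + x_j/2 d_tau.\<close>
definition horiz :: "'n::finite heis \<Rightarrow> (real^'n) \<times> (real^'n) \<Rightarrow> 'n heis" where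
  "horiz \<xi> h = (case \<xi> of (x, y, \<tau>) \<Rightarrow> case h of (a, b) \<Rightarrow>
      (a, b, (1/2) * (\<Sum>i\<in>UNIV. x$i * b$i - y$i * a$i)))"

definition subunit_curve :: "'n::finite heis \<Rightarrow> 'n heis \<Rightarrow> real \<Rightarrow> bool" where
  "subunit_curve \<xi> \<eta> T \<longleftrightarrow> 0 \<le> T \<and> (\<exists>\<gamma> :: real \<Rightarrow> 'n heis. \<gamma> 0 = \<xi> \<and> \<gamma> T = \<eta> \<and>
      (\<exists>L. L-lipschitz_on {0..T} \<gamma>) \<and>
      (AE t in lebesgue. t \<in> {0..T} \<longrightarrow>
         (\<exists>h. norm h \<le> 1 \<and> (\<gamma> has_vector_derivative horiz (\<gamma> t) h) (at t within {0..T}))))"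

definition cc_dist :: "'n::finite heis \<Rightarrow> 'n heis \<Rightarrow> real" where
  "cc_dist \<xi> \<eta> = Inf {T. subunit_curve \<xi> \<eta> T}"

definition hball :: "'n::finite heis \<Rightarrow> real \<Rightarrow> 'n heis set" where
  "hball \<xi>0 r = {\<xi>. cc_dist \<xi>0 \<xi> < r}"

definition ess_sup_on :: "'n::finite heis set \<Rightarrow> ('n heis \<Rightarrow> real) \<Rightarrow> ereal" where
  "ess_sup_on B f = esssup (restrict_space lebesgue B) (\<lambda>x. ereal (f x))"

definition ess_inf_on :: "'n::finite heis set \<Rightarrow> ('n heis \<Rightarrow> real) \<Rightarrow> ereal" where
  "ess_inf_on B f = - ess_sup_on B (\<lambda>x. - f x)"

definition Jp :: "real \<Rightarrow> real \<Rightarrow> real" where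
  "Jp l \<tau> = \<bar>\<tau>\<bar> powr (l - 2) * \<tau>"

definition Hfun :: "real \<Rightarrow> real \<Rightarrow> real \<Rightarrow> real \<Rightarrow> ('n::finite heis \<Rightarrow> 'n heis \<Rightarrow> real)
    \<Rightarrow> 'n heis \<Rightarrow> 'n heis \<Rightarrow> real \<Rightarrow> real" where
  "Hfun p q s t a \<xi> \<eta> \<tau> = \<tau> powr p / kern \<xi> \<eta> powr (s * p) + a \<xi> \<eta> * \<tau> powr q / kern \<xi> \<eta> powr (t * q)"

definition CC :: "'n::finite heis set \<Rightarrow> ('n heis \<times> 'n heis) set" where
  "CC \<Omega> = UNIV - ((UNIV - \<Omega>) \<times> (UNIV - \<Omega>))"

definition Aspace :: "real \<Rightarrow> real \<Rightarrow> real \<Rightarrow> real \<Rightarrow> ('n::finite heis \<Rightarrow> 'n heis \<Rightarrow> real)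
    \<Rightarrow> 'n heis set \<Rightarrow> ('n heis \<Rightarrow> real) set" where
  "Aspace p q s t a \<Omega> = {u. u \<in> borel_measurable lebesgue \<and>
      (\<integral>\<^sup>+ x. indicator \<Omega> x * ennreal (\<bar>u x\<bar> powr p) \<partial>lebesgue) < \<infinity> \<and>
      (\<integral>\<^sup>+ z. indicator (CC \<Omega>) z *
          ennreal (Hfun p q s t a (fst z) (snd z) \<bar>u (fst z) - u (snd z)\<bar>
                   / kern (fst z) (snd z) powr hdim TYPE('n)) \<partial>(lebesgue \<Otimes>\<^sub>M lebesgue)) < \<infinity>}"

definition tail_space :: "real \<Rightarrow> real \<Rightarrow> ('n::finite heis \<Rightarrow> real) set" where
  "tail_space l m = {u. u \<in> borel_measurable lebesgue \<and>
      (\<forall>K. compact K \<longrightarrow> (\<integral>\<^sup>+ x. indicator K x * ennreal (\<bar>u x\<bar> powr l) \<partial>lebesgue) < \<infinity>) \<and>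
      (\<integral>\<^sup>+ x. ennreal (\<bar>u x\<bar> powr l * (1 + hnorm x) powr (- hdim TYPE('n) - m)) \<partial>lebesgue) < \<infinity>}"

definition weak_solution :: "real \<Rightarrow> real \<Rightarrow> real \<Rightarrow> real \<Rightarrow> ('n::finite heis \<Rightarrow> 'n heis \<Rightarrow> real)
    \<Rightarrow> 'n heis set \<Rightarrow> ('n heis \<Rightarrow> real) \<Rightarrow> bool" where
  "weak_solution p q s t a \<Omega> u \<longleftrightarrow> u \<in> Aspace p q s t a \<Omega> \<and>
     (\<forall>\<phi> \<in> Aspace p q s t a \<Omega>. (AE x in lebesgue. x \<notin> \<Omega> \<longrightarrow> \<phi> x = 0) \<longrightarrow>
        set_lebesgue_integral (lebesgue \<Otimes>\<^sub>M lebesgue) (CC \<Omega>)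
          (\<lambda>z. Jp p (u (fst z) - u (snd z)) * (\<phi> (fst z) - \<phi> (snd z))
                  / kern (fst z) (snd z) powr (hdim TYPE('n) + s * p)
              + a (fst z) (snd z) * Jp q (u (fst z) - u (snd z)) * (\<phi> (fst z) - \<phi> (snd z))
                  / kern (fst z) (snd z) powr (hdim TYPE('n) + t * q)) = 0)"

definition a_sup_norm :: "('n::finite heis \<Rightarrow> 'n heis \<Rightarrow> real) \<Rightarrow> real" where
  "a_sup_norm a = real_of_ereal (esssup (lebesgue \<Otimes>\<^sub>M lebesgue) (\<lambda>z. ereal \<bar>a (fst z) (snd z)\<bar>))"

definition holder_cond :: "real \<Rightarrow> real \<Rightarrow> ('n::finite heis \<Rightarrow> 'n heis \<Rightarrow> real) \<Rightarrow> bool" where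
  "holder_cond \<alpha> C a \<longleftrightarrow> (\<forall>\<xi> \<eta> \<xi>' \<eta>'. \<bar>a \<xi> \<eta> - a \<xi>' \<eta>'\<bar> \<le> C * (kern \<xi> \<xi>' + kern \<eta> \<eta>') powr \<alpha>)"

definition a_holder :: "real \<Rightarrow> ('n::finite heis \<Rightarrow> 'n heis \<Rightarrow> real) \<Rightarrow> real" where
  "a_holder \<alpha> a = Inf {C. 0 \<le> C \<and> holder_cond \<alpha> C a}"

end

theory Submission
  imports Defs
begin

text \<open>Each step of the iteration is a nonlocal De Giorgi argument. After subtracting a constant and
  possibly changing the sign, u is a solution that is nonnegative in a ball and at least k on half of a
  much smaller concentric ball. The truncations below levels l \<le> k / 2 with a cutoff are admissible
  test functions; in the resulting identity the interaction with the set where u is at least k is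
  negative with a fixed size, beats the nonlocal tails (the ratio of the two radii is small), and makes
  the sublevel sets of level \<delta> k small. The interaction of a small sublevel set with its own complement gives the
  superlinear gain that replaces the Sobolev inequality, so the De Giorgi iteration yields u \<ge> \<delta> k on
  half of the smaller ball. The oscillation thus shrinks by the factor 1 - \<delta> / 2. Since constants are
  allowed to depend on the supremum of u, levels above it are trivial and the two phases are
  comparable up to the value of the coefficient at the center.\<close>

section \<open>The homogeneous metric and its balls\<close>

text \<open>The obstacle is that the two phases scale differently and the coefficient varies, so no
  single power measures the energy of a level. The excess of the coefficient over \<open>am\<close>
  is of order R^\<alpha> and is paid by the p-phase; the price depends on the radii only through R /
  \<rho>, which keeps all constants independent of the scale.

  The cutoff sits inside the level instead of multiplying a truncation: where the test function is
  positive, v is the level minus the test function, and one inequality for \<open>Jp\<close> serves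
  both exponents.

  The tails see all earlier balls at once, which forces a strong induction with the same rate at
  every scale. In that induction the bounds on the oscillation grow like the power \<beta> of the
  distance, and \<beta> (q - 1) \<le> s p / 2 leaves half of the decay of the kernel for
  convergence. Beyond the first ball, only the integrals that enter \<omega>0 control u.\<close>

lemma sigma_finite_lebesgue: "sigma_finite_measure (lebesgue :: 'a::euclidean_space measure)"
proof
  obtain A :: "'a set set" where A: "countable A" "A \<subseteq> sets lborel" "\<Union>A = space lborel"
      "\<forall>a\<in>A. emeasure lborel a \<noteq> \<infinity>"
    using lborel.sigma_finite_countable by blast
  show "\<exists>A::'a set set. countable A \<and> A \<subseteq> sets lebesgue \<and> \<Union>A = space lebesgue \<and> (\<forall>a\<in>A. emeasure lebesgue a \<noteq> \<infinity>)"
    by (rule exI[of _ A]) (use A in \<open>auto simp: subset_eq\<close>)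
qed

interpretation lebesgue: sigma_finite_measure "lebesgue :: 'a::euclidean_space measure"
  by (rule sigma_finite_lebesgue)

interpretation lebesgue_pair: pair_sigma_finite "lebesgue :: 'a::euclidean_space measure" "lebesgue :: 'b::euclidean_space measure" ..

text \<open>This is the Cauchy-Schwarz inequality for the Hermitian product of z = x + iy and z' =
  x' + iy', whose real part is P and whose imaginary part is W up to sign. The real inequality
  suffices once z is tested against w = (P - iW) z'.\<close>

lemma inner_symplectic_bound:
  fixes x y x' y' :: "'a::real_inner"
  shows "(x \<bullet> x' + y \<bullet> y')\<^sup>2 + (x \<bullet> y' - y \<bullet> x')\<^sup>2 \<le> ((norm x)\<^sup>2 + (norm y)\<^sup>2) * ((norm x')\<^sup>2 + (norm y')\<^sup>2)"
proof -
  define P W where "P = x \<bullet> x' + y \<bullet> y'" and "W = x \<bullet> y' - y \<bullet> x'"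
  define v w where "v = (x, y)" and "w = (P *\<^sub>R x' + W *\<^sub>R y', P *\<^sub>R y' - W *\<^sub>R x')"
  have vw: "v \<bullet> w = P\<^sup>2 + W\<^sup>2"
    by (simp add: v_def w_def inner_prod_def inner_simps P_def W_def power2_eq_square algebra_simps inner_commute)
  have ww: "w \<bullet> w = (P\<^sup>2 + W\<^sup>2) * (x' \<bullet> x' + y' \<bullet> y')"
    by (simp add: w_def inner_prod_def inner_simps power2_eq_square algebra_simps inner_commute)
  have vv: "v \<bullet> v = x \<bullet> x + y \<bullet> y"
    by (simp add: v_def inner_prod_def)
  have "(P\<^sup>2 + W\<^sup>2)\<^sup>2 \<le> (P\<^sup>2 + W\<^sup>2) * ((x \<bullet> x + y \<bullet> y) * (x' \<bullet> x' + y' \<bullet> y'))"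
    using Cauchy_Schwarz_ineq[of v w] unfolding vw ww vv by (simp add: mult_ac)
  hence *: "(P\<^sup>2 + W\<^sup>2) * (P\<^sup>2 + W\<^sup>2) \<le> (P\<^sup>2 + W\<^sup>2) * ((x \<bullet> x + y \<bullet> y) * (x' \<bullet> x' + y' \<bullet> y'))"
    by (simp only: power2_eq_square)
  show ?thesis
  proof (cases "P\<^sup>2 + W\<^sup>2 > 0")
    case True
    from * have "P\<^sup>2 + W\<^sup>2 \<le> (x \<bullet> x + y \<bullet> y) * (x' \<bullet> x' + y' \<bullet> y')"
      using True by (simp only: mult_le_cancel_left_pos)
    thus ?thesis unfolding P_def W_def by (simp only: dot_square_norm)
  next
    case False
    moreover have "0 \<le> ((norm x)\<^sup>2 + (norm y)\<^sup>2) * ((norm x')\<^sup>2 + (norm y')\<^sup>2)"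
      by simp
    ultimately show ?thesis unfolding P_def[symmetric] W_def[symmetric] by linarith
  qed
qed

lemma hmult_eq: "hmult (x, y, \<tau>) (x', y', \<tau>') = (x + x', y + y', \<tau> + \<tau>' + (x \<bullet> y' - y \<bullet> x') / 2)"
  by (simp add: hmult_def inner_vec_def sum_subtractf)

lemma hinv_eq: "hinv (x, y, \<tau>) = (-x, -y, -\<tau>)"
  by (simp add: hinv_def)

lemma horiz_eq: "horiz (x, y, \<tau>) (a, b) = (a, b, (x \<bullet> b - y \<bullet> a) / 2)"
  by (simp add: horiz_def inner_vec_def sum_subtractf)

lemma hmult_assoc: "hmult (hmult a b) c = hmult a (hmult b c)"
  by (cases a; cases b; cases c) (simp add: hmult_eq inner_simps field_simps)

lemma hmult_hinv [simp]: "hmult a (hinv a) = 0" "hmult (hinv a) a = 0"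
  by (cases a; simp add: hmult_eq hinv_eq inner_commute zero_prod_def)+

lemma hmult_0 [simp]: "hmult 0 a = a" "hmult a 0 = a"
  by (cases a; simp add: hmult_eq zero_prod_def)+

lemma hmult_hinv_cancel [simp]: "hmult a (hmult (hinv a) b) = b" "hmult (hinv a) (hmult a b) = b"
  by (simp_all flip: hmult_assoc)

lemma hinv_hinv [simp]: "hinv (hinv a) = a"
  by (cases a) (simp add: hinv_eq)

lemma hinv_hmult: "hinv (hmult a b) = hmult (hinv b) (hinv a)"
  by (cases a; cases b) (simp add: hmult_eq hinv_eq inner_commute field_simps)

text \<open>With the square of the gauge written as the modulus of |z|^2 + i \<tau>, the triangle
  inequality for complex numbers becomes available.\<close>

lemma hnorm_conv_cmod: "hnorm (x, y, \<tau>) = sqrt (cmod (Complex ((norm x)\<^sup>2 + (norm y)\<^sup>2) \<tau>))"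
  by (simp add: hnorm_def cmod_def powr_half_sqrt[symmetric] powr_powr)

lemma hnorm_nonneg [simp]: "0 \<le> hnorm a"
  by (simp add: hnorm_def split: prod.split)

lemma hnorm_hinv [simp]: "hnorm (hinv a) = hnorm a"
  by (cases a) (simp add: hinv_eq hnorm_def)

text \<open>In complex form the group law adds 2P + iW/2 to the sum of the two numbers. The
  Hermitian inequality bounds the modulus of this cross term by twice the product of the gauges,
  which is the mixed term of a square. So the gauge gives a true metric and no quasi-triangle
  constant appears later.\<close>

lemma hnorm_triangle: "hnorm (hmult a b) \<le> hnorm a + hnorm b"
proof -
  obtain x y \<tau> where a: "a = (x, y, \<tau>)" by (cases a)
  obtain x' y' \<tau>' where b: "b = (x', y', \<tau>')" by (cases b)
  define A where "A = (norm x)\<^sup>2 + (norm y)\<^sup>2"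
  define B where "B = (norm x')\<^sup>2 + (norm y')\<^sup>2"
  define P W where "P = x \<bullet> x' + y \<bullet> y'" and "W = x \<bullet> y' - y \<bullet> x'"
  have AB: "A \<ge> 0" "B \<ge> 0" by (simp_all add: A_def B_def)
  have PW: "P\<^sup>2 + W\<^sup>2 \<le> A * B"
    unfolding P_def W_def A_def B_def by (rule inner_symplectic_bound)
  have "(norm (x + x'))\<^sup>2 + (norm (y + y'))\<^sup>2 = A + B + 2 * P"
    by (simp add: A_def B_def P_def inner_simps power2_norm_eq_inner inner_commute algebra_simps)
  hence eq: "Complex ((norm (x + x'))\<^sup>2 + (norm (y + y'))\<^sup>2) (\<tau> + \<tau>' + W / 2)
      = Complex A \<tau> + Complex B \<tau>' + Complex (2 * P) (W / 2)"
    by (simp add: complex_eq_iff)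
  have "cmod (Complex (2 * P) (W / 2)) \<le> 2 * sqrt (A * B)"
  proof -
    have "(2 * P)\<^sup>2 + (W / 2)\<^sup>2 \<le> 4 * (A * B)"
      proof -
      have "(2 * P)\<^sup>2 + (W / 2)\<^sup>2 = 4 * P\<^sup>2 + W\<^sup>2 / 4" by (simp add: power_mult_distrib power_divide)
      also have "\<dots> \<le> 4 * (P\<^sup>2 + W\<^sup>2)" by simp
      also have "\<dots> \<le> 4 * (A * B)" by (intro mult_left_mono PW) simp
      finally show ?thesis .
    qed
    hence "sqrt ((2 * P)\<^sup>2 + (W / 2)\<^sup>2) \<le> sqrt (4 * (A * B))" by simp
    thus ?thesis by (simp add: cmod_def real_sqrt_mult)
  qed
  also have "\<dots> = 2 * sqrt A * sqrt B" by (simp add: real_sqrt_mult)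
  also have "\<dots> \<le> 2 * hnorm a * hnorm b"
  proof -
    have "A \<le> cmod (Complex A \<tau>)" "B \<le> cmod (Complex B \<tau>')"
      using abs_Re_le_cmod[of "Complex A \<tau>"] abs_Re_le_cmod[of "Complex B \<tau>'"] AB by auto
    thus ?thesis using AB unfolding a b hnorm_conv_cmod A_def B_def
      by (intro mult_mono) auto
  qed
  finally have 1: "cmod (Complex (2 * P) (W / 2)) \<le> 2 * hnorm a * hnorm b" .
  have "(hnorm (hmult a b))\<^sup>2 = cmod (Complex A \<tau> + Complex B \<tau>' + Complex (2 * P) (W / 2))"
    unfolding a b hmult_eq hnorm_conv_cmod W_def[symmetric] eq by simp
  also have "\<dots> \<le> cmod (Complex A \<tau>) + cmod (Complex B \<tau>') + cmod (Complex (2 * P) (W / 2))"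
    using norm_triangle_ineq[of "Complex A \<tau> + Complex B \<tau>'" "Complex (2 * P) (W / 2)"]
      norm_triangle_ineq[of "Complex A \<tau>" "Complex B \<tau>'"] by linarith
  also have "cmod (Complex A \<tau>) = (hnorm a)\<^sup>2" by (simp add: a hnorm_conv_cmod A_def)
  also have "cmod (Complex B \<tau>') = (hnorm b)\<^sup>2" by (simp add: b hnorm_conv_cmod B_def)
  finally have "(hnorm (hmult a b))\<^sup>2 \<le> (hnorm a + hnorm b)\<^sup>2"
    using 1 by (simp add: power2_eq_square algebra_simps)
  thus ?thesis by (rule power2_le_imp_le) simp
qed

lemma hnorm_eq_0_iff: "hnorm a = 0 \<longleftrightarrow> a = 0"
  by (cases a) (auto simp: hnorm_conv_cmod complex_eq_iff zero_prod_def sum_power2_eq_zero_iff)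

lemma kern_nonneg [simp]: "0 \<le> kern x y"
  by (simp add: kern_def)

lemma kern_commute: "kern x y = kern y x"
  using hnorm_hinv[of "hmult (hinv y) x"] by (simp add: kern_def hinv_hmult)

lemma kern_triangle: "kern x z \<le> kern x y + kern y z"
proof -
  have "hmult (hinv z) x = hmult (hmult (hinv z) y) (hmult (hinv y) x)"
    by (simp add: hmult_assoc)
  thus ?thesis using hnorm_triangle[of "hmult (hinv z) y" "hmult (hinv y) x"] by (simp add: kern_def)
qed

lemma kern_self [simp]: "kern x x = 0"
  by (simp add: kern_def hnorm_eq_0_iff)

lemma kern_eq_0_iff: "kern x y = 0 \<longleftrightarrow> x = y"
  by (metis hmult_0(2) hmult_hinv_cancel(1) hnorm_eq_0_iff kern_def)

lemma continuous_hnorm: "continuous_on UNIV (hnorm :: 'n::finite heis \<Rightarrow> real)"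
proof -
  have eq: "hnorm = (\<lambda>a::'n heis. sqrt (sqrt (((norm (fst a))\<^sup>2 + (norm (fst (snd a)))\<^sup>2)\<^sup>2 + (snd (snd a))\<^sup>2)))"
    by (auto simp: hnorm_conv_cmod cmod_def fun_eq_iff)
  show ?thesis by (subst eq) (intro continuous_intros)
qed

lemma continuous_hmult: "continuous_on UNIV (\<lambda>z. hmult (f z) (g z) :: 'n::finite heis)"
  if "continuous_on UNIV f" "continuous_on UNIV g"
proof -
  have eq: "(\<lambda>z. hmult (f z) (g z)) = (\<lambda>z. (fst (f z) + fst (g z), fst (snd (f z)) + fst (snd (g z)),
      snd (snd (f z)) + snd (snd (g z)) + (fst (f z) \<bullet> fst (snd (g z)) - fst (snd (f z)) \<bullet> fst (g z)) / 2))"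
  proof
    fix z
    show "hmult (f z) (g z) = (fst (f z) + fst (g z), fst (snd (f z)) + fst (snd (g z)),
      snd (snd (f z)) + snd (snd (g z)) + (fst (f z) \<bullet> fst (snd (g z)) - fst (snd (f z)) \<bullet> fst (g z)) / 2)"
      by (cases "f z"; cases "g z") (simp add: hmult_eq)
  qed
  show ?thesis by (subst eq) (intro continuous_intros that; simp)
qed

lemma hinv_eq_uminus: "hinv = uminus"
  by (auto simp: hinv_eq fun_eq_iff)

lemma continuous_kern: "continuous_on UNIV (\<lambda>z. kern (f z) (g z) :: real)"
  if "continuous_on UNIV f" "continuous_on UNIV g" for f :: "'a::topological_space \<Rightarrow> 'n::finite heis"
  unfolding kern_def
  by (rule continuous_on_compose2[OF continuous_hnorm continuous_hmult])
     (use that in \<open>auto simp: hinv_eq_uminus intro!: continuous_intros\<close>)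

text \<open>Gauge balls carry the analysis because they are explicit in coordinates and easily
  compared with boxes; Carnot-Caratheodory balls enter only through inclusions.\<close>

definition kball :: "'n::finite heis \<Rightarrow> real \<Rightarrow> 'n heis set" where
  "kball x d = {y. kern y x < d}"

lemma open_kball: "open (kball (x::'n::finite heis) d)"
  unfolding kball_def
  by (intro open_Collect_less continuous_kern continuous_intros)

lemma measurable_lebesgue_borel: "f \<in> borel_measurable borel \<Longrightarrow> f \<in> borel_measurable lebesgue"
  by (simp add: measurable_completion)

lemma sets_kball [measurable]: "kball x d \<in> sets lebesgue"
  using open_kball[of x d] by (simp add: borel_open)

lemma id_borel_lebesgue [measurable]: "(\<lambda>x. x) \<in> lebesgue \<rightarrow>\<^sub>M borel"
  by (simp add: measurable_completion)

lemma kern_measurable_pair [measurable]: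
  "(\<lambda>z. kern (fst z) (snd z)) \<in> borel_measurable (lebesgue \<Otimes>\<^sub>M (lebesgue :: 'n::finite heis measure))"
proof -
  have 1: "(\<lambda>z::('n heis\<times>'n heis). kern (fst z) (snd z)) \<in> borel_measurable (borel \<Otimes>\<^sub>M borel)"
    unfolding borel_prod by (intro borel_measurable_continuous_onI continuous_kern continuous_intros)
  have 2: "(\<lambda>z. (fst z, snd z)) \<in> lebesgue \<Otimes>\<^sub>M (lebesgue :: 'n heis measure) \<rightarrow>\<^sub>M borel \<Otimes>\<^sub>M (borel :: 'n heis measure)"
    by (intro measurable_Pair measurable_compose[OF measurable_fst id_borel_lebesgue] measurable_compose[OF measurable_snd id_borel_lebesgue])
  from measurable_compose[OF 2 1] show ?thesis by simp
qed

lemma kern_measurable [measurable]: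
  "(\<lambda>y. kern y x) \<in> borel_measurable (lebesgue :: 'n::finite heis measure)"
  "(\<lambda>y. kern x y) \<in> borel_measurable (lebesgue :: 'n::finite heis measure)"
  by (rule measurable_lebesgue_borel, intro borel_measurable_continuous_onI continuous_kern continuous_intros)+

section \<open>Invariance of the measure under left translation and volumes of balls\<close>

lemma nn_integral_lborel_shift:
  fixes f :: "'a::euclidean_space \<Rightarrow> ennreal"
  assumes [measurable]: "f \<in> borel_measurable borel"
  shows "(\<integral>\<^sup>+x. f (c + x) \<partial>lborel) = (\<integral>\<^sup>+x. f x \<partial>lborel)"
proof -
  have "(\<integral>\<^sup>+x. f x \<partial>lborel) = (\<integral>\<^sup>+x. f x \<partial>distr lborel borel ((+) c))"
    by (simp add: lborel_distr_plus)
  also have "\<dots> = (\<integral>\<^sup>+x. f (c + x) \<partial>lborel)"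
    by (rule nn_integral_distr) auto
  finally show ?thesis ..
qed

lemma nn_integral_lborel_triple:
  fixes f :: "'a::euclidean_space \<times> 'b::euclidean_space \<times> 'c::euclidean_space \<Rightarrow> ennreal"
  assumes [measurable]: "f \<in> borel_measurable borel"
  shows "(\<integral>\<^sup>+z. f z \<partial>lborel) = (\<integral>\<^sup>+x. \<integral>\<^sup>+y. \<integral>\<^sup>+w. f (x, y, w) \<partial>lborel \<partial>lborel \<partial>lborel)"
proof -
  have f: "f \<in> borel_measurable (lborel \<Otimes>\<^sub>M lborel)"
    by (simp add: lborel_prod)
  have g: "(\<lambda>z. f (x, z)) \<in> borel_measurable (lborel \<Otimes>\<^sub>M lborel)" for x
    by (simp add: lborel_prod) measurable
  have "(\<integral>\<^sup>+z. f z \<partial>lborel) = (\<integral>\<^sup>+z. f z \<partial>(lborel \<Otimes>\<^sub>M lborel))"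
    by (simp add: lborel_prod)
  also have "\<dots> = (\<integral>\<^sup>+x. \<integral>\<^sup>+z. f (x, z) \<partial>lborel \<partial>lborel)"
    by (rule lborel.nn_integral_fst[OF f, symmetric])
  also have "\<dots> = (\<integral>\<^sup>+x. \<integral>\<^sup>+z. f (x, z) \<partial>(lborel \<Otimes>\<^sub>M lborel) \<partial>lborel)"
    by (simp add: lborel_prod)
  also have "\<dots> = (\<integral>\<^sup>+x. \<integral>\<^sup>+y. \<integral>\<^sup>+w. f (x, y, w) \<partial>lborel \<partial>lborel \<partial>lborel)"
    by (subst lborel.nn_integral_fst[OF g, symmetric]) simp
  finally show ?thesis .
qed

text \<open>In coordinates a left translation shifts (x, y) and moves the last variable by an amount
  that depends on (x, y) alone. Integrating the last variable first removes this shear, and only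
  shifts remain.\<close>

lemma nn_integral_hmult:
  fixes f :: "'n::finite heis \<Rightarrow> ennreal"
  assumes f [measurable]: "f \<in> borel_measurable borel"
  shows "(\<integral>\<^sup>+z. f (hmult a z) \<partial>lborel) = (\<integral>\<^sup>+z. f z \<partial>lborel)"
proof -
  obtain x0 y0 t0 where a: "a = (x0, y0, t0)" by (cases a)
  have "(\<lambda>z. hmult a z) \<in> borel_measurable borel"
    by (intro borel_measurable_continuous_onI continuous_hmult continuous_intros)
  from measurable_compose[OF this f] have m0: "(\<lambda>z. f (hmult a z)) \<in> borel_measurable borel" .
  have m1: "(\<lambda>w. f (x, y, w)) \<in> borel_measurable borel" for x y
    by (rule measurable_compose[OF _ f]) (intro borel_measurable_continuous_onI continuous_intros)
  have g1: "(\<lambda>(x, y). \<integral>\<^sup>+w. f (x, y, w) \<partial>lborel) \<in> borel_measurable (borel \<Otimes>\<^sub>M borel)"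
  proof -
    have "(\<lambda>z. f (fst (fst z), snd (fst z), snd z)) \<in> borel_measurable borel"
      by (rule measurable_compose[OF _ f]) (intro borel_measurable_continuous_onI continuous_intros)
    moreover have "sets ((borel \<Otimes>\<^sub>M borel) \<Otimes>\<^sub>M lborel) = sets (borel :: (((real^'n) \<times> (real^'n)) \<times> real) measure)"
      by (rule trans[OF sets_pair_measure_cong[OF refl sets_lborel]]) (simp only: borel_prod)
    ultimately have "(\<lambda>z. f (fst (fst z), snd (fst z), snd z)) \<in> borel_measurable ((borel \<Otimes>\<^sub>M borel) \<Otimes>\<^sub>M lborel)"
      using measurable_cong_sets by blast
    from lborel.borel_measurable_nn_integral_fst[OF this] show ?thesis by (simp add: split_beta)
  qed
  have m2: "(\<lambda>y. \<integral>\<^sup>+w. f (x, y, w) \<partial>lborel) \<in> borel_measurable borel" for x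
    using measurable_Pair2[OF g1, of x] by simp
  have m3: "(\<lambda>x. \<integral>\<^sup>+y. \<integral>\<^sup>+w. f (x, y, w) \<partial>lborel \<partial>lborel) \<in> borel_measurable borel"
  proof -
    have "(\<lambda>(x, y). \<integral>\<^sup>+w. f (x, y, w) \<partial>lborel) \<in> borel_measurable (borel \<Otimes>\<^sub>M lborel)"
      using g1 measurable_cong_sets[OF sets_pair_measure_cong[OF refl sets_lborel] refl] by blast
    from lborel.borel_measurable_nn_integral_fst[OF this] show ?thesis by simp
  qed
  have "(\<integral>\<^sup>+z. f (hmult a z) \<partial>lborel)
      = (\<integral>\<^sup>+x. \<integral>\<^sup>+y. \<integral>\<^sup>+w. f (x0 + x, y0 + y, (t0 + (x0 \<bullet> y - y0 \<bullet> x) / 2) + w) \<partial>lborel \<partial>lborel \<partial>lborel)"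
  proof -
    have "hmult a (x, y, w) = (x0 + x, y0 + y, (t0 + (x0 \<bullet> y - y0 \<bullet> x) / 2) + w)" for x y w
      by (simp add: a hmult_eq)
    thus ?thesis unfolding nn_integral_lborel_triple[OF m0] by (simp only:)
  qed
  also have "\<dots> = (\<integral>\<^sup>+x. \<integral>\<^sup>+y. \<integral>\<^sup>+w. f (x0 + x, y0 + y, w) \<partial>lborel \<partial>lborel \<partial>lborel)"
    proof (rule nn_integral_cong, rule nn_integral_cong)
    fix x y
    show "(\<integral>\<^sup>+w. f (x0 + x, y0 + y, (t0 + (x0 \<bullet> y - y0 \<bullet> x) / 2) + w) \<partial>lborel) = (\<integral>\<^sup>+w. f (x0 + x, y0 + y, w) \<partial>lborel)"
      by (rule nn_integral_lborel_shift[where f="\<lambda>w. f (x0 + x, y0 + y, w)"]) (rule m1)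
  qed
  also have "\<dots> = (\<integral>\<^sup>+x. \<integral>\<^sup>+y. \<integral>\<^sup>+w. f (x0 + x, y, w) \<partial>lborel \<partial>lborel \<partial>lborel)"
    proof (rule nn_integral_cong)
    fix x
    show "(\<integral>\<^sup>+y. \<integral>\<^sup>+w. f (x0 + x, y0 + y, w) \<partial>lborel \<partial>lborel) = (\<integral>\<^sup>+y. \<integral>\<^sup>+w. f (x0 + x, y, w) \<partial>lborel \<partial>lborel)"
      by (rule nn_integral_lborel_shift[where f="\<lambda>y. \<integral>\<^sup>+w. f (x0 + x, y, w) \<partial>lborel"]) (rule m2)
  qed
  also have "\<dots> = (\<integral>\<^sup>+x. \<integral>\<^sup>+y. \<integral>\<^sup>+w. f (x, y, w) \<partial>lborel \<partial>lborel \<partial>lborel)"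
    by (rule nn_integral_lborel_shift[where f="\<lambda>x. \<integral>\<^sup>+y. \<integral>\<^sup>+w. f (x, y, w) \<partial>lborel \<partial>lborel"]) (rule m3)
  also have "\<dots> = (\<integral>\<^sup>+z. f z \<partial>lborel)"
    by (rule nn_integral_lborel_triple[symmetric]) (rule f)
  finally show ?thesis .
qed

lemma emeasure_kball_translate: "emeasure lebesgue (kball (x::'n::finite heis) d) = emeasure lborel (kball (0::'n heis) d)"
proof -
  have b [measurable]: "kball y d \<in> sets borel" for y :: "'n heis"
    using open_kball by (rule borel_open)
  have "emeasure lebesgue (kball x d) = (\<integral>\<^sup>+z. indicator (kball x d) z \<partial>lborel)"
    using b[of x] by simp
  also have "\<dots> = (\<integral>\<^sup>+z. indicator (kball 0 d) (hmult (hinv x) z) \<partial>lborel)"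
    by (intro nn_integral_cong) (auto simp: indicator_def kball_def kern_def hinv_eq_uminus)
  also have "\<dots> = (\<integral>\<^sup>+z. indicator (kball (0::'n heis) d) z \<partial>lborel)"
    by (rule nn_integral_hmult[where f="indicator (kball (0::'n heis) d)"]) (simp add: b)
  also have "\<dots> = emeasure lborel (kball (0::'n heis) d)"
    using b[of 0] by simp
  finally show ?thesis .
qed

text \<open>The measure of the product of two unit balls of R^n with (-1, 1). Stretching this box by
  d, d and d^2 multiplies its measure by d^Q, so boxes of this shape stand in for gauge
  balls.\<close>

definition kvol :: "'n::finite itself \<Rightarrow> real" where
  "kvol _ = 2 * (unit_ball_vol (real CARD('n)))\<^sup>2"

lemma kvol_pos: "kvol TYPE('n::finite) > 0"
  unfolding kvol_def by (intro mult_pos_pos zero_less_power unit_ball_vol_pos) auto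

lemma hdim_pos: "hdim TYPE('n::finite) > 0" "hdim TYPE('n) \<ge> 4"
proof -
  have "CARD('n) \<ge> 1" using zero_less_card_finite[where 'a='n] by linarith
  hence "real CARD('n) \<ge> 1" by linarith
  thus "hdim TYPE('n::finite) > 0" "hdim TYPE('n) \<ge> 4" unfolding hdim_def by linarith+
qed

lemma emeasure_box3:
  assumes "d \<ge> 0" "e \<ge> 0"
  shows "emeasure lborel (ball (0::real^'n) d \<times> ball (0::real^'n) d \<times> ball (0::real) e)
    = ennreal (kvol TYPE('n::finite) * d ^ (2 * CARD('n)) * e)"
proof -
  have "emeasure lborel (ball (0::real^'n) d \<times> ball (0::real^'n) d \<times> ball (0::real) e)
     = emeasure (lborel \<Otimes>\<^sub>M (lborel \<Otimes>\<^sub>M lborel)) (ball (0::real^'n) d \<times> ball (0::real^'n) d \<times> ball (0::real) e)"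
    by (simp only: lborel_prod)
  also have "\<dots> = emeasure lborel (ball (0::real^'n) d) * emeasure (lborel \<Otimes>\<^sub>M lborel) (ball (0::real^'n) d \<times> ball (0::real) e)"
  proof (rule lborel_pair.P.emeasure_pair_measure_Times)
    show "ball (0::real^'n) d \<times> ball (0::real) e \<in> sets (lborel \<Otimes>\<^sub>M lborel)"
      unfolding lborel_prod by (simp add: borel_open open_Times)
  qed simp
  also have "emeasure (lborel \<Otimes>\<^sub>M lborel) (ball (0::real^'n) d \<times> ball (0::real) e)
      = emeasure lborel (ball (0::real^'n) d) * emeasure lborel (ball (0::real) e)"
    by (rule lborel.emeasure_pair_measure_Times) simp_all
  also have "emeasure lborel (ball (0::real) e) = ennreal (2 * e)"
    using assms by (simp add: ball_eq_greaterThanLessThan)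
  also have "emeasure lborel (ball (0::real^'n) d) = ennreal (unit_ball_vol (real CARD('n)) * d ^ CARD('n))"
    using assms by (simp add: emeasure_ball)
  finally have "emeasure lborel (ball (0::real^'n) d \<times> ball (0::real^'n) d \<times> ball (0::real) e)
      = ennreal (unit_ball_vol (real CARD('n)) * d ^ CARD('n)) * (ennreal (unit_ball_vol (real CARD('n)) * d ^ CARD('n)) * ennreal (2 * e))" .
  also have "\<dots> = ennreal (unit_ball_vol (real CARD('n)) * d ^ CARD('n) * (unit_ball_vol (real CARD('n)) * d ^ CARD('n) * (2 * e)))"
  proof -
    have "unit_ball_vol (real CARD('n)) * d ^ CARD('n) \<ge> 0" "2 * e \<ge> 0"
      using assms by (simp_all add: unit_ball_vol_nonneg)
    thus ?thesis by (metis ennreal_mult mult_nonneg_nonneg)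
  qed
  also have "unit_ball_vol (real CARD('n)) * d ^ CARD('n) * (unit_ball_vol (real CARD('n)) * d ^ CARD('n) * (2 * e))
      = kvol TYPE('n) * d ^ (2 * CARD('n)) * e"
    unfolding kvol_def mult_2[of "CARD('n)"] power_add power2_eq_square by (simp only: mult_ac)
  finally show ?thesis .
qed

lemma hnorm_less_iff: "d > 0 \<Longrightarrow> hnorm (x, y, \<tau>) < d \<longleftrightarrow> ((norm x)\<^sup>2 + (norm y)\<^sup>2)\<^sup>2 + \<tau>\<^sup>2 < d ^ 4"
proof -
  assume d: "d > 0"
  let ?E = "((norm x)\<^sup>2 + (norm y)\<^sup>2)\<^sup>2 + \<tau>\<^sup>2"
  have "hnorm (x, y, \<tau>) = sqrt (sqrt ?E)" by (simp add: hnorm_conv_cmod cmod_def)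
  moreover have "d = sqrt (sqrt (d ^ 4))"
  proof -
    have "d ^ 4 = (d\<^sup>2)\<^sup>2" by (simp flip: power_mult)
    hence "sqrt (d ^ 4) = d\<^sup>2" by (metis real_sqrt_unique zero_le_power2)
    thus ?thesis using d by simp
  qed
  ultimately show ?thesis by (metis real_sqrt_less_iff)
qed

lemma powr_hdim: "d > 0 \<Longrightarrow> d powr hdim TYPE('n::finite) = d ^ (2 * CARD('n)) * d\<^sup>2"
proof -
  assume "d > 0"
  have "hdim TYPE('n) = real (2 * CARD('n) + 2)" by (simp add: hdim_def)
  thus ?thesis using \<open>d > 0\<close> by (simp only: powr_realpow power_add)
qed

lemma kball_0: "kball 0 d = {y. hnorm y < d}"
  by (simp add: kball_def kern_def hinv_eq_uminus)

lemma emeasure_kball_le: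
  assumes "d > 0" shows "emeasure lebesgue (kball (x::'n::finite heis) d) \<le> ennreal (kvol TYPE('n) * d powr hdim TYPE('n))"
proof -
  have "kball (0::'n heis) d \<subseteq> ball 0 d \<times> ball 0 d \<times> ball 0 (d\<^sup>2)"
  proof safe
    fix x y :: "real^'n" and \<tau> assume "(x, y, \<tau>) \<in> kball 0 d"
    hence *: "((norm x)\<^sup>2 + (norm y)\<^sup>2)\<^sup>2 + \<tau>\<^sup>2 < d ^ 4"
      using assms by (simp add: kball_0 hnorm_less_iff)
    have d4: "d ^ 4 = (d\<^sup>2)\<^sup>2" by (simp flip: power_mult)
    have "0 \<le> \<tau>\<^sup>2" "0 \<le> ((norm x)\<^sup>2 + (norm y)\<^sup>2)\<^sup>2" by simp_all
    with * have "((norm x)\<^sup>2 + (norm y)\<^sup>2)\<^sup>2 < (d\<^sup>2)\<^sup>2" "\<bar>\<tau>\<bar>\<^sup>2 < (d\<^sup>2)\<^sup>2"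
      unfolding power2_abs d4 by linarith+
    hence 1: "(norm x)\<^sup>2 + (norm y)\<^sup>2 < d\<^sup>2" "\<bar>\<tau>\<bar> < d\<^sup>2"
      by (auto intro: power2_less_imp_less[where y="d\<^sup>2"])
    moreover have "0 \<le> (norm x)\<^sup>2" "0 \<le> (norm y)\<^sup>2" by simp_all
    ultimately have "(norm x)\<^sup>2 < d\<^sup>2" "(norm y)\<^sup>2 < d\<^sup>2" by linarith+
    hence "norm x < d" "norm y < d"
      using assms by (auto intro: power2_less_imp_less)
    thus "x \<in> ball 0 d" "y \<in> ball 0 d" "\<tau> \<in> ball 0 (d\<^sup>2)"
      using 1 by auto
  qed
  hence "emeasure lborel (kball (0::'n heis) d) \<le> emeasure lborel (ball (0::real^'n) d \<times> ball (0::real^'n) d \<times> ball (0::real) (d\<^sup>2))"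
    by (rule emeasure_mono) (simp, intro borel_open open_Times open_ball)
  thus ?thesis using assms unfolding emeasure_kball_translate by (simp add: emeasure_box3 powr_hdim mult_ac)
qed

text \<open>The inscribed box has vertical half-length 2 d^2 instead of d^2. The resulting factor 2
  is used twice in \<open>pair_neg_lower_bound\<close>: a ball is made to have twice the measure of
  S, and the loss of one half in \<open>v_large\<close> is compensated.\<close>

lemma emeasure_kball_ge:
  assumes "d > 0" shows "emeasure lebesgue (kball (x::'n::finite heis) (2 * d)) \<ge> ennreal (2 * kvol TYPE('n) * d powr hdim TYPE('n))"
proof -
  have "ball 0 d \<times> ball 0 d \<times> ball 0 (2 * d\<^sup>2) \<subseteq> kball (0::'n heis) (2 * d)"
  proof safe
    fix x y :: "real^'n" and \<tau> :: real assume "x \<in> ball 0 d" "y \<in> ball 0 d" "\<tau> \<in> ball 0 (2 * d\<^sup>2)"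
    hence *: "norm x < d" "norm y < d" "\<bar>\<tau>\<bar> < 2 * d\<^sup>2" by auto
    have "(norm x)\<^sup>2 + (norm y)\<^sup>2 \<le> d\<^sup>2 + d\<^sup>2"
      using * by (intro add_mono power_mono) auto
    hence "((norm x)\<^sup>2 + (norm y)\<^sup>2)\<^sup>2 \<le> (2 * d\<^sup>2)\<^sup>2"
      by (intro power_mono) auto
    moreover have "\<bar>\<tau>\<bar>\<^sup>2 < (2 * d\<^sup>2)\<^sup>2" using * by (intro power_strict_mono) auto
    moreover have "(2 * d\<^sup>2)\<^sup>2 = 4 * d ^ 4" by (simp add: power_mult_distrib flip: power_mult)
    moreover have "(2 * d) ^ 4 = 16 * d ^ 4" by (simp add: power_mult_distrib)
    moreover have "d ^ 4 > 0" using assms by simp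
    ultimately have "((norm x)\<^sup>2 + (norm y)\<^sup>2)\<^sup>2 + \<tau>\<^sup>2 < (2 * d) ^ 4"
      by (simp only: power2_abs)
    thus "(x, y, \<tau>) \<in> kball 0 (2 * d)"
      using assms by (simp add: kball_0 hnorm_less_iff)
  qed
  hence "emeasure lborel (ball (0::real^'n) d \<times> ball (0::real^'n) d \<times> ball (0::real) (2 * d\<^sup>2)) \<le> emeasure lborel (kball (0::'n heis) (2 * d))"
    by (rule emeasure_mono) (simp add: borel_open open_kball)
  thus ?thesis using assms unfolding emeasure_kball_translate by (simp add: emeasure_box3 powr_hdim mult_ac)
qed

section \<open>Integrals of powers of the distance by dyadic layers\<close>

lemma nn_integral_kball_layers:
  fixes x :: "'n::finite heis" and f :: "'n heis \<Rightarrow> ennreal"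
  assumes layer: "\<And>y. f y \<noteq> 0 \<Longrightarrow> \<exists>i. f y \<le> ennreal (c i) \<and> y \<in> kball x (b i)"
    and pos: "\<And>i. c i \<ge> 0" "\<And>i. b i > 0"
    and cb: "\<And>i. c i * (kvol TYPE('n) * b i powr hdim TYPE('n)) \<le> K * w ^ i"
    and w: "0 \<le> w" "w < 1" and K: "K \<ge> 0"
  shows "(\<integral>\<^sup>+y. f y \<partial>lebesgue) \<le> ennreal (K / (1 - w))"
proof -
  have "(\<integral>\<^sup>+y. f y \<partial>lebesgue) \<le> (\<integral>\<^sup>+y. (\<Sum>i. ennreal (c i) * indicator (kball x (b i)) y) \<partial>lebesgue)"
  \<comment> \<open>The balls may be nested, so points are counted in many layers. One layer is
    enough for the pointwise bound, and the overcount is harmless because the integrals of the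
    layers form a geometric series.\<close>
  proof (rule nn_integral_mono)
    fix y
    show "f y \<le> (\<Sum>i. ennreal (c i) * indicator (kball x (b i)) y)"
    proof (cases "f y = 0")
      case False
      then obtain i where "f y \<le> ennreal (c i)" "y \<in> kball x (b i)" using layer by blast
      hence "f y \<le> (\<Sum>j\<in>{i}. ennreal (c j) * indicator (kball x (b j)) y)" by simp
      also have "\<dots> \<le> (\<Sum>j. ennreal (c j) * indicator (kball x (b j)) y)"
        by (rule sum_le_suminf) auto
      finally show ?thesis .
    qed simp
  qed
  also have "\<dots> = (\<Sum>i. \<integral>\<^sup>+y. ennreal (c i) * indicator (kball x (b i)) y \<partial>lebesgue)"
    by (rule nn_integral_suminf) measurable
  also have "\<dots> = (\<Sum>i. ennreal (c i) * emeasure lebesgue (kball x (b i)))"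
    by (simp add: nn_integral_cmult_indicator)
  also have "\<dots> \<le> (\<Sum>i. ennreal (K * w ^ i))"
  proof (rule suminf_le)
    fix i
    have "ennreal (c i) * emeasure lebesgue (kball x (b i)) \<le> ennreal (c i) * ennreal (kvol TYPE('n) * b i powr hdim TYPE('n))"
      using pos by (intro mult_left_mono emeasure_kball_le) auto
    also have "\<dots> \<le> ennreal (K * w ^ i)"
      unfolding ennreal_mult[OF pos(1) mult_nonneg_nonneg[OF less_imp_le[OF kvol_pos] powr_ge_zero], symmetric]
      by (rule ennreal_leI[OF cb])
    finally show "ennreal (c i) * emeasure lebesgue (kball x (b i)) \<le> ennreal (K * w ^ i)" .
  qed auto
  also have "\<dots> = ennreal (K / (1 - w))"
  proof (rule suminf_ennreal_eq)
    show "(\<lambda>i. K * w ^ i) sums (K / (1 - w))"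
      using sums_mult[OF geometric_sums[of w], of K] w by simp
  qed (use w K in auto)
  finally show ?thesis .
qed

text \<open>The sum of the geometric series with ratio 2^(-\<gamma>) over dyadic layers; 2^Q is the
  price of comparing the two radii of one layer. The same constant serves large and small
  distances.\<close>

definition kint :: "'n::finite itself \<Rightarrow> real \<Rightarrow> real" where
  "kint _ \<gamma> = kvol TYPE('n) * 2 powr hdim TYPE('n) / (1 - 2 powr - \<gamma>)"

lemma kint_pos: "\<gamma> > 0 \<Longrightarrow> kint TYPE('n::finite) \<gamma> > 0"
  by (simp add: kint_def kvol_pos powr_less_one)

lemma exists_dyadic_floor:
  fixes z :: real assumes "z \<ge> 1" shows "\<exists>i::nat. 2 ^ i \<le> z \<and> z < 2 ^ (Suc i)"
proof -
  define i where "i = (LEAST i. z < 2 ^ Suc i)"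
  obtain k where "z < 2 ^ k" using real_arch_pow[of 2 z] by auto
  hence ex: "z < 2 ^ Suc k" using power_increasing[of k "Suc k" "2::real"] by linarith
  have 1: "z < 2 ^ Suc i" unfolding i_def by (rule LeastI[of "\<lambda>i. z < 2 ^ Suc i", OF ex])
  have "2 ^ i \<le> z"
  proof (cases i)
    case (Suc j)
    hence "\<not> z < 2 ^ Suc j" using not_less_Least[of j "\<lambda>i. z < 2 ^ Suc i"] unfolding i_def by simp
    thus ?thesis using Suc by simp
  qed (use assms in simp)
  with 1 show ?thesis by blast
qed

lemma powr2_power: "((2::real) powr - \<gamma>) ^ i = 1 / (2 ^ i) powr \<gamma>"
proof -
  have "((2::real) powr - \<gamma>) ^ i = 2 powr (real i * - \<gamma>)" by (simp add: powr_power mult.commute)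
  also have "\<dots> = 1 / (2 powr (real i)) powr \<gamma>" by (simp add: powr_powr powr_minus_divide)
  finally show ?thesis by (simp add: powr_realpow)
qed

lemma nn_integral_kern_far:
  fixes x :: "'n::finite heis"
  assumes "\<gamma> > 0" "d > 0"
  shows "(\<integral>\<^sup>+y. indicator {y. d \<le> kern y x} y * ennreal (1 / kern y x powr (hdim TYPE('n) + \<gamma>)) \<partial>lebesgue)
    \<le> ennreal (kint TYPE('n) \<gamma> * d powr - \<gamma>)"
proof -
  let ?Q = "hdim TYPE('n)"
  define w where "w = (2::real) powr - \<gamma>"
  have w: "0 \<le> w" "w < 1" using assms by (simp_all add: w_def powr_less_one)
  have "(\<integral>\<^sup>+y. indicator {y. d \<le> kern y x} y * ennreal (1 / kern y x powr (?Q + \<gamma>)) \<partial>lebesgue)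
    \<le> ennreal (kvol TYPE('n) * 2 powr ?Q * d powr - \<gamma> / (1 - w))"
  proof (rule nn_integral_kball_layers[where c="\<lambda>i. 1 / (2 ^ i * d) powr (?Q + \<gamma>)" and b="\<lambda>i. 2 ^ Suc i * d" and x=x])
    fix y assume "indicator {y. d \<le> kern y x} y * ennreal (1 / kern y x powr (?Q + \<gamma>)) \<noteq> 0"
    hence y: "d \<le> kern y x" by (auto simp: indicator_def split: if_splits)
    hence "kern y x / d \<ge> 1" using assms by simp
    then obtain i :: nat where "2 ^ i \<le> kern y x / d" "kern y x / d < 2 ^ Suc i" using exists_dyadic_floor by blast
    hence i: "2 ^ i * d \<le> kern y x" "kern y x < 2 ^ Suc i * d" using assms by (simp_all add: field_simps)
    have "1 / kern y x powr (?Q + \<gamma>) \<le> 1 / (2 ^ i * d) powr (?Q + \<gamma>)"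
      using i assms hdim_pos(1)[where 'n='n] by (intro divide_left_mono powr_mono2 mult_pos_pos) (auto simp: powr_gt_zero)
    thus "\<exists>i. indicator {y. d \<le> kern y x} y * ennreal (1 / kern y x powr (?Q + \<gamma>)) \<le> ennreal (1 / (2 ^ i * d) powr (?Q + \<gamma>)) \<and> y \<in> kball x (2 ^ Suc i * d)"
      using i y by (intro exI[of _ i]) (auto simp: kball_def intro: ennreal_leI)
  next
    fix i :: nat
    define D where "D = 2 ^ i * d"
    have p: "D > 0" using assms by (simp add: D_def)
    hence "D powr ?Q > 0" by simp
    moreover have "(2 * D) powr ?Q = 2 powr ?Q * D powr ?Q"
      using p by (simp add: powr_mult)
    ultimately have "1 / D powr (?Q + \<gamma>) * (kvol TYPE('n) * (2 * D) powr ?Q) = kvol TYPE('n) * 2 powr ?Q * (1 / D powr \<gamma>)"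
      by (simp add: powr_add)
    also have "1 / D powr \<gamma> = d powr - \<gamma> * w ^ i"
      using assms unfolding D_def w_def powr2_power by (simp add: powr_mult powr_minus_divide)
    finally show "1 / (2 ^ i * d) powr (?Q + \<gamma>) * (kvol TYPE('n) * (2 ^ Suc i * d) powr ?Q) \<le> kvol TYPE('n) * 2 powr ?Q * d powr - \<gamma> * w ^ i"
      unfolding D_def by (simp add: mult.assoc)
  qed (use w assms kvol_pos[where 'n='n] in auto)
  thus ?thesis by (simp add: kint_def w_def mult_ac)
qed

lemma nn_integral_kern_near:
  fixes x :: "'n::finite heis"
  assumes "\<gamma> > 0" "d > 0"
  shows "(\<integral>\<^sup>+y. indicator {y. kern y x < d} y * ennreal (kern y x powr \<gamma> / kern y x powr hdim TYPE('n)) \<partial>lebesgue)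
    \<le> ennreal (kint TYPE('n) \<gamma> * d powr \<gamma>)"
proof -
  let ?Q = "hdim TYPE('n)"
  define w where "w = (2::real) powr - \<gamma>"
  have w: "0 \<le> w" "w < 1" using assms by (simp_all add: w_def powr_less_one)
  have "(\<integral>\<^sup>+y. indicator {y. kern y x < d} y * ennreal (kern y x powr \<gamma> / kern y x powr ?Q) \<partial>lebesgue)
    \<le> ennreal (kvol TYPE('n) * 2 powr ?Q * d powr \<gamma> / (1 - w))"
  proof (rule nn_integral_kball_layers[where c="\<lambda>i. (d / 2 ^ i) powr \<gamma> / (d / 2 ^ i / 2) powr ?Q" and b="\<lambda>i. d / 2 ^ i" and x=x])
    fix y assume *: "indicator {y. kern y x < d} y * ennreal (kern y x powr \<gamma> / kern y x powr ?Q) \<noteq> 0"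
    hence y: "kern y x < d" by (auto simp: indicator_def split: if_splits)
    have k0: "kern y x > 0" using * kern_nonneg[of y x] by (cases "kern y x = 0") (auto simp: less_le)
    hence "d / kern y x \<ge> 1" using y by simp
    then obtain i0 :: nat where i0: "2 ^ i0 \<le> d / kern y x" "d / kern y x < 2 ^ Suc i0" using exists_dyadic_floor by blast
    \<comment> \<open>The dyadic floor is closed on the wrong side: when d is exactly 2^i0 times the
      distance, the strict inequality required by an open ball fails for i0, and the preceding layer
      is taken.\<close>
    have "\<exists>i. d / 2 ^ i / 2 \<le> kern y x \<and> kern y x < d / 2 ^ i"
    proof (cases "2 ^ i0 = d / kern y x")
      case True
      hence "d = kern y x * 2 ^ i0" using k0 by (simp add: field_simps)
      moreover have "i0 \<noteq> 0"
      proof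
        assume "i0 = 0"
        with True k0 y show False by (simp add: field_simps)
      qed
      then obtain j where "i0 = Suc j" by (cases i0) auto
      ultimately show ?thesis using k0 by (intro exI[of _ j]) (simp add: field_simps)
    next
      case False
      thus ?thesis using i0 k0 by (intro exI[of _ i0]) (simp add: field_simps)
    qed
    then obtain i where i: "d / 2 ^ i / 2 \<le> kern y x" "kern y x < d / 2 ^ i" by blast
    have "kern y x powr \<gamma> / kern y x powr ?Q \<le> (d / 2 ^ i) powr \<gamma> / (d / 2 ^ i / 2) powr ?Q"
      using i assms hdim_pos(1)[where 'n='n] k0 by (intro frac_le powr_mono2) (auto simp: powr_gt_zero)
    thus "\<exists>i. indicator {y. kern y x < d} y * ennreal (kern y x powr \<gamma> / kern y x powr ?Q) \<le> ennreal ((d / 2 ^ i) powr \<gamma> / (d / 2 ^ i / 2) powr ?Q) \<and> y \<in> kball x (d / 2 ^ i)"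
      using i y by (intro exI[of _ i]) (auto simp: kball_def intro: ennreal_leI)
  next
    fix i :: nat
    define D where "D = d / 2 ^ i"
    have p: "D > 0" using assms by (simp add: D_def)
    hence "D powr ?Q > 0" by simp
    moreover have "(D / 2) powr ?Q = D powr ?Q / 2 powr ?Q"
      using p by (simp add: powr_divide)
    ultimately have "D powr \<gamma> / (D / 2) powr ?Q * (kvol TYPE('n) * D powr ?Q) = kvol TYPE('n) * 2 powr ?Q * D powr \<gamma>"
      by simp
    moreover have "D powr \<gamma> = d powr \<gamma> * w ^ i"
      using assms unfolding D_def w_def powr2_power by (simp add: powr_divide)
    ultimately show "(d / 2 ^ i) powr \<gamma> / (d / 2 ^ i / 2) powr ?Q * (kvol TYPE('n) * (d / 2 ^ i) powr ?Q) \<le> kvol TYPE('n) * 2 powr ?Q * d powr \<gamma> * w ^ i"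
      unfolding D_def by (simp only: mult.assoc order_refl)
  qed (use w assms kvol_pos[where 'n='n] in auto)
  thus ?thesis by (simp add: kint_def w_def mult_ac)
qed

section \<open>Comparison with the Carnot-Caratheodory distance\<close>

text \<open>The exceptional null set is enclosed in an open set U of measure at most e. The function
  g subtracts (B + e) t and L times the measure of U up to time t. At exceptional points the
  Lipschitz constant is paid by the measure of U, elsewhere by the derivative bound, so g is
  nonincreasing around every point; bisection makes this global.\<close>

lemma lipschitz_increment_le:
  fixes f :: "real \<Rightarrow> real"
  assumes T: "0 \<le> T" and lip: "L-lipschitz_on {0..T} f" and B: "0 \<le> B"
    and ae: "AE t in lebesgue. t \<in> {0..T} \<longrightarrow> (\<exists>D\<le>B. (f has_real_derivative D) (at t within {0..T}))"
  shows "f T - f 0 \<le> B * T"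
proof -
  have L: "L \<ge> 0" using lip by (rule lipschitz_on_nonneg)
  have main: "f T - f 0 \<le> B * T + e * (T + L)" if e: "e > 0" for e
  proof -
    define N where "N = {t \<in> {0..T}. \<not> (\<exists>D\<le>B. (f has_real_derivative D) (at t within {0..T}))}"
    from ae obtain N0 where N0: "N0 \<in> null_sets lebesgue" "N \<subseteq> N0"
      unfolding eventually_ae_filter by (auto simp: N_def)
    obtain U where U: "open U" "N0 \<subseteq> U" "U - N0 \<in> lmeasurable" "emeasure lebesgue (U - N0) < ennreal e"
      using sets_lebesgue_outer_open[of N0 e] N0 e by blast
    have Um [measurable]: "U \<in> sets lebesgue" using U(1) by (simp add: borel_open)
    have eU: "emeasure lebesgue U < ennreal e"
      using U(4) N0(1) emeasure_Diff_null_set[of N0 lebesgue U] by simp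
    hence Ufm: "U \<in> lmeasurable" by (intro fmeasurableI) (auto simp: less_top intro: order_less_trans)
    have mU: "measure lebesgue U \<le> e"
      using eU Ufm e by (simp add: emeasure_eq_measure2 ennreal_less_iff)
    define h where "h t = measure lebesgue (U \<inter> {0..t})" for t
    have fm: "U \<inter> S \<in> lmeasurable" if "S \<in> sets lebesgue" for S
      using Ufm that by (rule fmeasurable_Int_fmeasurable)
    have h_add: "h y = h x + measure lebesgue (U \<inter> {x<..y})" if "0 \<le> x" "x \<le> y" for x y
    proof -
      have "U \<inter> {0..y} = (U \<inter> {0..x}) \<union> (U \<inter> {x<..y})" using that by auto
      moreover have "(U \<inter> {0..x}) \<inter> (U \<inter> {x<..y}) = {}" by auto
      ultimately show ?thesis unfolding h_def
        by (simp add: measure_Un3 fm)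
    qed
    define g where "g t = f t - (B + e) * t - L * h t" for t
    have "0 \<le> (0::real) \<and> T \<le> T \<longrightarrow> g T \<le> g 0"
      using T
    proof (induction rule: Bolzano[where P="\<lambda>x y. 0 \<le> x \<and> y \<le> T \<longrightarrow> g y \<le> g x"])
      case (trans a b c)
      thus ?case by auto
    next
      case (local t)
      show ?case
      proof (cases "t \<in> N")
        case True
        then obtain d where d: "d > 0" "ball t d \<subseteq> U"
          using U N0 by (meson openE subsetD)
        show ?thesis
        proof (intro exI[of _ d] conjI allI impI d)
          fix x y assume xy: "x \<le> t \<and> t \<le> y \<and> y - x < d" "0 \<le> x \<and> y \<le> T"
          have "{x<..y} \<subseteq> ball t d" using xy by (auto simp: dist_real_def)
          hence "U \<inter> {x<..y} = {x<..y}" using d by auto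
          hence "h y = h x + (y - x)" using xy h_add[of x y] by simp
          moreover have "f y - f x \<le> L * (y - x)"
            using lipschitz_onD[OF lip, of y x] xy by (auto simp: dist_real_def)
          moreover have "0 \<le> (B + e) * (y - x)" using B e xy by simp
          ultimately have "f y - f x - (B + e) * (y - x) - L * (h y - h x) \<le> 0" by simp
          thus "g y \<le> g x" by (simp add: g_def algebra_simps)
        qed
      next
        case False
        then obtain D where D: "D \<le> B" "(f has_real_derivative D) (at t within {0..T})"
          using local by (auto simp: N_def)
        from D(2) e obtain d where d: "d > 0"
          "\<And>y. y \<in> {0..T} \<Longrightarrow> norm (y - t) < d \<Longrightarrow> norm (f y - f t - D * (y - t)) \<le> e * norm (y - t)"
          unfolding has_field_derivative_def has_derivative_within_alt by (metis)
        show ?thesis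
        proof (intro exI[of _ d] conjI allI impI d(1))
          fix x y assume xy: "x \<le> t \<and> t \<le> y \<and> y - x < d" "0 \<le> x \<and> y \<le> T"
          have "f y - f t \<le> D * (y - t) + e * (y - t)"
            using d(2)[of y] xy by auto
          moreover have "f t - f x \<le> D * (t - x) + e * (t - x)"
            using d(2)[of x] xy by (auto simp: algebra_simps)
          moreover have "(D + e) * (y - x) \<le> (B + e) * (y - x)" using D xy by (intro mult_right_mono) auto
          moreover have "h x \<le> h y" using h_add[of x y] xy by auto
          hence "L * h x \<le> L * h y" using L by (intro mult_left_mono)
          ultimately show "g y \<le> g x" by (simp add: g_def algebra_simps)
        qed
      qed
    qed
    hence "g T \<le> g 0" by simp
    moreover have "h T \<le> e"
    proof -
      have "h T \<le> measure lebesgue U" unfolding h_def by (rule measure_mono_fmeasurable) (use Ufm in auto)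
      thus ?thesis using mU by simp
    qed
    hence "L * h T \<le> L * e" using L by (intro mult_left_mono)
    moreover have "0 \<le> L * h 0" using L by (simp add: h_def)
    ultimately show ?thesis by (simp add: g_def algebra_simps)
  qed
  show ?thesis
  proof (rule field_le_epsilon)
    fix e :: real assume "e > 0"
    have "e / (T + L + 1) > 0" using \<open>e > 0\<close> T L by simp
    from main[OF this] have "f T - f 0 \<le> B * T + e * ((T + L) / (T + L + 1))" by simp
    also have "\<dots> \<le> B * T + e * 1"
      using \<open>e > 0\<close> T L by (intro add_left_mono mult_left_mono) auto
    finally show "f T - f 0 \<le> B * T + e" by simp
  qed
qed

text \<open>Left translation is affine in these coordinates and this is its linear part, hence its
  differential everywhere. By \<open>hlin_horiz\<close> it carries horizontal vectors to horizontal
  vectors with the same coefficients, which makes the length of a curve left invariant.\<close>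

definition hlin :: "'n::finite heis \<Rightarrow> 'n heis \<Rightarrow> 'n heis" where
  "hlin a v = (fst v, fst (snd v), snd (snd v) + (fst a \<bullet> fst (snd v) - fst (snd a) \<bullet> fst v) / 2)"

lemma bounded_linear_hlin: "bounded_linear (hlin a)"
  unfolding hlin_def
  by (intro bounded_linear_intros bounded_linear_Pair bounded_linear_compose[OF bounded_linear_fst]
      bounded_linear_compose[OF bounded_linear_snd] bounded_linear_add bounded_linear_sub
      bounded_linear_compose[OF bounded_linear_divide] bounded_linear_compose[OF bounded_linear_inner_right])

lemma hmult_affine: "hmult a v = a + hlin a v"
  by (cases a; cases v) (simp add: hmult_eq hlin_def)

lemma hlin_horiz: "hlin a (horiz v h) = horiz (hmult a v) h"
  by (cases a; cases v; cases h) (simp add: hlin_def horiz_eq hmult_eq inner_simps field_simps)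

lemma has_vector_derivative_hmult:
  assumes "(\<gamma> has_vector_derivative horiz (\<gamma> t) h) (at t within S)"
  shows "((\<lambda>t. hmult a (\<gamma> t)) has_vector_derivative horiz (hmult a (\<gamma> t)) h) (at t within S)"
proof -
  have "((\<lambda>t. hlin a (\<gamma> t)) has_vector_derivative hlin a (horiz (\<gamma> t) h)) (at t within S)"
    by (rule bounded_linear.has_vector_derivative[OF bounded_linear_hlin assms])
  hence "((\<lambda>t. a + hlin a (\<gamma> t)) has_vector_derivative hlin a (horiz (\<gamma> t) h)) (at t within S)"
    by (auto intro!: derivative_eq_intros)
  thus ?thesis by (simp add: hmult_affine hlin_horiz)
qed

lemma bounded_linear_lipschitz_on:
  assumes "bounded_linear f" "L-lipschitz_on S g"
  shows "\<exists>M. M-lipschitz_on S (\<lambda>x. f (g x))"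
proof -
  from assms(1) obtain K where K: "\<And>x. norm (f x) \<le> norm x * K" "K > 0"
    using bounded_linear.pos_bounded by blast
  have "dist (f (g x)) (f (g y)) \<le> (L * K) * dist x y" if "x \<in> S" "y \<in> S" for x y
  proof -
    have "dist (f (g x)) (f (g y)) = norm (f (g x - g y))"
      using assms(1) by (simp add: dist_norm linear_diff bounded_linear.linear)
    also have "\<dots> \<le> dist (g x) (g y) * K" using K by (simp add: dist_norm)
    also have "\<dots> \<le> (L * dist x y) * K"
      using lipschitz_onD[OF assms(2) that] K by (intro mult_right_mono) auto
    finally show ?thesis by (simp add: mult_ac)
  qed
  thus ?thesis using lipschitz_on_nonneg[OF assms(2)] K(2) by (intro exI[of _ "L * K"] lipschitz_onI) auto
qed

lemma subunit_curve_translate: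
  assumes "subunit_curve \<xi> \<eta> T" shows "subunit_curve (hmult a \<xi>) (hmult a \<eta>) T"
proof -
  from assms obtain \<gamma> L where \<gamma>: "0 \<le> T" "\<gamma> 0 = \<xi>" "\<gamma> T = \<eta>" "L-lipschitz_on {0..T} \<gamma>"
      "AE t in lebesgue. t \<in> {0..T} \<longrightarrow> (\<exists>h. norm h \<le> 1 \<and> (\<gamma> has_vector_derivative horiz (\<gamma> t) h) (at t within {0..T}))"
    unfolding subunit_curve_def by blast
  obtain M where "M-lipschitz_on {0..T} (\<lambda>t. hlin a (\<gamma> t))"
    using bounded_linear_lipschitz_on[OF bounded_linear_hlin \<gamma>(4)] by blast
  hence "M-lipschitz_on {0..T} (\<lambda>t. hmult a (\<gamma> t))"
    unfolding hmult_affine lipschitz_on_def by simp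
  moreover have "AE t in lebesgue. t \<in> {0..T} \<longrightarrow> (\<exists>h. norm h \<le> 1 \<and> ((\<lambda>t. hmult a (\<gamma> t)) has_vector_derivative horiz (hmult a (\<gamma> t)) h) (at t within {0..T}))"
    using \<gamma>(5) by eventually_elim (use has_vector_derivative_hmult in blast)
  ultimately show ?thesis unfolding subunit_curve_def using \<gamma>(1-3) by (intro conjI exI[of _ "\<lambda>t. hmult a (\<gamma> t)"]) auto
qed

text \<open>The horizontal projection has speed at most 1, so at time s its norm is at most s. With
  this bound the vertical coordinate changes at rate at most T / 2. Both statements are increments
  of scalar Lipschitz functions.\<close>

lemma subunit_curve_hnorm_le:
  assumes "subunit_curve 0 \<eta> T" shows "hnorm (\<eta> :: 'n::finite heis) \<le> 2 * T"
proof -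
  from assms obtain \<gamma> L where \<gamma>: "0 \<le> T" "\<gamma> 0 = 0" "\<gamma> T = \<eta>" "L-lipschitz_on {0..T} \<gamma>"
      "AE t in lebesgue. t \<in> {0..T} \<longrightarrow> (\<exists>h. norm h \<le> 1 \<and> (\<gamma> has_vector_derivative horiz (\<gamma> t) h) (at t within {0..T}))"
    unfolding subunit_curve_def by blast
  define z where "z v = (fst v, fst (snd v))" for v :: "'n heis"
  have z_lin: "bounded_linear z" unfolding z_def
    by (intro bounded_linear_intros bounded_linear_Pair bounded_linear_compose[OF bounded_linear_fst])
  have z_horiz: "z (horiz v h) = h" for v h
    by (cases v; cases h) (simp add: z_def horiz_eq)
  have zbound: "norm (z (\<gamma> s)) \<le> s" if s: "s \<in> {0..T}" for s
  proof -
    \<comment> \<open>Testing the projected curve against its own end point turns the bound on a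
      norm into a bound on a scalar increment.\<close>
    define w where "w = z (\<gamma> s)"
    have bl: "bounded_linear (\<lambda>v. w \<bullet> z v)"
      by (intro bounded_linear_compose[OF bounded_linear_inner_right z_lin])
    have "L-lipschitz_on {0..s} \<gamma>" using \<gamma>(4) by (rule lipschitz_on_subset) (use s in auto)
    then obtain M where M: "M-lipschitz_on {0..s} (\<lambda>t. w \<bullet> z (\<gamma> t))"
      using bounded_linear_lipschitz_on[OF bl] by blast
    have "w \<bullet> z (\<gamma> s) - w \<bullet> z (\<gamma> 0) \<le> norm w * s"
    proof (rule lipschitz_increment_le[OF _ M])
      show "AE t in lebesgue. t \<in> {0..s} \<longrightarrow> (\<exists>D\<le>norm w. ((\<lambda>t. w \<bullet> z (\<gamma> t)) has_real_derivative D) (at t within {0..s}))"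
        using \<gamma>(5)
      proof eventually_elim
        case (elim t)
        show ?case
        proof
          assume t: "t \<in> {0..s}"
          then obtain h where h: "norm h \<le> 1" "(\<gamma> has_vector_derivative horiz (\<gamma> t) h) (at t within {0..T})"
            using elim s by auto
          have "((\<lambda>t. w \<bullet> z (\<gamma> t)) has_vector_derivative w \<bullet> z (horiz (\<gamma> t) h)) (at t within {0..s})"
            by (rule bounded_linear.has_vector_derivative[OF bl has_vector_derivative_within_subset[OF h(2)]]) (use s in auto)
          moreover have "w \<bullet> h \<le> norm w"
          proof -
            have "w \<bullet> h \<le> norm w * norm h" by (rule norm_cauchy_schwarz)
            also have "\<dots> \<le> norm w * 1" using h by (intro mult_left_mono) auto
            finally show ?thesis by simp
          qed
          ultimately show "\<exists>D\<le>norm w. ((\<lambda>t. w \<bullet> z (\<gamma> t)) has_real_derivative D) (at t within {0..s})"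
            by (auto simp: z_horiz has_real_derivative_iff_has_vector_derivative)
        qed
      qed
    qed (use s in auto)
    hence "norm w * norm w \<le> norm w * s"
      using \<gamma>(2) by (simp add: w_def z_def dot_square_norm power2_eq_square inner_prod_def)
    thus ?thesis using s unfolding w_def[symmetric]
      by (metis atLeastAtMost_iff mult_le_cancel_left_pos norm_ge_zero order_le_less)
  qed
  have tau: "c * snd (snd \<eta>) \<le> T / 2 * T" if c: "c = 1 \<or> c = -1" for c :: real
  proof -
    have bl: "bounded_linear (\<lambda>v :: 'n heis. c * snd (snd v))"
      by (intro bounded_linear_compose[OF bounded_linear_mult_right] bounded_linear_intros bounded_linear_compose[OF bounded_linear_snd])
    obtain M where M: "M-lipschitz_on {0..T} (\<lambda>t. c * snd (snd (\<gamma> t)))"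
      using bounded_linear_lipschitz_on[OF bl \<gamma>(4)] by blast
    have "c * snd (snd (\<gamma> T)) - c * snd (snd (\<gamma> 0)) \<le> T / 2 * T"
    proof (rule lipschitz_increment_le[OF \<gamma>(1) M])
      show "AE t in lebesgue. t \<in> {0..T} \<longrightarrow> (\<exists>D\<le>T/2. ((\<lambda>t. c * snd (snd (\<gamma> t))) has_real_derivative D) (at t within {0..T}))"
        using \<gamma>(5)
      proof eventually_elim
        case (elim t)
        show ?case
        proof
          assume t: "t \<in> {0..T}"
          then obtain h where h: "norm h \<le> 1" "(\<gamma> has_vector_derivative horiz (\<gamma> t) h) (at t within {0..T})"
            using elim by auto
          have "((\<lambda>t. c * snd (snd (\<gamma> t))) has_vector_derivative c * snd (snd (horiz (\<gamma> t) h))) (at t within {0..T})"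
            by (rule bounded_linear.has_vector_derivative[OF bl h(2)])
          moreover have "c * snd (snd (horiz (\<gamma> t) h)) \<le> T / 2"
          proof -
            obtain x y \<tau> where g: "\<gamma> t = (x, y, \<tau>)" by (cases "\<gamma> t")
            obtain a b where hab: "h = (a, b)" by (cases h)
            have "x \<bullet> b - y \<bullet> a = (x, y) \<bullet> (b, - a)" by (simp add: inner_prod_def)
            hence "\<bar>x \<bullet> b - y \<bullet> a\<bar> \<le> norm (x, y) * norm (b, - a)"
              using Cauchy_Schwarz_ineq2[of "(x, y)" "(b, - a)"] by simp
            also have "norm (b, - a) = norm h" by (simp add: hab norm_prod_def add.commute)
            also have "norm (x, y) * norm h \<le> T * 1"
              using zbound[OF t] t h by (intro mult_mono) (auto simp: z_def g)
            finally show ?thesis using c by (auto simp: g hab horiz_eq)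
          qed
          ultimately show "\<exists>D\<le>T/2. ((\<lambda>t. c * snd (snd (\<gamma> t))) has_real_derivative D) (at t within {0..T})"
            by (auto simp: has_real_derivative_iff_has_vector_derivative)
        qed
      qed
    qed (use \<gamma>(1) in auto)
    thus ?thesis using \<gamma> by simp
  qed
  obtain x y \<tau> where e: "\<eta> = (x, y, \<tau>)" by (cases \<eta>)
  have z: "norm (x, y) \<le> T" using zbound[of T] \<gamma> e by (simp add: z_def)
  hence "(norm (x, y))\<^sup>2 \<le> T\<^sup>2" by (intro power_mono) auto
  hence 1: "(norm x)\<^sup>2 + (norm y)\<^sup>2 \<le> T\<^sup>2" by (simp add: norm_prod_def)
  have "\<bar>\<tau>\<bar> \<le> T / 2 * T" using tau[of 1] tau[of "-1"] by (simp add: e abs_le_iff)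
  also have "\<dots> \<le> T\<^sup>2" by (simp add: power2_eq_square)
  finally have 2: "\<bar>\<tau>\<bar> \<le> T\<^sup>2" .
  have "cmod (Complex ((norm x)\<^sup>2 + (norm y)\<^sup>2) \<tau>) \<le> \<bar>(norm x)\<^sup>2 + (norm y)\<^sup>2\<bar> + \<bar>\<tau>\<bar>"
    using cmod_le[of "Complex ((norm x)\<^sup>2 + (norm y)\<^sup>2) \<tau>"] by simp
  also have "\<dots> \<le> T\<^sup>2 + T\<^sup>2" using 1 2 by (intro add_mono) auto
  also have "\<dots> \<le> (2 * T)\<^sup>2" by (simp add: power_mult_distrib)
  finally have "hnorm \<eta> \<le> sqrt ((2 * T)\<^sup>2)" unfolding e hnorm_conv_cmod by (rule real_sqrt_le_mono)
  also have "sqrt ((2 * T)\<^sup>2) = 2 * T" using \<gamma>(1) by (intro real_sqrt_unique) auto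
  finally show ?thesis .
qed

lemma subunit_curve_kern_le:
  assumes "subunit_curve \<xi> \<eta> T" shows "kern \<eta> \<xi> \<le> 2 * T"
  using subunit_curve_hnorm_le[of "hmult (hinv \<xi>) \<eta>" T] subunit_curve_translate[OF assms, of "hinv \<xi>"]
  by (simp add: kern_def)

lemma subunit_curve_segment: "subunit_curve \<xi> (hmult \<xi> (a, b, 0)) (norm (a, b))"
proof -
  define N where "N = norm (a, b)"
  \<comment> \<open>If (a, b) = 0 then 1 / N is 0 by convention, w vanishes and the curve is
    constant.\<close>
  define w where "w = (1 / N) *\<^sub>R (a, b)"
  have N0: "N \<ge> 0" by (simp add: N_def)
  have wn: "norm w \<le> 1" unfolding w_def norm_scaleR N_def by (cases "(a, b) = 0") auto
  have wN: "N *\<^sub>R w = (a, b)" by (cases "(a, b) = 0") (simp_all add: w_def N_def zero_prod_def)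
  define e where "e = (fst w, snd w, 0::real)"
  define \<gamma>0 where "\<gamma>0 t = t *\<^sub>R e" for t :: real
  have deriv0: "(\<gamma>0 has_vector_derivative horiz (\<gamma>0 t) w) (at t within S)" for t S
  proof -
    have "horiz (\<gamma>0 t) w = e"
      by (cases w) (simp add: \<gamma>0_def e_def horiz_eq inner_commute)
    thus ?thesis unfolding \<gamma>0_def by (auto intro!: derivative_eq_intros)
  qed
  have "subunit_curve 0 (a, b, 0) N"
    unfolding subunit_curve_def
  proof (intro conjI exI[of _ \<gamma>0])
    show "\<gamma>0 0 = 0" by (simp add: \<gamma>0_def)
    have "N *\<^sub>R e = (fst (N *\<^sub>R w), snd (N *\<^sub>R w), 0)" by (simp add: e_def)
    thus "\<gamma>0 N = (a, b, 0)" unfolding wN by (simp add: \<gamma>0_def)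
    have "(norm e)-lipschitz_on {0..N} \<gamma>0"
      by (rule lipschitz_onI) (auto simp: \<gamma>0_def dist_norm mult.commute simp flip: scaleR_diff_left)
    thus "\<exists>L. L-lipschitz_on {0..N} \<gamma>0" by blast
    show "AE t in lebesgue. t \<in> {0..N} \<longrightarrow> (\<exists>h. norm h \<le> 1 \<and> (\<gamma>0 has_vector_derivative horiz (\<gamma>0 t) h) (at t within {0..N}))"
      using wn deriv0 by (intro AE_I2) blast
  qed (rule N0)
  from subunit_curve_translate[OF this, of \<xi>] show ?thesis by (simp add: N_def)
qed

lemma AE_lebesgue_shift:
  fixes P :: "real \<Rightarrow> bool"
  assumes "AE t in lebesgue. P t" shows "AE t in lebesgue. P (t - c)"
proof -
  from assms obtain N where N: "{t. \<not> P t} \<subseteq> N" "N \<in> null_sets lebesgue"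
    unfolding eventually_ae_filter by auto
  hence "negligible N" by (simp add: negligible_iff_null_sets)
  hence "negligible ((+) c ` N)" by (rule negligible_translation)
  hence "(+) c ` N \<in> null_sets lebesgue" by (simp add: negligible_iff_null_sets)
  moreover have "{t. \<not> P (t - c)} \<subseteq> (+) c ` N"
  proof
    fix t assume "t \<in> {t. \<not> P (t - c)}"
    hence "t - c \<in> N" using N by auto
    thus "t \<in> (+) c ` N" by (intro image_eqI[of _ _ "t - c"]) auto
  qed
  ultimately show ?thesis by (intro AE_I'[of "(+) c ` N"]) auto
qed

lemma subunit_curve_concat:
  assumes "subunit_curve \<xi> \<eta> T" "subunit_curve \<eta> \<zeta> T'"
  shows "subunit_curve \<xi> \<zeta> (T + T')"
proof -
  from assms(1) obtain \<gamma> L where \<gamma>: "0 \<le> T" "\<gamma> 0 = \<xi>" "\<gamma> T = \<eta>" "L-lipschitz_on {0..T} \<gamma>"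
      "AE t in lebesgue. t \<in> {0..T} \<longrightarrow> (\<exists>h. norm h \<le> 1 \<and> (\<gamma> has_vector_derivative horiz (\<gamma> t) h) (at t within {0..T}))"
    unfolding subunit_curve_def by blast
  from assms(2) obtain \<delta> L' where \<delta>: "0 \<le> T'" "\<delta> 0 = \<eta>" "\<delta> T' = \<zeta>" "L'-lipschitz_on {0..T'} \<delta>"
      "AE t in lebesgue. t \<in> {0..T'} \<longrightarrow> (\<exists>h. norm h \<le> 1 \<and> (\<delta> has_vector_derivative horiz (\<delta> t) h) (at t within {0..T'}))"
    unfolding subunit_curve_def by blast
  define \<kappa> where "\<kappa> t = (if t \<le> T then \<gamma> t else \<delta> (t - T))" for t
  have "L'-lipschitz_on {T..T + T'} (\<lambda>t. \<delta> (t - T))"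
  proof (rule lipschitz_onI)
    fix x y assume "x \<in> {T..T + T'}" "y \<in> {T..T + T'}"
    thus "dist (\<delta> (x - T)) (\<delta> (y - T)) \<le> L' * dist x y"
      using lipschitz_onD[OF \<delta>(4), of "x - T" "y - T"] by (simp add: dist_real_def)
  qed (rule lipschitz_on_nonneg[OF \<delta>(4)])
  from lipschitz_on_concat_max[OF \<gamma>(4) this] \<gamma> \<delta>
  have lip: "\<exists>M. M-lipschitz_on {0..T + T'} \<kappa>"
    unfolding \<kappa>_def by auto
  \<comment> \<open>The junction and both end points are discarded. At all other times derivatives
    within the intervals are ordinary derivatives, and \<open>\<kappa>\<close> agrees near t with
    one of the two pieces.\<close>
  have ae: "AE t in lebesgue. t \<noteq> c" for c :: real
    by (rule AE_I'[of "{c}"]) auto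
  have "AE t in lebesgue. t \<in> {0..T + T'} \<longrightarrow> (\<exists>h. norm h \<le> 1 \<and> (\<kappa> has_vector_derivative horiz (\<kappa> t) h) (at t within {0..T + T'}))"
    using \<gamma>(5) AE_lebesgue_shift[OF \<delta>(5), of T] ae[of 0] ae[of T] ae[of "T + T'"]
  proof eventually_elim
    case (elim t)
    show ?case
    proof
      assume t: "t \<in> {0..T + T'}"
      hence at: "at t within {0..T + T'} = at t" using elim by (intro at_within_Icc_at) auto
      show "\<exists>h. norm h \<le> 1 \<and> (\<kappa> has_vector_derivative horiz (\<kappa> t) h) (at t within {0..T + T'})"
      proof (cases "t < T")
        case True
        hence at': "at t within {0..T} = at t" using elim t by (intro at_within_Icc_at) auto
        obtain h where h: "norm h \<le> 1" "(\<gamma> has_vector_derivative horiz (\<gamma> t) h) (at t)"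
          using elim(1) True t at' by auto
        have "(\<kappa> has_vector_derivative horiz (\<gamma> t) h) (at t)"
          by (rule has_vector_derivative_transform_within_open[OF h(2), of "{..<T}"]) (use True in \<open>auto simp: \<kappa>_def\<close>)
        thus ?thesis unfolding at using h(1) True by (intro exI[of _ h]) (simp add: \<kappa>_def)
      next
        case False
        hence tT: "t > T" "t - T < T'" using elim t by auto
        hence at': "at (t - T) within {0..T'} = at (t - T)" by (intro at_within_Icc_at) auto
        obtain h where h: "norm h \<le> 1" "(\<delta> has_vector_derivative horiz (\<delta> (t - T)) h) (at (t - T))"
          using elim(2) tT at' by auto
        have "((\<lambda>t. t - T) has_vector_derivative 1) (at t)"
          by (auto intro!: derivative_eq_intros)
        from vector_diff_chain_at[OF this h(2)]
        have "((\<lambda>t. \<delta> (t - T)) has_vector_derivative horiz (\<delta> (t - T)) h) (at t)" by (simp add: o_def)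
        hence "(\<kappa> has_vector_derivative horiz (\<delta> (t - T)) h) (at t)"
          by (rule has_vector_derivative_transform_within_open[of _ _ _ "{T<..}"]) (use tT in \<open>auto simp: \<kappa>_def\<close>)
        thus ?thesis unfolding at using h(1) tT by (intro exI[of _ h]) (simp add: \<kappa>_def)
      qed
    qed
  qed
  moreover have "\<kappa> 0 = \<xi>" using \<gamma> by (simp add: \<kappa>_def)
  moreover have "\<kappa> (T + T') = \<zeta>" using \<gamma> \<delta> by (cases "T' = 0") (auto simp: \<kappa>_def)
  ultimately show ?thesis unfolding subunit_curve_def using lip \<gamma>(1) \<delta>(1) by auto
qed

text \<open>Vertical displacements are commutators of horizontal segments.\<close>

lemma subunit_curve_exists: "\<exists>T \<le> 5 * kern \<eta> (\<xi> :: 'n::finite heis). subunit_curve \<xi> \<eta> T"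
proof -
  obtain x y \<tau> where e: "hmult (hinv \<xi>) \<eta> = (x, y, \<tau>)" by (cases "hmult (hinv \<xi>) \<eta>")
  define N where "N = kern \<eta> \<xi>"
  have N: "N = sqrt (cmod (Complex ((norm x)\<^sup>2 + (norm y)\<^sup>2) \<tau>))"
    by (simp add: N_def kern_def e hnorm_conv_cmod)
  have "(norm x)\<^sup>2 + (norm y)\<^sup>2 \<le> cmod (Complex ((norm x)\<^sup>2 + (norm y)\<^sup>2) \<tau>)"
    using complex_Re_le_cmod[of "Complex ((norm x)\<^sup>2 + (norm y)\<^sup>2) \<tau>"] by simp
  hence z: "norm (x, y) \<le> N" unfolding N norm_prod_def by simp
  have "\<bar>\<tau>\<bar> \<le> cmod (Complex ((norm x)\<^sup>2 + (norm y)\<^sup>2) \<tau>)"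
    using abs_Im_le_cmod[of "Complex ((norm x)\<^sup>2 + (norm y)\<^sup>2) \<tau>"] by simp
  hence t: "sqrt \<bar>\<tau>\<bar> \<le> N" unfolding N by simp
  define \<epsilon> :: "real^'n" where "\<epsilon> = axis undefined 1"
  have ee: "\<epsilon> \<bullet> \<epsilon> = 1" "norm \<epsilon> = 1" by (simp_all add: \<epsilon>_def inner_axis_axis)
  define s where "s = sqrt \<bar>\<tau>\<bar>"
  have ss: "s * s = \<bar>\<tau>\<bar>" "s \<ge> 0" by (simp_all add: s_def)
  define P where "P c = (c * s) *\<^sub>R \<epsilon>" for c :: real
  have seg: "subunit_curve \<zeta> (hmult \<zeta> (P c, P d, 0)) (sqrt (c\<^sup>2 + d\<^sup>2) * s)" for \<zeta> :: "'n heis" and c d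
  proof -
    have "norm (P c, P d) = sqrt ((c\<^sup>2 + d\<^sup>2) * s\<^sup>2)"
      by (simp add: norm_prod_def P_def ee power_mult_distrib algebra_simps)
    also have "\<dots> = sqrt (c\<^sup>2 + d\<^sup>2) * s" using ss by (simp add: real_sqrt_mult)
    finally show ?thesis using subunit_curve_segment[of \<zeta> "P c" "P d"] by simp
  qed
  \<comment> \<open>The vertical gain of a horizontal loop is the signed area it encloses. A square
    of side s has area |\<tau>|, and the order of its sides gives the sign. Together with the first
    segment the length is at most (1 + 4) N, the origin of the factor 5.\<close>
  have vert: "subunit_curve \<zeta> (hmult \<zeta> (0, 0, \<tau>)) (4 * s)" for \<zeta> :: "'n heis"
  proof (cases "\<tau> \<ge> 0")
    case True
    have "hmult (hmult (hmult (hmult \<zeta> (P 1, P 0, 0)) (P 0, P 1, 0)) (P (-1), P 0, 0)) (P 0, P (-1), 0) = hmult \<zeta> (0, 0, \<tau>)"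
      using True ss unfolding hmult_assoc by (simp add: hmult_eq P_def ee algebra_simps)
    thus ?thesis
      using subunit_curve_concat[OF subunit_curve_concat[OF subunit_curve_concat[OF seg[of \<zeta> 1 0] seg[of _ 0 1]] seg[of _ "-1" 0]] seg[of _ 0 "-1"]]
      by simp
  next
    case False
    have "hmult (hmult (hmult (hmult \<zeta> (P 0, P 1, 0)) (P 1, P 0, 0)) (P 0, P (-1), 0)) (P (-1), P 0, 0) = hmult \<zeta> (0, 0, \<tau>)"
      using False ss unfolding hmult_assoc by (simp add: hmult_eq P_def ee algebra_simps)
    thus ?thesis
      using subunit_curve_concat[OF subunit_curve_concat[OF subunit_curve_concat[OF seg[of \<zeta> 0 1] seg[of _ 1 0]] seg[of _ 0 "-1"]] seg[of _ "-1" 0]]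
      by simp
  qed
  have "hmult (hmult \<xi> (x, y, 0)) (0, 0, \<tau>) = \<eta>"
  proof -
    have "hmult (x, y, 0) (0, 0, \<tau>) = hmult (hinv \<xi>) \<eta>" unfolding e by (simp add: hmult_eq)
    thus ?thesis by (simp add: hmult_assoc)
  qed
  hence "subunit_curve \<xi> \<eta> (norm (x, y) + 4 * s)"
    using subunit_curve_concat[OF subunit_curve_segment[of \<xi> x y] vert] by simp
  moreover have "norm (x, y) + 4 * s \<le> 5 * N" using z t by (simp add: s_def)
  ultimately show ?thesis unfolding N_def by blast
qed

section \<open>Inclusions between gauge balls and Carnot-Caratheodory balls\<close>

lemma cc_dist_bdd_below: "bdd_below {T. subunit_curve \<xi> \<eta> T}"
  by (rule bdd_belowI[of _ 0]) (auto simp: subunit_curve_def)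

lemma cc_dist_le_kern: "cc_dist \<xi> \<eta> \<le> 5 * kern \<eta> \<xi>"
proof -
  obtain T where "T \<le> 5 * kern \<eta> \<xi>" "subunit_curve \<xi> \<eta> T" using subunit_curve_exists by blast
  thus ?thesis unfolding cc_dist_def
    using cInf_lower[OF _ cc_dist_bdd_below, of T \<xi> \<eta>] by simp
qed

lemma cc_dist_less_iff: "cc_dist \<xi> \<eta> < r \<longleftrightarrow> (\<exists>T<r. subunit_curve \<xi> \<eta> T)"
proof -
  have "{T. subunit_curve \<xi> \<eta> T} \<noteq> {}" using subunit_curve_exists by blast
  thus ?thesis unfolding cc_dist_def using cInf_less_iff[OF _ cc_dist_bdd_below] by blast
qed

text \<open>The factor 5 here and the factor 2 in \<open>hball_subset_kball\<close> are the source
  of the radii \<open>rr j / 5\<close> and of the bound \<open>\<theta> / 20\<close> on \<sigma> in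
  the iteration over radii.\<close>

lemma kball_subset_hball: "kball \<xi> (r / 5) \<subseteq> hball \<xi> r"
proof
  fix y assume "y \<in> kball \<xi> (r / 5)"
  thus "y \<in> hball \<xi> r" using cc_dist_le_kern[of \<xi> y] by (simp add: kball_def hball_def)
qed

lemma hball_subset_kball: "hball \<xi> r \<subseteq> kball \<xi> (2 * r)"
proof
  fix y assume "y \<in> hball \<xi> r"
  then obtain T where "T < r" "subunit_curve \<xi> y T" by (auto simp: hball_def cc_dist_less_iff)
  thus "y \<in> kball \<xi> (2 * r)" using subunit_curve_kern_le[of \<xi> y T] by (simp add: kball_def)
qed

lemma open_hball: "open (hball (\<xi> :: 'n::finite heis) r)"
proof (subst open_subopen, rule ballI)
  fix y assume "y \<in> hball \<xi> r"
  then obtain T where T: "T < r" "subunit_curve \<xi> y T" by (auto simp: hball_def cc_dist_less_iff)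
  have "kball y ((r - T) / 5) \<subseteq> hball \<xi> r"
  proof
    fix z assume "z \<in> kball y ((r - T) / 5)"
    hence "cc_dist y z < r - T" using cc_dist_le_kern[of y z] by (simp add: kball_def)
    then obtain T' where "T' < r - T" "subunit_curve y z T'" by (auto simp: cc_dist_less_iff)
    hence "subunit_curve \<xi> z (T + T')" "T + T' < r" using subunit_curve_concat[OF T(2)] by auto
    thus "z \<in> hball \<xi> r" by (auto simp: hball_def cc_dist_less_iff)
  qed
  moreover have "y \<in> kball y ((r - T) / 5)" using T by (simp add: kball_def)
  ultimately show "\<exists>S. open S \<and> y \<in> S \<and> S \<subseteq> hball \<xi> r"
    using open_kball by blast
qed

section \<open>The energy inequality\<close>

lemma Jp_eq: "Jp m \<tau> = sgn \<tau> * \<bar>\<tau>\<bar> powr (m - 1)"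
proof (cases "\<tau> = 0")
  case False
  have "\<bar>\<tau>\<bar> powr (m - 1) = \<bar>\<tau>\<bar> powr (m - 2) * \<bar>\<tau>\<bar> powr 1"
    by (subst powr_add[symmetric]) simp
  thus ?thesis using False by (simp add: Jp_def mult_sgn_abs)
qed (simp add: Jp_def)

lemma Jp_uminus: "Jp m (- \<tau>) = - Jp m \<tau>"
  by (simp add: Jp_def)

lemma Jp_of_pos: "\<tau> > 0 \<Longrightarrow> Jp m \<tau> = \<tau> powr (m - 1)"
  by (simp add: Jp_eq)

lemma Jp_of_neg: "\<tau> < 0 \<Longrightarrow> Jp m \<tau> = - ((- \<tau>) powr (m - 1))"
  by (simp add: Jp_eq)

lemma Jp_mono:
  assumes "m > 1" "x \<le> y" shows "Jp m x \<le> Jp m y"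
proof -
  consider "x > 0" | "x \<le> 0" "y \<ge> 0" | "y < 0" by linarith
  thus ?thesis
  proof cases
    case 1 thus ?thesis using assms by (simp add: Jp_of_pos powr_mono2)
  next
    case 2
    hence "Jp m x \<le> 0" "0 \<le> Jp m y" by (simp_all add: Jp_def mult_nonneg_nonpos)
    thus ?thesis by simp
  next
    case 3 thus ?thesis using assms by (simp add: Jp_of_neg powr_mono2)
  qed
qed

lemma abs_Jp_mult_le:
  assumes "m > 1" shows "\<bar>Jp m x * y\<bar> \<le> \<bar>x\<bar> powr m + \<bar>y\<bar> powr m"
proof -
  define z where "z = max \<bar>x\<bar> \<bar>y\<bar>"
  have split: "z powr m = z powr (m - 1) * z"
  proof (cases "z = 0")
    case False
    hence "z > 0" by (auto simp: z_def)
    thus ?thesis using powr_add[of z "m - 1" 1] by simp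
  qed simp
  have "\<bar>Jp m x * y\<bar> \<le> \<bar>x\<bar> powr (m - 1) * \<bar>y\<bar>"
    by (simp add: Jp_eq abs_mult abs_sgn_eq)
  also have "\<dots> \<le> z powr (m - 1) * z"
    using assms by (intro mult_mono powr_mono2) (auto simp: z_def)
  also have "\<dots> \<le> \<bar>x\<bar> powr m + \<bar>y\<bar> powr m"
    unfolding split[symmetric] by (simp add: z_def max_def)
  finally show ?thesis .
qed

text \<open>Here b plays the increment of the level, a that of the test function, and b - a that of
  the solution. Either flux and test increment have opposite signs, or a lies between 0 and b and
  both factors are controlled by b.\<close>

lemma Jp_diff_mult_le:
  assumes m: "m > 1" shows "Jp m (b - a) * a \<le> \<bar>b\<bar> powr m"
proof (cases "(b - a) * a \<le> 0")
  case True
  have "Jp m (b - a) * a = \<bar>b - a\<bar> powr (m - 2) * ((b - a) * a)" by (simp add: Jp_def)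
  also have "\<dots> \<le> 0" using True by (simp add: mult_nonneg_nonpos)
  finally show ?thesis by (rule order_trans) simp
next
  case False
  hence ab: "\<bar>b - a\<bar> \<le> \<bar>b\<bar>" "\<bar>a\<bar> \<le> \<bar>b\<bar>" "b \<noteq> 0"
    by (auto simp: mult_le_0_iff abs_if split: if_splits)
  have "b \<noteq> a" using False by auto
  hence "Jp m (b - a) * a \<le> \<bar>b - a\<bar> powr (m - 1) * \<bar>a\<bar>"
    using abs_ge_self[of "Jp m (b - a) * a"] by (simp add: Jp_eq abs_mult abs_sgn_eq split: if_splits)
  also have "\<dots> \<le> \<bar>b\<bar> powr (m - 1) * \<bar>b\<bar>" using ab m by (intro mult_mono powr_mono2) auto
  also have "\<dots> = \<bar>b\<bar> powr m" using powr_add[of "\<bar>b\<bar>" "m - 1" 1] ab(3) by simp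
  finally show ?thesis .
qed

text \<open>This version keeps a good term. If |b| \<le> a / 2, the flux is at most its value at -a
  / 2 and the product is at most -2 (a / 2)^m. Otherwise (a / 2)^m is itself at most |b|^m, so it
  can be subtracted at the cost of doubling the right side of the weak form.\<close>

lemma Jp_diff_mult_le_strong:
  assumes m: "m > 1" and a: "a > 0" shows "Jp m (b - a) * a \<le> 2 * \<bar>b\<bar> powr m - a powr m / 2 powr m"
proof (cases "\<bar>b\<bar> \<le> a / 2")
  case True
  hence "b - a \<le> - (a / 2)" by simp
  hence "Jp m (b - a) \<le> Jp m (- (a / 2))" by (rule Jp_mono[OF m])
  also have "\<dots> = - ((a / 2) powr (m - 1))" using a by (simp add: Jp_of_neg)
  finally have "Jp m (b - a) * a \<le> - ((a / 2) powr (m - 1)) * a" using a by (intro mult_right_mono) auto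
  also have "\<dots> = - 2 * (a / 2) powr m" using powr_add[of "a / 2" "m - 1" 1] a by simp
  also have "\<dots> \<le> 2 * \<bar>b\<bar> powr m - (a / 2) powr m"
    using powr_ge_zero[of "a / 2" m] powr_ge_zero[of "\<bar>b\<bar>" m] by linarith
  finally show ?thesis using a by (simp add: powr_divide)
next
  case False
  have "(a / 2) powr m \<le> \<bar>b\<bar> powr m" using False a m by (intro powr_mono2) auto
  thus ?thesis using Jp_diff_mult_le[OF m, of b a] a by (simp add: powr_divide)
qed

text \<open>The level \<psi> already contains the cutoff. Where this function is positive and v is
  nonnegative, v equals \<psi> minus it, so an increment of v splits exactly. The positive part of v
  ensures that the function vanishes wherever \<psi> does, even at far points where v is
  negative.\<close>

definition testfn :: "('a \<Rightarrow> real) \<Rightarrow> ('a \<Rightarrow> real) \<Rightarrow> 'a \<Rightarrow> real" where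
  "testfn \<psi> v x = max 0 (\<psi> x - max 0 (v x))"

text \<open>Bad terms of the flux, charged to the point x where the test function is positive: the
  cost of the cutoff if y is in the ball, the nonlocal tail if it is not. Charging ordered pairs
  reduces double integrals to integrals over the positivity set.\<close>

definition Gpos :: "real \<Rightarrow> real \<Rightarrow> 'a set \<Rightarrow> ('a \<Rightarrow> real) \<Rightarrow> ('a \<Rightarrow> real) \<Rightarrow> 'a \<Rightarrow> 'a \<Rightarrow> real" where
  "Gpos m k B \<psi> v x y = (if testfn \<psi> v x > 0 then
     (if y \<in> B then 2 * \<bar>\<psi> x - \<psi> y\<bar> powr m else testfn \<psi> v x * (k + max 0 (- v y)) powr (m - 1)) else 0)"

text \<open>Good terms: the interaction of the positivity set with its complement, and with the set
  where v is at least k. The extra factors 1 / 2 come from averaging two bounds; k / 2 appears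
  because v is at most k / 2 at x.\<close>

definition Gneg :: "real \<Rightarrow> real \<Rightarrow> 'a set \<Rightarrow> ('a \<Rightarrow> real) \<Rightarrow> ('a \<Rightarrow> real) \<Rightarrow> 'a \<Rightarrow> 'a \<Rightarrow> real" where
  "Gneg m k B \<psi> v x y = (if testfn \<psi> v x > 0 \<and> y \<in> B then
     (if testfn \<psi> v y = 0 then testfn \<psi> v x powr m / 2 powr (m + 1) else 0)
     + (if v y \<ge> k then (k / 2) powr (m - 1) * testfn \<psi> v x / 2 else 0) else 0)"

lemma testfn_nonneg [simp]: "testfn \<psi> v x \<ge> 0"
  by (simp add: testfn_def)

lemma Gpos_nonneg: "Gpos m k B \<psi> v x y \<ge> 0"
  by (simp add: Gpos_def)

lemma Gneg_nonneg: "Gneg m k B \<psi> v x y \<ge> 0"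
  by (simp add: Gneg_def)

lemma testfn_diff_le: "\<bar>testfn \<psi> v x - testfn \<psi> v y\<bar> \<le> \<bar>\<psi> x - \<psi> y\<bar> + \<bar>v x - v y\<bar>"
proof -
  have *: "\<bar>max 0 a - max 0 b\<bar> \<le> \<bar>a - b\<bar>" for a b :: real by linarith
  have "\<bar>testfn \<psi> v x - testfn \<psi> v y\<bar> \<le> \<bar>(\<psi> x - max 0 (v x)) - (\<psi> y - max 0 (v y))\<bar>"
    unfolding testfn_def by (rule *)
  with *[of "v x" "v y"] show ?thesis by linarith
qed

text \<open>When the value at y exceeds k there are two competing upper bounds: the Caccioppoli type
  estimate and the strong negativity of the flux. Their mean is used, so that the set where v is
  large keeps contributing at every level.\<close>

lemma flux_bound_aux:
  assumes m: "m > 1" and \<psi>: "0 \<le> \<psi> x" "0 \<le> \<psi> y" "\<psi> x \<le> l" "\<psi> y \<le> l" and k: "0 < k" "2 * l \<le> k"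
    and B: "x \<in> B \<Longrightarrow> v x \<ge> 0" "y \<in> B \<Longrightarrow> v y \<ge> 0" "testfn \<psi> v x > 0 \<Longrightarrow> x \<in> B" "testfn \<psi> v y > 0 \<Longrightarrow> y \<in> B"
    and x: "testfn \<psi> v x > 0"
  shows "Jp m (v x - v y) * (testfn \<psi> v x - testfn \<psi> v y)
    \<le> Gpos m k B \<psi> v x y - Gneg m k B \<psi> v x y + Gpos m k B \<psi> v y x - Gneg m k B \<psi> v y x"
proof -
  define \<phi> where "\<phi> = testfn \<psi> v"
  have xB: "x \<in> B" using B(3) x by simp
  have vx0: "v x \<ge> 0" using B(1) xB by simp
  have vx: "v x \<ge> 0" "v x = \<psi> x - \<phi> x" "\<phi> x > 0"
    using vx0 x unfolding \<phi>_def testfn_def by linarith+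
  hence xl: "v x < k" using \<psi> k by linarith
  consider (both) "\<phi> y > 0" | (inB) "\<phi> y = 0" "y \<in> B" | (out) "\<phi> y = 0" "y \<notin> B"
    using testfn_nonneg[of \<psi> v y] unfolding \<phi>_def by linarith
  thus ?thesis
  proof cases
    case both
    hence yB: "y \<in> B" using B(4) by (simp add: \<phi>_def)
    have vy0: "v y \<ge> 0" using B(2) yB by simp
    have vy: "v y \<ge> 0" "v y = \<psi> y - \<phi> y" "v y < k"
      using vy0 both \<psi> k unfolding \<phi>_def testfn_def by linarith+
    have "v x - v y = (\<psi> x - \<psi> y) - (\<phi> x - \<phi> y)" using vx vy by simp
    hence "Jp m (v x - v y) * (\<phi> x - \<phi> y) \<le> \<bar>\<psi> x - \<psi> y\<bar> powr m"
      using Jp_diff_mult_le[OF m, of "\<psi> x - \<psi> y" "\<phi> x - \<phi> y"] by simp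
    moreover have "Gneg m k B \<psi> v x y = 0" "Gneg m k B \<psi> v y x = 0"
      using both vx vy xl unfolding Gneg_def \<phi>_def by auto
    moreover have "Gpos m k B \<psi> v x y = 2 * \<bar>\<psi> x - \<psi> y\<bar> powr m" "Gpos m k B \<psi> v y x \<ge> 0"
      using x yB by (simp_all add: Gpos_def Gpos_nonneg)
    moreover have "0 \<le> \<bar>\<psi> x - \<psi> y\<bar> powr m" by simp
    ultimately show ?thesis unfolding \<phi>_def by linarith
  next
    case inB
    have "v y \<ge> 0" using inB B(2) by simp
    hence vy: "v y \<ge> \<psi> y" using inB(1) unfolding \<phi>_def testfn_def by linarith
    have z: "Gpos m k B \<psi> v y x = 0" "Gneg m k B \<psi> v y x = 0"
      using inB by (simp_all add: Gpos_def Gneg_def \<phi>_def)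
    have "Jp m (v x - v y) \<le> Jp m ((\<psi> x - \<psi> y) - \<phi> x)"
      by (rule Jp_mono[OF m]) (use vx vy in simp)
    hence "Jp m (v x - v y) * \<phi> x \<le> Jp m ((\<psi> x - \<psi> y) - \<phi> x) * \<phi> x"
      using vx by (intro mult_right_mono) auto
    also have "\<dots> \<le> 2 * \<bar>\<psi> x - \<psi> y\<bar> powr m - \<phi> x powr m / 2 powr m"
      by (rule Jp_diff_mult_le_strong[OF m]) (rule vx)
    finally have U1: "Jp m (v x - v y) * \<phi> x \<le> 2 * \<bar>\<psi> x - \<psi> y\<bar> powr m - \<phi> x powr m / 2 powr m" .
    have gp: "Gpos m k B \<psi> v x y = 2 * \<bar>\<psi> x - \<psi> y\<bar> powr m"
      using x inB by (simp add: Gpos_def)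
    have half: "\<phi> x powr m / 2 powr (m + 1) = \<phi> x powr m / 2 powr m / 2" by (simp add: powr_add)
    have nn: "\<phi> x powr m / 2 powr m \<ge> 0" "\<bar>\<psi> x - \<psi> y\<bar> powr m \<ge> 0" by simp_all
    show ?thesis
    proof (cases "v y \<ge> k")
      case True
      have "Jp m (v x - v y) \<le> Jp m (- (k / 2))"
        by (rule Jp_mono[OF m]) (use True vx \<psi> k in simp)
      also have "\<dots> = - ((k / 2) powr (m - 1))" using k by (simp add: Jp_of_neg)
      finally have "Jp m (v x - v y) * \<phi> x \<le> - ((k / 2) powr (m - 1)) * \<phi> x" using vx by (intro mult_right_mono) auto
      hence U2: "Jp m (v x - v y) * \<phi> x \<le> - ((k / 2) powr (m - 1) * \<phi> x)" by simp
      have geq: "Gneg m k B \<psi> v x y = \<phi> x powr m / 2 powr m / 2 + (k / 2) powr (m - 1) * \<phi> x / 2"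
        using x inB True unfolding half[symmetric] by (simp add: Gneg_def \<phi>_def)
      have mean: "X \<le> 2 * b - (c / 2 + d / 2)" if "X \<le> 2 * b - c" "X \<le> - d" "0 \<le> b" for X b c d :: real
        using that by linarith
      show ?thesis using mean[OF U1 U2 nn(2)]
        unfolding z gp geq \<phi>_def[symmetric] inB(1) diff_zero add_0_right .
    next
      case False
      have geq: "Gneg m k B \<psi> v x y = \<phi> x powr m / 2 powr m / 2"
        using x inB False unfolding half[symmetric] by (simp add: Gneg_def \<phi>_def)
      have mean: "X \<le> b - c / 2" if "X \<le> b - c" "0 \<le> c" for X b c :: real
        using that by linarith
      show ?thesis using mean[OF U1 nn(1)]
        unfolding z gp geq \<phi>_def[symmetric] inB(1) diff_zero add_0_right .
    qed
  next
    case out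
    have z: "Gpos m k B \<psi> v y x = 0" "Gneg m k B \<psi> v y x = 0" "Gneg m k B \<psi> v x y = 0"
      using out by (simp_all add: Gpos_def Gneg_def \<phi>_def)
    have "Jp m (v x - v y) \<le> Jp m (k + max 0 (- v y))"
      by (rule Jp_mono[OF m]) (use xl in simp)
    also have "\<dots> = (k + max 0 (- v y)) powr (m - 1)" using k by (intro Jp_of_pos) simp
    finally have "Jp m (v x - v y) * \<phi> x \<le> (k + max 0 (- v y)) powr (m - 1) * \<phi> x"
      using vx by (intro mult_right_mono) auto
    thus ?thesis using x out unfolding z by (simp add: Gpos_def \<phi>_def mult.commute)
  qed
qed

lemma flux_bound:
  assumes m: "m > 1" and \<psi>: "0 \<le> \<psi> x" "0 \<le> \<psi> y" "\<psi> x \<le> l" "\<psi> y \<le> l" and k: "0 < k" "2 * l \<le> k"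
    and B: "x \<in> B \<Longrightarrow> v x \<ge> 0" "y \<in> B \<Longrightarrow> v y \<ge> 0" "testfn \<psi> v x > 0 \<Longrightarrow> x \<in> B" "testfn \<psi> v y > 0 \<Longrightarrow> y \<in> B"
  shows "Jp m (v x - v y) * (testfn \<psi> v x - testfn \<psi> v y)
    \<le> Gpos m k B \<psi> v x y - Gneg m k B \<psi> v x y + Gpos m k B \<psi> v y x - Gneg m k B \<psi> v y x"
proof -
  consider "testfn \<psi> v x > 0" | "testfn \<psi> v y > 0" | "testfn \<psi> v x = 0" "testfn \<psi> v y = 0"
    using testfn_nonneg[of \<psi> v x] testfn_nonneg[of \<psi> v y] by linarith
  thus ?thesis
  proof cases
    case 1
    show ?thesis by (rule flux_bound_aux[where l=l and B=B, OF m \<psi>(1-4) k B(1) B(2) B(3) B(4) 1])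
  next
    case 2
    have "Jp m (v x - v y) * (testfn \<psi> v x - testfn \<psi> v y) = Jp m (v y - v x) * (testfn \<psi> v y - testfn \<psi> v x)"
      using Jp_uminus[of m "v y - v x"] by (simp add: algebra_simps)
    also have "\<dots> \<le> Gpos m k B \<psi> v y x - Gneg m k B \<psi> v y x + Gpos m k B \<psi> v x y - Gneg m k B \<psi> v x y"
      by (rule flux_bound_aux[where l=l and B=B, OF m \<psi>(2) \<psi>(1) \<psi>(4) \<psi>(3) k B(2) B(1) B(4) B(3) 2])
    finally show ?thesis by linarith
  next
    case 3
    thus ?thesis by (simp add: Gpos_def Gneg_def)
  qed
qed

text \<open>The positive and negative parts of F have the same finite integral and cancel. The
  integrals of N and P may be infinite, which suits the energy inequality, where their finiteness is
  not known in advance.\<close>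

lemma nn_integral_le_of_integral_zero:
  fixes F N P :: "'a \<Rightarrow> real"
  assumes F: "integrable M F" "integral\<^sup>L M F = 0"
    and [measurable]: "N \<in> borel_measurable M" "P \<in> borel_measurable M"
    and nn: "\<And>z. 0 \<le> N z" "\<And>z. 0 \<le> P z"
    and le: "AE z in M. F z + N z \<le> P z"
  shows "(\<integral>\<^sup>+z. ennreal (N z) \<partial>M) \<le> (\<integral>\<^sup>+z. ennreal (P z) \<partial>M)"
proof -
  have [measurable]: "F \<in> borel_measurable M" using F(1) by (rule borel_measurable_integrable)
  have fin: "(\<integral>\<^sup>+z. ennreal (F z) \<partial>M) \<noteq> \<infinity>" "(\<integral>\<^sup>+z. ennreal (- F z) \<partial>M) \<noteq> \<infinity>"
    using F(1) by (auto simp: real_integrable_def)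
  have "enn2real (\<integral>\<^sup>+z. ennreal (F z) \<partial>M) = enn2real (\<integral>\<^sup>+z. ennreal (- F z) \<partial>M)"
    using F by (simp add: real_lebesgue_integral_def)
  hence eq: "(\<integral>\<^sup>+z. ennreal (F z) \<partial>M) = (\<integral>\<^sup>+z. ennreal (- F z) \<partial>M)"
    using fin by (metis ennreal_enn2real_if infinity_ennreal_def)
  have "(\<integral>\<^sup>+z. ennreal (F z) \<partial>M) + (\<integral>\<^sup>+z. ennreal (N z) \<partial>M) = (\<integral>\<^sup>+z. ennreal (F z) + ennreal (N z) \<partial>M)"
    by (rule nn_integral_add[symmetric]) measurable
  also have "\<dots> \<le> (\<integral>\<^sup>+z. ennreal (- F z) + ennreal (P z) \<partial>M)"
  proof (rule nn_integral_mono_AE, use le in eventually_elim)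
    fix z assume *: "F z + N z \<le> P z"
    show "ennreal (F z) + ennreal (N z) \<le> ennreal (- F z) + ennreal (P z)"
    proof (cases "F z \<ge> 0")
      case True
      have "ennreal (F z) + ennreal (N z) = ennreal (F z + N z)" using True nn by (simp add: ennreal_plus)
      also have "\<dots> \<le> ennreal (P z)" using * by (rule ennreal_leI)
      also have "\<dots> \<le> ennreal (- F z) + ennreal (P z)" by simp
      finally show ?thesis .
    next
      case False
      have "ennreal (F z) + ennreal (N z) = ennreal (N z)" using False by (simp add: ennreal_neg)
      also have "\<dots> \<le> ennreal (- F z + P z)" using * by (intro ennreal_leI) simp
      also have "\<dots> = ennreal (- F z) + ennreal (P z)" using False nn by (intro ennreal_plus) auto
      finally show ?thesis .
    qed
  qed
  also have "\<dots> = (\<integral>\<^sup>+z. ennreal (F z) \<partial>M) + (\<integral>\<^sup>+z. ennreal (P z) \<partial>M)"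
    unfolding eq by (rule nn_integral_add) measurable
  finally show ?thesis using fin(1) by (simp add: ennreal_add_left_cancel_le)
qed

lemma nn_integral_pair_symmetrize:
  fixes N P :: "'a::euclidean_space \<Rightarrow> 'a \<Rightarrow> ennreal"
  assumes N: "(\<lambda>z. N (fst z) (snd z)) \<in> borel_measurable (lebesgue \<Otimes>\<^sub>M lebesgue)"
  shows "(\<integral>\<^sup>+z. N (fst z) (snd z) + N (snd z) (fst z) \<partial>(lebesgue \<Otimes>\<^sub>M lebesgue))
      = 2 * (\<integral>\<^sup>+x. \<integral>\<^sup>+y. N x y \<partial>lebesgue \<partial>lebesgue)"
    and "(\<lambda>z. N (snd z) (fst z)) \<in> borel_measurable (lebesgue \<Otimes>\<^sub>M lebesgue)"
proof -
  have sw: "(\<lambda>z. (snd z, fst z)) \<in> lebesgue \<Otimes>\<^sub>M lebesgue \<rightarrow>\<^sub>M lebesgue \<Otimes>\<^sub>M (lebesgue :: 'a measure)"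
    by measurable
  show N': "(\<lambda>z. N (snd z) (fst z)) \<in> borel_measurable (lebesgue \<Otimes>\<^sub>M lebesgue)"
    using measurable_compose[OF sw N] by simp
  have N2: "(\<lambda>(x, y). N x y) \<in> borel_measurable (lebesgue \<Otimes>\<^sub>M lebesgue)"
    using N by (simp add: split_beta)
  have "(\<integral>\<^sup>+z. N (fst z) (snd z) \<partial>(lebesgue \<Otimes>\<^sub>M lebesgue)) = (\<integral>\<^sup>+x. \<integral>\<^sup>+y. N x y \<partial>lebesgue \<partial>lebesgue)"
    using lebesgue.nn_integral_fst[OF N] by simp
  moreover have "(\<integral>\<^sup>+z. N (snd z) (fst z) \<partial>(lebesgue \<Otimes>\<^sub>M lebesgue)) = (\<integral>\<^sup>+y. \<integral>\<^sup>+x. N x y \<partial>lebesgue \<partial>lebesgue)"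
  proof -
    have "(\<integral>\<^sup>+z. N (snd z) (fst z) \<partial>(lebesgue \<Otimes>\<^sub>M lebesgue)) = (\<integral>\<^sup>+x. \<integral>\<^sup>+y. N y x \<partial>lebesgue \<partial>lebesgue)"
      using lebesgue.nn_integral_fst[OF N'] by simp
    thus ?thesis by simp
  qed
  moreover have "(\<integral>\<^sup>+y. \<integral>\<^sup>+x. N x y \<partial>lebesgue \<partial>lebesgue) = (\<integral>\<^sup>+x. \<integral>\<^sup>+y. N x y \<partial>lebesgue \<partial>lebesgue)"
    using lebesgue_pair.Fubini'[OF N2] by simp
  ultimately show "(\<integral>\<^sup>+z. N (fst z) (snd z) + N (snd z) (fst z) \<partial>(lebesgue \<Otimes>\<^sub>M lebesgue))
      = 2 * (\<integral>\<^sup>+x. \<integral>\<^sup>+y. N x y \<partial>lebesgue \<partial>lebesgue)"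
    by (simp add: nn_integral_add[OF N N'] mult_2)
qed

lemma AE_lebesgue_pair:
  assumes "AE x in lebesgue. P (x :: 'a::euclidean_space)"
  shows "AE z in lebesgue \<Otimes>\<^sub>M (lebesgue :: 'a measure). P (fst z) \<and> P (snd z)"
proof -
  obtain N where N: "{x. \<not> P x} \<subseteq> N" "N \<in> null_sets lebesgue"
    using assms unfolding eventually_ae_filter by auto
  have Nm [measurable]: "N \<in> sets lebesgue" using N by auto
  have "N \<times> UNIV \<union> UNIV \<times> N \<in> null_sets (lebesgue \<Otimes>\<^sub>M (lebesgue :: 'a measure))"
  proof (rule null_sets.Un)
    have "emeasure (lebesgue \<Otimes>\<^sub>M (lebesgue :: 'a measure)) (N \<times> UNIV) = 0"
      using N by (subst lebesgue.emeasure_pair_measure_Times) auto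
    moreover have "N \<times> UNIV \<in> sets (lebesgue \<Otimes>\<^sub>M (lebesgue :: 'a measure))" by (intro pair_measureI) auto
    ultimately show "N \<times> UNIV \<in> null_sets (lebesgue \<Otimes>\<^sub>M (lebesgue :: 'a measure))" by (simp add: null_sets_def)
    have "emeasure (lebesgue \<Otimes>\<^sub>M (lebesgue :: 'a measure)) (UNIV \<times> N) = 0"
      using N by (subst lebesgue.emeasure_pair_measure_Times) auto
    moreover have "UNIV \<times> N \<in> sets (lebesgue \<Otimes>\<^sub>M (lebesgue :: 'a measure))" by (intro pair_measureI) auto
    ultimately show "UNIV \<times> N \<in> null_sets (lebesgue \<Otimes>\<^sub>M (lebesgue :: 'a measure))" by (simp add: null_sets_def)
  qed
  thus ?thesis by (rule AE_I') (use N in auto)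
qed

text \<open>On the diagonal the value is 0 by the conventions for \<open>powr\<close> and division.
  Lower bounds on the weight therefore have to exclude x = y first.\<close>

definition Wt :: "real \<Rightarrow> 'n::finite heis \<Rightarrow> 'n heis \<Rightarrow> real" where
  "Wt e x y = 1 / kern x y powr (hdim TYPE('n) + e)"

lemma Wt_nonneg [simp]: "Wt e x y \<ge> 0"
  by (simp add: Wt_def)

lemma Wt_commute: "Wt e x y = Wt e y x"
  by (simp add: Wt_def kern_commute)

lemma Wt_measurable_pair [measurable]:
  "(\<lambda>z. Wt e (fst z) (snd z)) \<in> borel_measurable (lebesgue \<Otimes>\<^sub>M (lebesgue :: 'n::finite heis measure))"
  unfolding Wt_def by measurable

lemma Wt_measurable [measurable]:
  "Wt e x \<in> borel_measurable (lebesgue :: 'n::finite heis measure)"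
  unfolding Wt_def by measurable

lemma Hfun_conv_Wt:
  "Hfun p q s t a x y \<tau> / kern x y powr hdim TYPE('n::finite)
    = \<tau> powr p * Wt (s * p) x (y :: 'n heis) + a x y * (\<tau> powr q * Wt (t * q) x y)"
  by (simp add: Hfun_def Wt_def powr_add add_divide_distrib mult.commute)

lemma Aspace_iff:
  "u \<in> Aspace p q s t a (\<Omega> :: 'n::finite heis set) \<longleftrightarrow> u \<in> borel_measurable lebesgue \<and>
      (\<integral>\<^sup>+ x. indicator \<Omega> x * ennreal (\<bar>u x\<bar> powr p) \<partial>lebesgue) < \<infinity> \<and>
      (\<integral>\<^sup>+ z. indicator (CC \<Omega>) z * ennreal (\<bar>u (fst z) - u (snd z)\<bar> powr p * Wt (s * p) (fst z) (snd z)
         + a (fst z) (snd z) * (\<bar>u (fst z) - u (snd z)\<bar> powr q * Wt (t * q) (fst z) (snd z))) \<partial>(lebesgue \<Otimes>\<^sub>M lebesgue)) < \<infinity>"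
  unfolding Aspace_def mem_Collect_eq Hfun_conv_Wt ..

text \<open>At distance below d the Lipschitz bound removes m powers of the singularity, and what
  remains is integrable because e < m. Farther away only the size l is used. Splitting at d makes
  both contributions multiples of d^(-e).\<close>

lemma nn_integral_cutoff:
  fixes x :: "'n::finite heis"
  assumes e: "0 < e" "e < m" and N: "1 \<le> N" and l: "0 \<le> l" and d: "0 < d"
    and \<psi>: "\<And>y. \<bar>\<psi> x - \<psi> y\<bar> \<le> l" "\<And>y. \<bar>\<psi> x - \<psi> y\<bar> \<le> N * l / d * kern y x"
  shows "(\<integral>\<^sup>+y. ennreal (\<bar>\<psi> x - \<psi> y\<bar> powr m * Wt e x y) \<partial>lebesgue)
    \<le> ennreal ((kint TYPE('n) (m - e) + kint TYPE('n) e) * (N powr m * l powr m * d powr - e))"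
proof -
  let ?Q = "hdim TYPE('n)"
  have m: "m > 0" using e by simp
  define L where "L = N * l / d"
  have L: "L \<ge> 0" using N l d by (simp add: L_def)
  have "(\<integral>\<^sup>+y. ennreal (\<bar>\<psi> x - \<psi> y\<bar> powr m * Wt e x y) \<partial>lebesgue)
    \<le> (\<integral>\<^sup>+y. ennreal (L powr m) * (indicator {y. kern y x < d} y * ennreal (kern y x powr (m - e) / kern y x powr ?Q))
        + ennreal (l powr m) * (indicator {y. d \<le> kern y x} y * ennreal (1 / kern y x powr (?Q + e))) \<partial>lebesgue)"
  proof (rule nn_integral_mono)
    fix y
    show "ennreal (\<bar>\<psi> x - \<psi> y\<bar> powr m * Wt e x y)
      \<le> ennreal (L powr m) * (indicator {y. kern y x < d} y * ennreal (kern y x powr (m - e) / kern y x powr ?Q))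
        + ennreal (l powr m) * (indicator {y. d \<le> kern y x} y * ennreal (1 / kern y x powr (?Q + e)))"
    proof (cases "kern y x < d")
      case True
      have "\<bar>\<psi> x - \<psi> y\<bar> powr m * Wt e x y \<le> L powr m * (kern y x powr (m - e) / kern y x powr ?Q)"
      proof (cases "kern y x = 0")
        case True
        hence "\<bar>\<psi> x - \<psi> y\<bar> = 0" using \<psi>(2)[of y] by simp
        thus ?thesis by simp
      next
        case False
        hence K: "kern y x > 0" by (simp add: less_le)
        have "\<bar>\<psi> x - \<psi> y\<bar> powr m \<le> (L * kern y x) powr m"
          using \<psi>(2)[of y] m by (intro powr_mono2) (auto simp: L_def)
        also have "\<dots> = L powr m * kern y x powr m" using L by (simp add: powr_mult)
        finally have "\<bar>\<psi> x - \<psi> y\<bar> powr m * Wt e x y \<le> L powr m * kern y x powr m * Wt e x y"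
          by (rule mult_right_mono) simp
        also have "\<dots> = L powr m * (kern y x powr (m - e) / kern y x powr ?Q)"
          using K by (simp add: Wt_def kern_commute[of x y] powr_add powr_diff)
        finally show ?thesis .
      qed
      thus ?thesis using True L by (simp add: ennreal_mult[symmetric] ennreal_leI)
    next
      case False
      have "\<bar>\<psi> x - \<psi> y\<bar> powr m * Wt e x y \<le> l powr m * (1 / kern y x powr (?Q + e))"
        unfolding Wt_def kern_commute[of x y] using \<psi>(1)[of y] m by (intro mult_right_mono powr_mono2) auto
      hence "ennreal (\<bar>\<psi> x - \<psi> y\<bar> powr m * Wt e x y) \<le> ennreal (l powr m) * ennreal (1 / kern y x powr (?Q + e))"
        by (subst ennreal_mult[symmetric]) (auto intro: ennreal_leI)
      thus ?thesis using False by simp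
    qed
  qed
  also have "\<dots> = ennreal (L powr m) * (\<integral>\<^sup>+y. indicator {y. kern y x < d} y * ennreal (kern y x powr (m - e) / kern y x powr ?Q) \<partial>lebesgue)
        + ennreal (l powr m) * (\<integral>\<^sup>+y. indicator {y. d \<le> kern y x} y * ennreal (1 / kern y x powr (?Q + e)) \<partial>lebesgue)"
    by (subst nn_integral_add) (simp_all add: nn_integral_cmult)
  also have "\<dots> \<le> ennreal (L powr m) * ennreal (kint TYPE('n) (m - e) * d powr (m - e))
        + ennreal (l powr m) * ennreal (kint TYPE('n) e * d powr - e)"
    using e d by (intro add_mono mult_left_mono nn_integral_kern_near nn_integral_kern_far) auto
  also have "\<dots> = ennreal (L powr m * (kint TYPE('n) (m - e) * d powr (m - e)) + l powr m * (kint TYPE('n) e * d powr - e))"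
    using kint_pos[where 'n='n, of "m - e"] kint_pos[where 'n='n, of e] e
    by (simp add: ennreal_mult[symmetric] ennreal_plus[symmetric] del: ennreal_plus)
  also have "\<dots> \<le> ennreal ((kint TYPE('n) (m - e) + kint TYPE('n) e) * (N powr m * l powr m * d powr - e))"
  proof (rule ennreal_leI)
    define X where "X = N powr m * l powr m * d powr - e"
    have LX: "L powr m * d powr (m - e) = X"
      using N l d by (simp add: L_def X_def powr_mult powr_divide powr_diff powr_minus_divide)
    have "1 powr m \<le> N powr m" using N m by (intro powr_mono2) auto
    hence "1 * (l powr m * d powr - e) \<le> N powr m * (l powr m * d powr - e)"
      by (intro mult_right_mono) auto
    hence lX: "l powr m * d powr - e \<le> X" by (simp add: X_def)
    have "L powr m * (kint TYPE('n) (m - e) * d powr (m - e)) + l powr m * (kint TYPE('n) e * d powr - e)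
       = kint TYPE('n) (m - e) * (L powr m * d powr (m - e)) + kint TYPE('n) e * (l powr m * d powr - e)"
      by (simp only: mult_ac)
    also have "\<dots> \<le> kint TYPE('n) (m - e) * X + kint TYPE('n) e * X"
      unfolding LX using lX kint_pos[where 'n='n, of e] e by (intro add_left_mono mult_left_mono) auto
    finally show "L powr m * (kint TYPE('n) (m - e) * d powr (m - e)) + l powr m * (kint TYPE('n) e * d powr - e)
      \<le> (kint TYPE('n) (m - e) + kint TYPE('n) e) * (N powr m * l powr m * d powr - e)"
      unfolding X_def[symmetric] by (simp add: distrib_right)
  qed
  finally show ?thesis .
qed

lemma powr_add_le:
  fixes x y e :: real
  assumes "x \<ge> 0" "y \<ge> 0" "e \<ge> 0"
  shows "(x + y) powr e \<le> 2 powr e * (x powr e + y powr e)"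
proof -
  have "(x + y) powr e \<le> (2 * max x y) powr e" using assms by (intro powr_mono2) auto
  also have "\<dots> = 2 powr e * max x y powr e" using assms by (simp add: powr_mult)
  also have "\<dots> \<le> 2 powr e * (x powr e + y powr e)" by (intro mult_left_mono) (auto simp: max_def)
  finally show ?thesis .
qed

lemma measurable_pair_fst_snd:
  assumes "u \<in> borel_measurable (lebesgue :: 'a::euclidean_space measure)"
  shows "(\<lambda>z. u (fst z)) \<in> borel_measurable (lebesgue \<Otimes>\<^sub>M (lebesgue :: 'a measure))"
    "(\<lambda>z. u (snd z)) \<in> borel_measurable (lebesgue \<Otimes>\<^sub>M (lebesgue :: 'a measure))"
  using measurable_compose[OF measurable_fst assms] measurable_compose[OF measurable_snd assms] by auto

lemma CC_sets [measurable]: "\<Omega> \<in> sets lebesgue \<Longrightarrow> CC (\<Omega> :: 'n::finite heis set) \<in> sets (lebesgue \<Otimes>\<^sub>M lebesgue)"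
proof -
  assume [measurable]: "\<Omega> \<in> sets lebesgue"
  have "CC \<Omega> = space (lebesgue \<Otimes>\<^sub>M lebesgue) - (UNIV - \<Omega>) \<times> (UNIV - \<Omega>)"
    by (simp add: CC_def space_pair_measure)
  also have "\<dots> \<in> sets (lebesgue \<Otimes>\<^sub>M lebesgue)"
  proof (rule sets.compl_sets, rule pair_measureI)
    show "UNIV - \<Omega> \<in> sets lebesgue" "UNIV - \<Omega> \<in> sets lebesgue"
      using sets.compl_sets[of \<Omega> "lebesgue :: 'n heis measure"] by auto
  qed
  finally show ?thesis .
qed

section \<open>Admissible test functions and the tested equation\<close>

definition pair_pos :: "real \<Rightarrow> real \<Rightarrow> real \<Rightarrow> real \<Rightarrow> ('n::finite heis \<Rightarrow> 'n heis \<Rightarrow> real) \<Rightarrow> real \<Rightarrow> 'n heis set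
    \<Rightarrow> ('n heis \<Rightarrow> real) \<Rightarrow> ('n heis \<Rightarrow> real) \<Rightarrow> 'n heis \<Rightarrow> 'n heis \<Rightarrow> real" where
  "pair_pos p q s t a k B \<psi> v x y = Gpos p k B \<psi> v x y * Wt (s * p) x y + a x y * (Gpos q k B \<psi> v x y * Wt (t * q) x y)"

definition pair_neg :: "real \<Rightarrow> real \<Rightarrow> real \<Rightarrow> real \<Rightarrow> ('n::finite heis \<Rightarrow> 'n heis \<Rightarrow> real) \<Rightarrow> real \<Rightarrow> 'n heis set
    \<Rightarrow> ('n heis \<Rightarrow> real) \<Rightarrow> ('n heis \<Rightarrow> real) \<Rightarrow> 'n heis \<Rightarrow> 'n heis \<Rightarrow> real" where
  "pair_neg p q s t a k B \<psi> v x y = Gneg p k B \<psi> v x y * Wt (s * p) x y + a x y * (Gneg q k B \<psi> v x y * Wt (t * q) x y)"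

lemma testfn_measurable:
  assumes [measurable]: "v \<in> borel_measurable M" "\<psi> \<in> borel_measurable M"
  shows "testfn \<psi> v \<in> borel_measurable M"
  unfolding testfn_def by measurable

lemma pair_pos_neg_measurable:
  fixes v \<psi> :: "'n::finite heis \<Rightarrow> real"
  assumes v [measurable]: "v \<in> borel_measurable lebesgue" and \<psi> [measurable]: "\<psi> \<in> borel_measurable lebesgue"
    and [measurable]: "(\<lambda>z. a (fst z) (snd z)) \<in> borel_measurable (lebesgue \<Otimes>\<^sub>M lebesgue)" "B \<in> sets lebesgue"
  shows "(\<lambda>z. pair_pos p q s t a k B \<psi> v (fst z) (snd z)) \<in> borel_measurable (lebesgue \<Otimes>\<^sub>M lebesgue)"
    "(\<lambda>z. pair_neg p q s t a k B \<psi> v (fst z) (snd z)) \<in> borel_measurable (lebesgue \<Otimes>\<^sub>M lebesgue)"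
proof -
  note [measurable] = measurable_pair_fst_snd[OF v] measurable_pair_fst_snd[OF \<psi>] measurable_pair_fst_snd[OF testfn_measurable[OF v \<psi>]]
  have [measurable]: "Measurable.pred (lebesgue \<Otimes>\<^sub>M (lebesgue :: 'n heis measure)) (\<lambda>z. snd z \<in> B)"
    by (rule measurable_compose[OF measurable_snd]) measurable
  show "(\<lambda>z. pair_pos p q s t a k B \<psi> v (fst z) (snd z)) \<in> borel_measurable (lebesgue \<Otimes>\<^sub>M lebesgue)"
    unfolding pair_pos_def Gpos_def by measurable
  show "(\<lambda>z. pair_neg p q s t a k B \<psi> v (fst z) (snd z)) \<in> borel_measurable (lebesgue \<Otimes>\<^sub>M lebesgue)"
    unfolding pair_neg_def Gneg_def by measurable
qed

definition hpair :: "real \<Rightarrow> real \<Rightarrow> real \<Rightarrow> real \<Rightarrow> ('n::finite heis \<Rightarrow> 'n heis \<Rightarrow> real)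
    \<Rightarrow> ('n heis \<Rightarrow> real) \<Rightarrow> 'n heis \<Rightarrow> 'n heis \<Rightarrow> real" where
  "hpair p q s t a u x y = \<bar>u x - u y\<bar> powr p * Wt (s * p) x y + a x y * (\<bar>u x - u y\<bar> powr q * Wt (t * q) x y)"

lemma hpair_nonneg: "0 \<le> a x y \<Longrightarrow> 0 \<le> hpair p q s t a u x y"
  by (simp add: hpair_def)

lemma hpair_commute: "a x y = a y x \<Longrightarrow> hpair p q s t a u x y = hpair p q s t a u y x"
  by (simp add: hpair_def Wt_commute[of _ x y] abs_minus_commute[of "u x" "u y"])

lemma hpair_measurable:
  fixes u :: "'n::finite heis \<Rightarrow> real"
  assumes u: "u \<in> borel_measurable lebesgue"
    and [measurable]: "(\<lambda>z. a (fst z) (snd z)) \<in> borel_measurable (lebesgue \<Otimes>\<^sub>M lebesgue)"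
  shows "(\<lambda>z. hpair p q s t a u (fst z) (snd z)) \<in> borel_measurable (lebesgue \<Otimes>\<^sub>M lebesgue)"
proof -
  note [measurable] = measurable_pair_fst_snd[OF u]
  show ?thesis unfolding hpair_def by measurable
qed

lemma Aspace_iff_hpair:
  "u \<in> Aspace p q s t a (\<Omega> :: 'n::finite heis set) \<longleftrightarrow> u \<in> borel_measurable lebesgue \<and>
      (\<integral>\<^sup>+ x. indicator \<Omega> x * ennreal (\<bar>u x\<bar> powr p) \<partial>lebesgue) < \<infinity> \<and>
      (\<integral>\<^sup>+ z. indicator (CC \<Omega>) z * ennreal (hpair p q s t a u (fst z) (snd z)) \<partial>(lebesgue \<Otimes>\<^sub>M lebesgue)) < \<infinity>"
  unfolding Aspace_iff hpair_def ..

text \<open>Pairs with both points outside D contribute nothing. By symmetry the double integral is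
  at most twice the part with x in D, where \<open>nn_integral_cutoff\<close> bounds the inner
  integral uniformly in x.\<close>

lemma cutoff_pair_finite:
  fixes \<psi> :: "'n::finite heis \<Rightarrow> real"
  assumes pq: "1 < p" "p \<le> q" "0 < s" "s \<le> t" "t < 1"
    and a: "(\<lambda>z. a (fst z) (snd z)) \<in> borel_measurable (lebesgue \<Otimes>\<^sub>M lebesgue)"
      "\<And>x y. 0 \<le> a x y" "\<And>x y. a x y = a y x" "\<And>x y. a x y \<le> La"
    and \<psi>: "\<psi> \<in> borel_measurable lebesgue" "\<And>x. 0 \<le> \<psi> x" "\<And>x. \<psi> x \<le> l" "\<And>x. x \<notin> D \<Longrightarrow> \<psi> x = 0"
      "\<And>x y. \<bar>\<psi> x - \<psi> y\<bar> \<le> N * l / d * kern x y"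
    and N: "1 \<le> N" "0 \<le> l" "0 < d"
    and D: "D \<in> sets lebesgue" "emeasure lebesgue D < \<infinity>"
  shows "(\<integral>\<^sup>+ z. ennreal (hpair p q s t a \<psi> (fst z) (snd z)) \<partial>(lebesgue \<Otimes>\<^sub>M lebesgue)) < \<infinity>"
proof -
  define h where "h x y = ennreal (hpair p q s t a \<psi> x y)" for x y
  define g where "g x y = indicator D x * h x y" for x y
  have hm: "(\<lambda>z. h (fst z) (snd z)) \<in> borel_measurable (lebesgue \<Otimes>\<^sub>M lebesgue)"
    unfolding h_def using hpair_measurable[OF \<psi>(1) a(1)] by (rule measurable_compose) measurable
  have gm: "(\<lambda>z. g (fst z) (snd z)) \<in> borel_measurable (lebesgue \<Otimes>\<^sub>M lebesgue)"
    unfolding g_def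
    by (intro borel_measurable_times_ennreal hm measurable_compose[OF measurable_fst borel_measurable_indicator[OF D(1)]])
  have e: "0 < s * p" "s * p < p" "0 < t * q" "t * q < q"
    using pq by auto
  define C where "C = (kint TYPE('n) (p - s * p) + kint TYPE('n) (s * p)) * (N powr p * l powr p * d powr - (s * p))
      + La * ((kint TYPE('n) (q - t * q) + kint TYPE('n) (t * q)) * (N powr q * l powr q * d powr - (t * q)))"
  have La: "La \<ge> 0" using a(2)[of 0 0] a(4)[of 0 0] by linarith
  have inner: "(\<integral>\<^sup>+y. h x y \<partial>lebesgue) \<le> ennreal C" for x
  proof -
    have [measurable]: "\<psi> \<in> borel_measurable lebesgue" by (rule \<psi>)
    have c: "\<bar>\<psi> x - \<psi> y\<bar> \<le> l" "\<bar>\<psi> x - \<psi> y\<bar> \<le> N * l / d * kern y x" for y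
      using \<psi>(2,3)[of x] \<psi>(2,3)[of y] \<psi>(5)[of x y] by (auto simp: kern_commute[of y x])
    have "(\<integral>\<^sup>+y. h x y \<partial>lebesgue) \<le> (\<integral>\<^sup>+y. ennreal (\<bar>\<psi> x - \<psi> y\<bar> powr p * Wt (s * p) x y)
        + ennreal La * ennreal (\<bar>\<psi> x - \<psi> y\<bar> powr q * Wt (t * q) x y) \<partial>lebesgue)"
    proof (rule nn_integral_mono)
      fix y
      have "hpair p q s t a \<psi> x y \<le> \<bar>\<psi> x - \<psi> y\<bar> powr p * Wt (s * p) x y + La * (\<bar>\<psi> x - \<psi> y\<bar> powr q * Wt (t * q) x y)"
        unfolding hpair_def using a(4) by (intro add_left_mono mult_right_mono) auto
      hence "h x y \<le> ennreal (\<bar>\<psi> x - \<psi> y\<bar> powr p * Wt (s * p) x y + La * (\<bar>\<psi> x - \<psi> y\<bar> powr q * Wt (t * q) x y))"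
        unfolding h_def by (rule ennreal_leI)
      thus "h x y \<le> ennreal (\<bar>\<psi> x - \<psi> y\<bar> powr p * Wt (s * p) x y) + ennreal La * ennreal (\<bar>\<psi> x - \<psi> y\<bar> powr q * Wt (t * q) x y)"
        using La by (simp add: ennreal_mult ennreal_plus)
    qed
    also have "\<dots> = (\<integral>\<^sup>+y. ennreal (\<bar>\<psi> x - \<psi> y\<bar> powr p * Wt (s * p) x y) \<partial>lebesgue)
        + ennreal La * (\<integral>\<^sup>+y. ennreal (\<bar>\<psi> x - \<psi> y\<bar> powr q * Wt (t * q) x y) \<partial>lebesgue)"
      by (subst nn_integral_add) (simp_all add: nn_integral_cmult)
    also have "\<dots> \<le> ennreal ((kint TYPE('n) (p - s * p) + kint TYPE('n) (s * p)) * (N powr p * l powr p * d powr - (s * p)))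
       + ennreal La * ennreal ((kint TYPE('n) (q - t * q) + kint TYPE('n) (t * q)) * (N powr q * l powr q * d powr - (t * q)))"
      by (intro add_mono mult_left_mono nn_integral_cutoff e N c) auto
    also have "\<dots> = ennreal C"
      unfolding C_def using La kint_pos[where 'n='n] e
      by (simp add: ennreal_plus ennreal_mult add_nonneg_nonneg less_imp_le)
    finally show ?thesis .
  qed
  have "(\<integral>\<^sup>+ z. h (fst z) (snd z) \<partial>(lebesgue \<Otimes>\<^sub>M lebesgue)) \<le> (\<integral>\<^sup>+ z. g (fst z) (snd z) + g (snd z) (fst z) \<partial>(lebesgue \<Otimes>\<^sub>M lebesgue))"
  proof (rule nn_integral_mono)
    fix z :: "'n heis \<times> 'n heis"
    obtain x y where z: "z = (x, y)" by (cases z)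
    have comm: "h y x = h x y" unfolding h_def by (subst hpair_commute[OF a(3)]) simp
    have "h x y = 0" if "x \<notin> D" "y \<notin> D"
      using \<psi>(4)[OF that(1)] \<psi>(4)[OF that(2)] by (simp add: h_def hpair_def)
    thus "h (fst z) (snd z) \<le> g (fst z) (snd z) + g (snd z) (fst z)"
      unfolding z g_def by (cases "x \<in> D"; cases "y \<in> D") (auto simp: comm)
  qed
  also have "\<dots> = 2 * (\<integral>\<^sup>+x. \<integral>\<^sup>+y. g x y \<partial>lebesgue \<partial>lebesgue)"
    by (rule nn_integral_pair_symmetrize(1)[OF gm])
  also have "(\<integral>\<^sup>+x. \<integral>\<^sup>+y. g x y \<partial>lebesgue \<partial>lebesgue) \<le> (\<integral>\<^sup>+x. ennreal C * indicator D x \<partial>lebesgue)"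
  proof (rule nn_integral_mono)
    fix x
    show "(\<integral>\<^sup>+y. g x y \<partial>lebesgue) \<le> ennreal C * indicator D x"
      by (cases "x \<in> D") (simp_all add: g_def inner)
  qed
  also have "\<dots> = ennreal C * emeasure lebesgue D"
    using D by (simp add: nn_integral_cmult_indicator)
  finally have "(\<integral>\<^sup>+ z. h (fst z) (snd z) \<partial>(lebesgue \<Otimes>\<^sub>M lebesgue)) \<le> 2 * (ennreal C * emeasure lebesgue D)"
    by (simp add: mult_left_mono)
  also have "\<dots> < \<infinity>" using D(2) by (simp add: ennreal_mult_less_top less_top)
  finally show ?thesis unfolding h_def .
qed

text \<open>Taking positive parts does not increase differences, so the energy of the test function
  is controlled by the energies of \<psi> and v.\<close>

lemma testfn_in_Aspace:
  fixes \<psi> :: "'n::finite heis \<Rightarrow> real"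
  assumes pq: "1 < p" "p \<le> q" "0 < s" "s \<le> t" "t < 1"
    and a: "(\<lambda>z. a (fst z) (snd z)) \<in> borel_measurable (lebesgue \<Otimes>\<^sub>M lebesgue)"
      "\<And>x y. 0 \<le> a x y" "\<And>x y. a x y = a y x" "\<And>x y. a x y \<le> La"
    and \<psi>: "\<psi> \<in> borel_measurable lebesgue" "\<And>x. 0 \<le> \<psi> x" "\<And>x. \<psi> x \<le> l" "\<And>x. x \<notin> D \<Longrightarrow> \<psi> x = 0"
      "\<And>x y. \<bar>\<psi> x - \<psi> y\<bar> \<le> N * l / d * kern x y"
    and N: "1 \<le> N" "0 \<le> l" "0 < d"
    and D: "D \<in> sets lebesgue" "emeasure lebesgue D < \<infinity>"
    and \<Omega>: "open \<Omega>" "bounded \<Omega>" and v: "v \<in> Aspace p q s t a \<Omega>"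
  shows "testfn \<psi> v \<in> Aspace p q s t a \<Omega>"
  unfolding Aspace_iff_hpair
proof (intro conjI)
  have vm: "v \<in> borel_measurable lebesgue"
    and vf: "(\<integral>\<^sup>+ z. indicator (CC \<Omega>) z * ennreal (hpair p q s t a v (fst z) (snd z)) \<partial>(lebesgue \<Otimes>\<^sub>M lebesgue)) < \<infinity>"
    using v unfolding Aspace_iff_hpair by auto
  have \<Omega>m: "\<Omega> \<in> sets lebesgue" using \<Omega> by (simp add: borel_open)
  show "testfn \<psi> v \<in> borel_measurable lebesgue" by (rule testfn_measurable[OF vm \<psi>(1)])
  have "(\<integral>\<^sup>+ x. indicator \<Omega> x * ennreal (\<bar>testfn \<psi> v x\<bar> powr p) \<partial>lebesgue) \<le> (\<integral>\<^sup>+ x. ennreal (l powr p) * indicator \<Omega> x \<partial>lebesgue)"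
  proof (rule nn_integral_mono)
    fix x
    have "testfn \<psi> v x \<le> l" using \<psi>(3)[of x] N(2) unfolding testfn_def by linarith
    hence "\<bar>testfn \<psi> v x\<bar> powr p \<le> l powr p" using pq by (intro powr_mono2) auto
    thus "indicator \<Omega> x * ennreal (\<bar>testfn \<psi> v x\<bar> powr p) \<le> ennreal (l powr p) * indicator \<Omega> x"
      by (auto simp: indicator_def intro: ennreal_leI)
  qed
  also have "\<dots> = ennreal (l powr p) * emeasure lebesgue \<Omega>" using \<Omega>m by (simp add: nn_integral_cmult_indicator)
  also have "\<dots> < \<infinity>"
  proof -
    have "\<Omega> \<in> lmeasurable" using \<Omega> by (simp add: lmeasurable_open)
    hence "emeasure lebesgue \<Omega> < top" unfolding fmeasurable_def infinity_ennreal_def by blast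
    thus ?thesis by (simp only: ennreal_mult_less_top infinity_ennreal_def ennreal_less_top simp_thms)
  qed
  finally show "(\<integral>\<^sup>+ x. indicator \<Omega> x * ennreal (\<bar>testfn \<psi> v x\<bar> powr p) \<partial>lebesgue) < \<infinity>" .
  have le: "hpair p q s t a (testfn \<psi> v) x y \<le> 2 powr q * (hpair p q s t a \<psi> x y + hpair p q s t a v x y)" for x y
  proof -
    have m: "\<bar>testfn \<psi> v x - testfn \<psi> v y\<bar> powr m \<le> 2 powr q * (\<bar>\<psi> x - \<psi> y\<bar> powr m + \<bar>v x - v y\<bar> powr m)"
      if "1 < m" "m \<le> q" for m
    proof -
      have "\<bar>testfn \<psi> v x - testfn \<psi> v y\<bar> powr m \<le> (\<bar>\<psi> x - \<psi> y\<bar> + \<bar>v x - v y\<bar>) powr m"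
        using that testfn_diff_le[of \<psi> v x y] by (intro powr_mono2) auto
      also have "\<dots> \<le> 2 powr m * (\<bar>\<psi> x - \<psi> y\<bar> powr m + \<bar>v x - v y\<bar> powr m)"
        using that by (intro powr_add_le) auto
      also have "\<dots> \<le> 2 powr q * (\<bar>\<psi> x - \<psi> y\<bar> powr m + \<bar>v x - v y\<bar> powr m)"
        using that by (intro mult_right_mono) auto
      finally show ?thesis .
    qed
    have "hpair p q s t a (testfn \<psi> v) x y \<le> (2 powr q * (\<bar>\<psi> x - \<psi> y\<bar> powr p + \<bar>v x - v y\<bar> powr p)) * Wt (s * p) x y
       + a x y * ((2 powr q * (\<bar>\<psi> x - \<psi> y\<bar> powr q + \<bar>v x - v y\<bar> powr q)) * Wt (t * q) x y)"
      unfolding hpair_def using pq a(2) by (intro add_mono mult_left_mono mult_right_mono m) auto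
    also have "\<dots> = 2 powr q * (hpair p q s t a \<psi> x y + hpair p q s t a v x y)"
      unfolding hpair_def by algebra
    finally show ?thesis .
  qed
  have m1: "(\<lambda>z. ennreal (hpair p q s t a \<psi> (fst z) (snd z))) \<in> borel_measurable (lebesgue \<Otimes>\<^sub>M lebesgue)"
    using hpair_measurable[OF \<psi>(1) a(1)] by (rule measurable_compose) measurable
  have m2: "(\<lambda>z. indicator (CC \<Omega>) z * ennreal (hpair p q s t a v (fst z) (snd z))) \<in> borel_measurable (lebesgue \<Otimes>\<^sub>M lebesgue)"
    using CC_sets[OF \<Omega>m] measurable_compose[OF hpair_measurable[OF vm a(1)] measurable_ennreal] by measurable
  have "(\<integral>\<^sup>+ z. indicator (CC \<Omega>) z * ennreal (hpair p q s t a (testfn \<psi> v) (fst z) (snd z)) \<partial>(lebesgue \<Otimes>\<^sub>M lebesgue))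
    \<le> (\<integral>\<^sup>+ z. ennreal (2 powr q) * (ennreal (hpair p q s t a \<psi> (fst z) (snd z)) + indicator (CC \<Omega>) z * ennreal (hpair p q s t a v (fst z) (snd z))) \<partial>(lebesgue \<Otimes>\<^sub>M lebesgue))"
  proof (rule nn_integral_mono)
    fix z :: "'n heis \<times> 'n heis"
    have "ennreal (hpair p q s t a (testfn \<psi> v) (fst z) (snd z)) \<le> ennreal (2 powr q * (hpair p q s t a \<psi> (fst z) (snd z) + hpair p q s t a v (fst z) (snd z)))"
      by (rule ennreal_leI[OF le])
    also have "\<dots> = ennreal (2 powr q) * (ennreal (hpair p q s t a \<psi> (fst z) (snd z)) + ennreal (hpair p q s t a v (fst z) (snd z)))"
      by (simp add: ennreal_mult hpair_nonneg a(2) ennreal_plus)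
    finally show "indicator (CC \<Omega>) z * ennreal (hpair p q s t a (testfn \<psi> v) (fst z) (snd z))
      \<le> ennreal (2 powr q) * (ennreal (hpair p q s t a \<psi> (fst z) (snd z)) + indicator (CC \<Omega>) z * ennreal (hpair p q s t a v (fst z) (snd z)))"
      by (simp add: indicator_def)
  qed
  also have "\<dots> = ennreal (2 powr q) * ((\<integral>\<^sup>+ z. ennreal (hpair p q s t a \<psi> (fst z) (snd z)) \<partial>(lebesgue \<Otimes>\<^sub>M lebesgue))
       + (\<integral>\<^sup>+ z. indicator (CC \<Omega>) z * ennreal (hpair p q s t a v (fst z) (snd z)) \<partial>(lebesgue \<Otimes>\<^sub>M lebesgue)))"
    using m1 m2 by (simp add: nn_integral_cmult nn_integral_add)
  also have "\<dots> < \<infinity>"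
    using vf cutoff_pair_finite[OF pq a \<psi> N D] by (simp add: ennreal_mult_less_top)
  finally show "(\<integral>\<^sup>+ z. indicator (CC \<Omega>) z * ennreal (hpair p q s t a (testfn \<psi> v) (fst z) (snd z)) \<partial>(lebesgue \<Otimes>\<^sub>M lebesgue)) < \<infinity>" .
qed

definition flux_pair :: "real \<Rightarrow> real \<Rightarrow> real \<Rightarrow> real \<Rightarrow> ('n::finite heis \<Rightarrow> 'n heis \<Rightarrow> real)
    \<Rightarrow> ('n heis \<Rightarrow> real) \<Rightarrow> ('n heis \<Rightarrow> real) \<Rightarrow> 'n heis \<Rightarrow> 'n heis \<Rightarrow> real" where
  "flux_pair p q s t a u \<phi> x y = Jp p (u x - u y) * (\<phi> x - \<phi> y) * Wt (s * p) x y
     + a x y * (Jp q (u x - u y) * (\<phi> x - \<phi> y) * Wt (t * q) x y)"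

lemma weak_solution_iff:
  "weak_solution p q s t a \<Omega> u \<longleftrightarrow> u \<in> Aspace p q s t a (\<Omega> :: 'n::finite heis set) \<and>
     (\<forall>\<phi> \<in> Aspace p q s t a \<Omega>. (AE x in lebesgue. x \<notin> \<Omega> \<longrightarrow> \<phi> x = 0) \<longrightarrow>
        (\<integral>z. indicator (CC \<Omega>) z * flux_pair p q s t a u \<phi> (fst z) (snd z) \<partial>(lebesgue \<Otimes>\<^sub>M lebesgue)) = 0)"
  unfolding weak_solution_def set_lebesgue_integral_def flux_pair_def Wt_def by (simp add: mult_ac)

lemma flux_pair_measurable:
  fixes u :: "'n::finite heis \<Rightarrow> real"
  assumes u: "u \<in> borel_measurable lebesgue" and \<phi>: "\<phi> \<in> borel_measurable lebesgue"
    and [measurable]: "(\<lambda>z. a (fst z) (snd z)) \<in> borel_measurable (lebesgue \<Otimes>\<^sub>M lebesgue)"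
  shows "(\<lambda>z. flux_pair p q s t a u \<phi> (fst z) (snd z)) \<in> borel_measurable (lebesgue \<Otimes>\<^sub>M lebesgue)"
proof -
  note [measurable] = measurable_pair_fst_snd[OF u] measurable_pair_fst_snd[OF \<phi>]
  show ?thesis unfolding flux_pair_def Jp_def by measurable
qed

text \<open>The integral of a non-integrable function is 0 by convention, so the vanishing integral
  in the weak formulation is a genuine balance of positive and negative parts only once
  integrability is known. It follows from the energies of u and \<phi> by
  \<open>abs_Jp_mult_le\<close>.\<close>

lemma flux_pair_integrable:
  fixes \<Omega> :: "'n::finite heis set"
  assumes pq: "1 < p" "p \<le> q" and \<Omega>: "open \<Omega>"
    and a: "(\<lambda>z. a (fst z) (snd z)) \<in> borel_measurable (lebesgue \<Otimes>\<^sub>M lebesgue)" "\<And>x y. 0 \<le> a x y"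
    and u: "u \<in> Aspace p q s t a \<Omega>" and \<phi>: "\<phi> \<in> Aspace p q s t a \<Omega>"
  shows "integrable (lebesgue \<Otimes>\<^sub>M lebesgue) (\<lambda>z. indicator (CC \<Omega>) z * flux_pair p q s t a u \<phi> (fst z) (snd z))"
proof (rule integrableI_bounded)
  have \<Omega>m: "\<Omega> \<in> sets lebesgue" using \<Omega> by (simp add: borel_open)
  have um: "u \<in> borel_measurable lebesgue" "\<phi> \<in> borel_measurable lebesgue"
    using u \<phi> unfolding Aspace_iff_hpair by auto
  show "(\<lambda>z. indicator (CC \<Omega>) z * flux_pair p q s t a u \<phi> (fst z) (snd z)) \<in> borel_measurable (lebesgue \<Otimes>\<^sub>M lebesgue)"
    using CC_sets[OF \<Omega>m] flux_pair_measurable[OF um a(1)] by measurable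
  have le: "\<bar>flux_pair p q s t a u \<phi> x y\<bar> \<le> hpair p q s t a u x y + hpair p q s t a \<phi> x y" for x y
  proof -
    have "\<bar>flux_pair p q s t a u \<phi> x y\<bar> \<le> \<bar>Jp p (u x - u y) * (\<phi> x - \<phi> y)\<bar> * Wt (s * p) x y + a x y * (\<bar>Jp q (u x - u y) * (\<phi> x - \<phi> y)\<bar> * Wt (t * q) x y)"
      unfolding flux_pair_def using a(2)[of x y]
      by (intro order_trans[OF abs_triangle_ineq]) (simp add: abs_mult mult_ac)
    also have "\<dots> \<le> (\<bar>u x - u y\<bar> powr p + \<bar>\<phi> x - \<phi> y\<bar> powr p) * Wt (s * p) x y + a x y * ((\<bar>u x - u y\<bar> powr q + \<bar>\<phi> x - \<phi> y\<bar> powr q) * Wt (t * q) x y)"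
      using a(2)[of x y] pq by (intro add_mono mult_left_mono mult_right_mono abs_Jp_mult_le) auto
    also have "\<dots> = hpair p q s t a u x y + hpair p q s t a \<phi> x y"
      unfolding hpair_def by algebra
    finally show ?thesis .
  qed
  have m: "(\<lambda>z. indicator (CC \<Omega>) z * ennreal (hpair p q s t a w (fst z) (snd z))) \<in> borel_measurable (lebesgue \<Otimes>\<^sub>M lebesgue)"
    if "w \<in> borel_measurable lebesgue" for w
    using CC_sets[OF \<Omega>m] measurable_compose[OF hpair_measurable[OF that a(1)] measurable_ennreal] by measurable
  have "(\<integral>\<^sup>+ z. ennreal (norm (indicator (CC \<Omega>) z * flux_pair p q s t a u \<phi> (fst z) (snd z))) \<partial>(lebesgue \<Otimes>\<^sub>M lebesgue))
    \<le> (\<integral>\<^sup>+ z. indicator (CC \<Omega>) z * ennreal (hpair p q s t a u (fst z) (snd z)) + indicator (CC \<Omega>) z * ennreal (hpair p q s t a \<phi> (fst z) (snd z)) \<partial>(lebesgue \<Otimes>\<^sub>M lebesgue))"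
  proof (rule nn_integral_mono)
    fix z :: "'n heis \<times> 'n heis"
    have "ennreal \<bar>flux_pair p q s t a u \<phi> (fst z) (snd z)\<bar> \<le> ennreal (hpair p q s t a u (fst z) (snd z)) + ennreal (hpair p q s t a \<phi> (fst z) (snd z))"
      using ennreal_leI[OF le[of "fst z" "snd z"]] by (simp add: hpair_nonneg a(2) ennreal_plus)
    thus "ennreal (norm (indicator (CC \<Omega>) z * flux_pair p q s t a u \<phi> (fst z) (snd z)))
      \<le> indicator (CC \<Omega>) z * ennreal (hpair p q s t a u (fst z) (snd z)) + indicator (CC \<Omega>) z * ennreal (hpair p q s t a \<phi> (fst z) (snd z))"
      by (simp add: indicator_def)
  qed
  also have "\<dots> < \<infinity>"
    using u \<phi> unfolding nn_integral_add[OF m[OF um(1)] m[OF um(2)]] Aspace_iff_hpair by (simp add: less_top)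
  finally show "(\<integral>\<^sup>+ z. ennreal (norm (indicator (CC \<Omega>) z * flux_pair p q s t a u \<phi> (fst z) (snd z))) \<partial>(lebesgue \<Otimes>\<^sub>M lebesgue)) < \<infinity>" .
qed

text \<open>The pointwise bound of the flux is integrated for both phases with the common test
  function. It charges each pair once to x and once to y, so both sides are twice an iterated
  integral and the factor 2 cancels.\<close>

lemma energy_inequality:
  fixes \<psi> :: "'n::finite heis \<Rightarrow> real"
  assumes pq: "1 < p" "p \<le> q" "0 < s" "s \<le> t" "t < 1"
    and a: "(\<lambda>z. a (fst z) (snd z)) \<in> borel_measurable (lebesgue \<Otimes>\<^sub>M lebesgue)"
      "\<And>x y. 0 \<le> a x y" "\<And>x y. a x y = a y x" "\<And>x y. a x y \<le> La"
    and \<psi>: "\<psi> \<in> borel_measurable lebesgue" "\<And>x. 0 \<le> \<psi> x" "\<And>x. \<psi> x \<le> l" "\<And>x. x \<notin> D \<Longrightarrow> \<psi> x = 0"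
      "\<And>x y. \<bar>\<psi> x - \<psi> y\<bar> \<le> N * l / d * kern x y"
    and N: "1 \<le> N" "0 \<le> l" "0 < d"
    and D: "D \<in> sets lebesgue" "emeasure lebesgue D < \<infinity>"
    and \<Omega>: "open \<Omega>" "bounded \<Omega>" and v: "weak_solution p q s t a \<Omega> v"
    and B: "B \<in> sets lebesgue" "D \<subseteq> B" "B \<subseteq> \<Omega>" "AE x in lebesgue. x \<in> B \<longrightarrow> v x \<ge> 0"
    and k: "0 < k" "2 * l \<le> k"
  shows "(\<integral>\<^sup>+x. \<integral>\<^sup>+y. ennreal (pair_neg p q s t a k B \<psi> v x y) \<partial>lebesgue \<partial>lebesgue)
    \<le> (\<integral>\<^sup>+x. \<integral>\<^sup>+y. ennreal (pair_pos p q s t a k B \<psi> v x y) \<partial>lebesgue \<partial>lebesgue)"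
proof -
  define \<phi> where "\<phi> = testfn \<psi> v"
  have vA: "v \<in> Aspace p q s t a \<Omega>" using v by (simp add: weak_solution_iff)
  have vm: "v \<in> borel_measurable lebesgue" using vA unfolding Aspace_iff_hpair by auto
  have \<phi>A: "\<phi> \<in> Aspace p q s t a \<Omega>"
    unfolding \<phi>_def by (rule testfn_in_Aspace[OF pq a \<psi> N D \<Omega> vA])
  have \<phi>0: "\<phi> x = 0" if "x \<notin> D" for x
    using \<psi>(4)[OF that] by (simp add: \<phi>_def testfn_def)
  have \<phi>B: "x \<in> B" if "testfn \<psi> v x > 0" for x
    using \<phi>0[of x] that B(2) by (auto simp: \<phi>_def)
  let ?M = "lebesgue \<Otimes>\<^sub>M (lebesgue :: 'n heis measure)"
  define F where "F z = indicator (CC \<Omega>) z * flux_pair p q s t a v \<phi> (fst z) (snd z)" for z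
  have "(AE x in lebesgue. x \<notin> \<Omega> \<longrightarrow> \<phi> x = 0)"
  proof (intro AE_I2 impI)
    fix x assume "x \<notin> \<Omega>"
    thus "\<phi> x = 0" using \<phi>0 B(2,3) by blast
  qed
  hence F0: "integral\<^sup>L ?M F = 0"
    using v \<phi>A unfolding weak_solution_iff F_def by blast
  have Fi: "integrable ?M F"
    unfolding F_def by (rule flux_pair_integrable[OF pq(1,2) \<Omega>(1) a(1,2) vA \<phi>A])
  define Pn where "Pn x y = pair_neg p q s t a k B \<psi> v x y" for x y
  define Pp where "Pp x y = pair_pos p q s t a k B \<psi> v x y" for x y
  note mm = pair_pos_neg_measurable[OF vm \<psi>(1) a(1) B(1), of p q s t k]
  have nn: "0 \<le> Pn x y" "0 \<le> Pp x y" for x y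
    unfolding Pn_def Pp_def pair_neg_def pair_pos_def using a(2)[of x y]
    by (simp_all add: Gneg_nonneg Gpos_nonneg)
  have Pm: "(\<lambda>z. Pn (fst z) (snd z)) \<in> borel_measurable ?M" "(\<lambda>z. Pp (fst z) (snd z)) \<in> borel_measurable ?M"
    unfolding Pn_def Pp_def by (fact mm)+
  have sw: "(\<lambda>z. (snd z, fst z)) \<in> ?M \<rightarrow>\<^sub>M ?M" by measurable
  have Pm': "(\<lambda>z. Pn (snd z) (fst z)) \<in> borel_measurable ?M" "(\<lambda>z. Pp (snd z) (fst z)) \<in> borel_measurable ?M"
    using measurable_compose[OF sw Pm(1)] measurable_compose[OF sw Pm(2)] by simp_all
  have "(\<integral>\<^sup>+z. ennreal (Pn (fst z) (snd z) + Pn (snd z) (fst z)) \<partial>?M) \<le> (\<integral>\<^sup>+z. ennreal (Pp (fst z) (snd z) + Pp (snd z) (fst z)) \<partial>?M)"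
  proof (rule nn_integral_le_of_integral_zero[OF Fi F0])
    show "AE z in ?M. F z + (Pn (fst z) (snd z) + Pn (snd z) (fst z)) \<le> Pp (fst z) (snd z) + Pp (snd z) (fst z)"
      using AE_lebesgue_pair[OF B(4)]
    proof eventually_elim
      case (elim z)
      obtain x y where z: "z = (x, y)" by (cases z)
      have xy: "x \<in> B \<Longrightarrow> v x \<ge> 0" "y \<in> B \<Longrightarrow> v y \<ge> 0" using elim by (auto simp: z)
      have fb: "Jp m (v x - v y) * (\<phi> x - \<phi> y)
          \<le> Gpos m k B \<psi> v x y - Gneg m k B \<psi> v x y + Gpos m k B \<psi> v y x - Gneg m k B \<psi> v y x" if "m > 1" for m
        unfolding \<phi>_def by (rule flux_bound[OF that \<psi>(2) \<psi>(2) \<psi>(3) \<psi>(3) k xy \<phi>B \<phi>B])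
      have Feq: "F z = flux_pair p q s t a v \<phi> x y"
      proof (cases "z \<in> CC \<Omega>")
        case False
        hence "x \<notin> D" "y \<notin> D" using B by (auto simp: z CC_def)
        thus ?thesis using \<phi>0 by (simp add: F_def z flux_pair_def)
      qed (simp add: F_def z)
      have "flux_pair p q s t a v \<phi> x y \<le>
          (Gpos p k B \<psi> v x y - Gneg p k B \<psi> v x y + Gpos p k B \<psi> v y x - Gneg p k B \<psi> v y x) * Wt (s * p) x y
          + a x y * ((Gpos q k B \<psi> v x y - Gneg q k B \<psi> v x y + Gpos q k B \<psi> v y x - Gneg q k B \<psi> v y x) * Wt (t * q) x y)"
        unfolding flux_pair_def using pq a(2)[of x y]
        by (intro add_mono mult_left_mono mult_right_mono fb) auto
      also have "\<dots> = Pp x y + Pp y x - Pn x y - Pn y x"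
        unfolding Pp_def Pn_def pair_pos_def pair_neg_def Wt_commute[of _ y x] a(3)[of y x] by algebra
      finally show ?case using Feq unfolding z fst_conv snd_conv by linarith
    qed
  qed (use Pm Pm' nn in \<open>auto intro!: borel_measurable_add add_nonneg_nonneg\<close>)
  hence "(\<integral>\<^sup>+z. ennreal (Pn (fst z) (snd z)) + ennreal (Pn (snd z) (fst z)) \<partial>?M) \<le> (\<integral>\<^sup>+z. ennreal (Pp (fst z) (snd z)) + ennreal (Pp (snd z) (fst z)) \<partial>?M)"
    by (simp add: ennreal_plus nn)
  hence "2 * (\<integral>\<^sup>+x. \<integral>\<^sup>+y. ennreal (Pn x y) \<partial>lebesgue \<partial>lebesgue) \<le> 2 * (\<integral>\<^sup>+x. \<integral>\<^sup>+y. ennreal (Pp x y) \<partial>lebesgue \<partial>lebesgue)"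
    using nn_integral_pair_symmetrize(1)[of "\<lambda>x y. ennreal (Pn x y)"] nn_integral_pair_symmetrize(1)[of "\<lambda>x y. ennreal (Pp x y)"]
      measurable_compose[OF Pm(1) measurable_ennreal] measurable_compose[OF Pm(2) measurable_ennreal] by simp
  thus ?thesis unfolding Pn_def Pp_def
    by (subst (asm) ennreal_mult_le_mult_iff) auto
qed

section \<open>The growth lemma\<close>

locale double_phase =
  fixes p q s t \<alpha> La Ha :: real and a :: "'n::finite heis \<Rightarrow> 'n heis \<Rightarrow> real"
  assumes pq: "1 < p" "p \<le> q" "0 < s" "s \<le> t" "t < 1" and \<alpha>: "0 < \<alpha>" "\<alpha> \<le> 1" "t * q \<le> s * p + \<alpha>"
    and a: "(\<lambda>z. a (fst z) (snd z)) \<in> borel_measurable (lebesgue \<Otimes>\<^sub>M lebesgue)"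
      "\<And>x y. 0 \<le> a x y" "\<And>x y. a x y = a y x" "\<And>x y. a x y \<le> La"
    and holder: "holder_cond \<alpha> Ha a"
begin

lemma La_nonneg: "La \<ge> 0"
  using a(2)[of 0 0] a(4)[of 0 0] by linarith

lemma Ha_nonneg: "Ha \<ge> 0"
proof (rule ccontr)
  assume "\<not> Ha \<ge> 0"
  define x where "x = ((0, 0, 1) :: 'n heis)"
  have "kern x 0 > 0" using kern_eq_0_iff[of x 0] kern_nonneg[of x 0] by (auto simp: x_def zero_prod_def less_le)
  hence "(kern x 0 + kern x 0) powr \<alpha> > 0" by simp
  moreover have "0 \<le> Ha * (kern x 0 + kern x 0) powr \<alpha>"
    using holder abs_ge_zero order_trans unfolding holder_cond_def by blast
  ultimately show False using \<open>\<not> Ha \<ge> 0\<close> by (simp add: zero_le_mult_iff)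
qed

lemma exponents: "0 < s * p" "s * p < p" "0 < t * q" "t * q < q" "s * p \<le> t * q"
  using pq by (auto intro: mult_mono)

end

text \<open>Tails are measured against k^(m-1) \<rho>^(-e), the natural size of the flux of height k
  at scale \<rho>. They contain k because v is below k where the test function is positive, so v x -
  v y \<le> k + max 0 (- v y). The first tail also carries the power q - 1: by
  \<open>a_Wt_far\<close> the excess of the coefficient over \<open>am\<close> moves part of the
  q-phase to the kernel of the p-phase.\<close>

locale growth = double_phase p q s t \<alpha> La Ha a
  for p q s t \<alpha> La Ha :: real and a :: "'n::finite heis \<Rightarrow> 'n heis \<Rightarrow> real" +
  fixes \<Omega> :: "'n heis set" and v :: "'n heis \<Rightarrow> real" and \<xi>0 :: "'n heis" and R \<rho> k \<epsilon> :: real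
  assumes \<Omega>: "open \<Omega>" "bounded \<Omega>" and v: "weak_solution p q s t a \<Omega> v"
    and B: "kball \<xi>0 R \<subseteq> \<Omega>" and R: "R \<le> 1" and \<rho>: "0 < \<rho>" "4 * \<rho> \<le> R" and k: "0 < k"
    and v_nonneg: "AE x in lebesgue. x \<in> kball \<xi>0 R \<longrightarrow> v x \<ge> 0"
    and v_large: "emeasure lebesgue (kball \<xi>0 \<rho>) \<le> 2 * emeasure lebesgue {y \<in> kball \<xi>0 \<rho>. k \<le> v y}"
    and \<epsilon>: "0 \<le> \<epsilon>"
    and tail1: "(\<integral>\<^sup>+y. indicator (- kball \<xi>0 R) y * ennreal (((k + max 0 (- v y)) powr (p - 1)
        + (k + max 0 (- v y)) powr (q - 1)) * Wt (s * p) \<xi>0 y) \<partial>lebesgue) \<le> ennreal (\<epsilon> * (k powr (p - 1) * \<rho> powr - (s * p)))"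
    and tail2: "(\<integral>\<^sup>+y. indicator (- kball \<xi>0 R) y * ennreal ((k + max 0 (- v y)) powr (q - 1) * Wt (t * q) \<xi>0 y) \<partial>lebesgue)
        \<le> ennreal (\<epsilon> * (k powr (q - 1) * \<rho> powr - (t * q)))"
begin

text \<open>A lower bound of the coefficient on all pairs of the ball, cut off at 0. Good terms are
  estimated with \<open>am\<close> and bad terms with \<open>am\<close> plus an excess of order
  R^\<alpha>, so both sides involve the same frozen energy.\<close>

definition am :: real where "am = max 0 (a \<xi>0 \<xi>0 - Ha * (2 * R) powr \<alpha>)"

lemma am_nonneg [simp]: "am \<ge> 0" by (simp add: am_def)

lemma R_pos: "0 < R" using \<rho> by linarith

lemma a_diff_le: "\<bar>a x y - a \<xi>0 \<xi>0\<bar> \<le> Ha * (kern x \<xi>0 + kern y \<xi>0) powr \<alpha>"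
  using holder unfolding holder_cond_def by blast

lemma powr_alpha_2: "c \<ge> 0 \<Longrightarrow> (2 * c) powr \<alpha> \<le> 2 * c powr \<alpha>"
proof -
  assume "c \<ge> 0"
  have "2 powr \<alpha> \<le> 2 powr (1::real)" using \<alpha> by (intro powr_mono) auto
  thus ?thesis using \<open>c \<ge> 0\<close> by (simp add: powr_mult mult_right_mono)
qed

lemma a_near:
  assumes "x \<in> kball \<xi>0 R" "y \<in> kball \<xi>0 R"
  shows "am \<le> a x y" "a x y \<le> am + 4 * Ha * R powr \<alpha>"
proof -
  have "(kern x \<xi>0 + kern y \<xi>0) powr \<alpha> \<le> (2 * R) powr \<alpha>"
    using assms \<alpha> by (intro powr_mono2) (auto simp: kball_def)
  hence "Ha * (kern x \<xi>0 + kern y \<xi>0) powr \<alpha> \<le> Ha * (2 * R) powr \<alpha>"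
    using Ha_nonneg by (rule mult_left_mono)
  hence *: "\<bar>a x y - a \<xi>0 \<xi>0\<bar> \<le> Ha * (2 * R) powr \<alpha>" using a_diff_le[of x y] by linarith
  thus "am \<le> a x y" using a(2)[of x y] unfolding am_def by linarith
  have "Ha * (2 * R) powr \<alpha> \<le> Ha * (2 * R powr \<alpha>)"
    using Ha_nonneg powr_alpha_2[of R] R_pos by (intro mult_left_mono) auto
  thus "a x y \<le> am + 4 * Ha * R powr \<alpha>" using * unfolding am_def by linarith
qed

lemma a_far:
  assumes "x \<in> kball \<xi>0 R" "y \<notin> kball \<xi>0 R"
  shows "a x y \<le> am + 4 * Ha * kern y \<xi>0 powr \<alpha>"
proof -
  define d where "d = kern y \<xi>0"
  have d: "R \<le> d" "0 \<le> d" using assms by (auto simp: kball_def d_def)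
  have 1: "(2 * R) powr \<alpha> \<le> (2 * d) powr \<alpha>" using d R_pos \<alpha> by (intro powr_mono2) auto
  have 2: "(kern x \<xi>0 + kern y \<xi>0) powr \<alpha> \<le> (2 * d) powr \<alpha>"
    using assms \<alpha> d by (intro powr_mono2) (auto simp: kball_def d_def)
  have "Ha * (kern x \<xi>0 + kern y \<xi>0) powr \<alpha> \<le> Ha * (2 * d powr \<alpha>)" "Ha * (2 * R) powr \<alpha> \<le> Ha * (2 * d powr \<alpha>)"
    using 1 2 powr_alpha_2[OF d(2)] Ha_nonneg by (auto intro!: mult_left_mono)
  thus ?thesis using a_diff_le[of x y] unfolding am_def d_def[symmetric] by linarith
qed

definition G :: "real \<Rightarrow> real" where
  "G \<tau> = \<tau> powr p * \<rho> powr - (s * p) + am * (\<tau> powr q * \<rho> powr - (t * q))"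

lemma G_nonneg [simp]: "G \<tau> \<ge> 0" by (simp add: G_def)

lemma G_mono: "0 \<le> \<tau> \<Longrightarrow> \<tau> \<le> \<tau>' \<Longrightarrow> G \<tau> \<le> G \<tau>'"
  unfolding G_def using pq by (intro add_mono mult_right_mono mult_left_mono powr_mono2) auto

lemma G_pos: "\<tau> > 0 \<Longrightarrow> G \<tau> > 0"
  unfolding G_def using \<rho> by (intro add_pos_nonneg) auto

lemma G_scale_up:
  assumes "0 < \<eta>" "\<eta> \<le> l" shows "G l \<le> (l / \<eta>) powr q * G \<eta>"
proof -
  have 1: "l powr m \<le> (l / \<eta>) powr q * \<eta> powr m" if "m \<le> q" for m
  proof -
    have "(l / \<eta>) powr m \<le> (l / \<eta>) powr q" using that assms by (intro powr_mono) auto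
    hence "(l / \<eta>) powr m * \<eta> powr m \<le> (l / \<eta>) powr q * \<eta> powr m" by (rule mult_right_mono) simp
    thus ?thesis using assms by (simp add: powr_divide)
  qed
  have "G l \<le> ((l / \<eta>) powr q * \<eta> powr p) * \<rho> powr - (s * p) + am * (((l / \<eta>) powr q * \<eta> powr q) * \<rho> powr - (t * q))"
    unfolding G_def using pq by (intro add_mono mult_right_mono mult_left_mono 1) auto
  also have "\<dots> = (l / \<eta>) powr q * G \<eta>" unfolding G_def by algebra
  finally show ?thesis .
qed

lemma G_scale_down:
  assumes "0 < l" "l \<le> k" shows "G l \<le> (l / k) powr p * G k"
proof -
  have 1: "l powr m \<le> (l / k) powr p * k powr m" if "p \<le> m" for m
  proof -
    have "(l / k) powr m \<le> (l / k) powr p" using that assms k by (intro powr_mono') auto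
    hence "(l / k) powr m * k powr m \<le> (l / k) powr p * k powr m" by (rule mult_right_mono) simp
    thus ?thesis using assms k by (simp add: powr_divide)
  qed
  have "G l \<le> ((l / k) powr p * k powr p) * \<rho> powr - (s * p) + am * (((l / k) powr p * k powr q) * \<rho> powr - (t * q))"
    unfolding G_def using pq by (intro add_mono mult_right_mono mult_left_mono 1) auto
  also have "\<dots> = (l / k) powr p * G k" unfolding G_def by algebra
  finally show ?thesis .
qed

text \<open>The condition t q \<le> s p + \<alpha> is used here and in the lemma a_Wt_far: the oscillation of
  the coefficient turns the q-phase at scale \<rho> \<le> 1 into the p-phase.\<close>

lemma rho_alpha: "\<rho> powr (\<alpha> - t * q) \<le> \<rho> powr - (s * p)"
proof -
  have "\<rho> powr (\<alpha> - t * q) \<le> \<rho> powr (- (s * p))"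
    using \<rho> R \<alpha>(3) by (intro powr_mono') auto
  thus ?thesis by simp
qed

lemma R_alpha: "R powr \<alpha> * \<rho> powr - (t * q) \<le> (R / \<rho>) powr \<alpha> * \<rho> powr - (s * p)"
proof -
  have "R powr \<alpha> * \<rho> powr - (t * q) = (R / \<rho>) powr \<alpha> * \<rho> powr (\<alpha> - t * q)"
    using \<rho> R_pos by (simp add: powr_divide powr_diff powr_minus_divide)
  also have "\<dots> \<le> (R / \<rho>) powr \<alpha> * \<rho> powr - (s * p)" by (intro mult_left_mono rho_alpha) auto
  finally show ?thesis .
qed

lemma v_Aspace: "v \<in> Aspace p q s t a \<Omega>" using v by (simp add: weak_solution_iff)

lemma v_measurable [measurable]: "v \<in> borel_measurable lebesgue"
  using v_Aspace unfolding Aspace_iff_hpair by auto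

lemma D_subset_B: "kball \<xi>0 \<rho> \<subseteq> kball \<xi>0 R"
  using \<rho> by (auto simp: kball_def)

text \<open>Since 4 \<rho> \<le> R, a point of the small ball and the center see every far point at
  comparable distances, so it suffices to control the tails at the center.\<close>

lemma Wt_far:
  assumes x: "x \<in> kball \<xi>0 \<rho>" and y: "y \<notin> kball \<xi>0 R" and e: "0 \<le> e" "e \<le> t * q"
  shows "Wt e x y \<le> 2 powr (hdim TYPE('n) + t * q) * Wt e \<xi>0 y"
proof -
  let ?Q = "hdim TYPE('n)"
  have d: "R \<le> kern \<xi>0 y" "kern x \<xi>0 < \<rho>" using x y by (auto simp: kball_def kern_commute)
  have "kern \<xi>0 y \<le> kern \<xi>0 x + kern x y" by (rule kern_triangle)
  hence xy: "kern \<xi>0 y / 2 \<le> kern x y" using d \<rho> kern_commute[of x \<xi>0] by linarith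
  have pos: "kern \<xi>0 y > 0" using d R_pos by linarith
  have "Wt e x y \<le> 1 / (kern \<xi>0 y / 2) powr (?Q + e)"
    unfolding Wt_def using xy pos e hdim_pos[where 'n='n]
    by (intro divide_left_mono powr_mono2 mult_pos_pos) (auto simp: powr_gt_zero)
  also have "\<dots> = 2 powr (?Q + e) * Wt e \<xi>0 y"
    unfolding Wt_def using pos by (simp add: powr_divide)
  also have "\<dots> \<le> 2 powr (?Q + t * q) * Wt e \<xi>0 y"
    using e by (intro mult_right_mono powr_mono) auto
  finally show ?thesis .
qed

lemma a_Wt_far:
  assumes x: "x \<in> kball \<xi>0 R" and y: "y \<notin> kball \<xi>0 R"
  shows "a x y * Wt (t * q) \<xi>0 y \<le> am * Wt (t * q) \<xi>0 y + max (4 * Ha) La * Wt (s * p) \<xi>0 y"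
proof -
  let ?Q = "hdim TYPE('n)"
  define d where "d = kern \<xi>0 y"
  have d: "0 < d" using y R_pos by (auto simp: kball_def d_def kern_commute[of \<xi>0 y])
  have Wd: "Wt e \<xi>0 y = d powr - (?Q + e)" for e by (simp only: Wt_def d_def powr_minus_divide)
  show ?thesis
  \<comment> \<open>Beyond distance 1 the Hoelder excess grows, but there the kernel of the q-phase
    decays at least as fast as that of the p-phase, and the bound \<open>La\<close> takes
    over.\<close>
  proof (cases "d \<le> 1")
    case True
    have "a x y * Wt (t * q) \<xi>0 y \<le> (am + 4 * Ha * d powr \<alpha>) * Wt (t * q) \<xi>0 y"
      using a_far[OF x y] by (intro mult_right_mono) (auto simp: d_def kern_commute)
    also have "\<dots> = am * Wt (t * q) \<xi>0 y + 4 * Ha * (d powr \<alpha> * d powr - (?Q + t * q))"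
      by (simp add: Wd algebra_simps)
    also have "d powr \<alpha> * d powr - (?Q + t * q) = d powr (\<alpha> - (?Q + t * q))"
      by (subst powr_add[symmetric]) (simp add: algebra_simps)
    also have "d powr (\<alpha> - (?Q + t * q)) \<le> d powr - (?Q + s * p)"
      using True d \<alpha>(3) by (intro powr_mono') auto
    finally have "a x y * Wt (t * q) \<xi>0 y \<le> am * Wt (t * q) \<xi>0 y + 4 * Ha * Wt (s * p) \<xi>0 y"
      using Ha_nonneg by (simp add: Wd mult_left_mono)
    also have "\<dots> \<le> am * Wt (t * q) \<xi>0 y + max (4 * Ha) La * Wt (s * p) \<xi>0 y"
      by (intro add_left_mono mult_right_mono) auto
    finally show ?thesis .
  next
    case False
    have "a x y * Wt (t * q) \<xi>0 y \<le> La * d powr - (?Q + s * p)"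
      unfolding Wd using a(4) La_nonneg False exponents by (intro mult_mono powr_mono) auto
    also have "\<dots> \<le> max (4 * Ha) La * Wt (s * p) \<xi>0 y" unfolding Wd by (intro mult_right_mono) auto
    finally show ?thesis by (simp add: add_increasing)
  qed
qed

end

text \<open>The worst powers of 2 from both kinds of good term: 2^(-(m+1)) from \<open>Gneg\<close>,
  2^(-(Q+e)) from the kernel at twice a radius, and 2^(-Q) from the volume at half the radius, with
  m \<le> q and e \<le> t q.\<close>

definition energy_const :: "'n::finite itself \<Rightarrow> real \<Rightarrow> real \<Rightarrow> real" where
  "energy_const _ q t = kvol TYPE('n) * 2 powr - (q + 1 + 2 * hdim TYPE('n) + t * q)"

lemma energy_const_pos: "energy_const TYPE('n::finite) q t > 0"
  by (simp add: energy_const_def kvol_pos)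

text \<open>Chosen so that the tails, after the factor 2^(Q+tq) for moving them to the center and
  the factor for the coefficient, use up at most half of the good term \<open>energy_const\<close>
  times \<phi> G(k) / k.\<close>

definition tail_threshold :: "'n::finite itself \<Rightarrow> real \<Rightarrow> real \<Rightarrow> real \<Rightarrow> real \<Rightarrow> real" where
  "tail_threshold _ q t La Ha = energy_const TYPE('n) q t / (2 * (2 powr (hdim TYPE('n) + t * q) * (1 + max (4 * Ha) La)))"

definition cutoff_const :: "'n::finite itself \<Rightarrow> real \<Rightarrow> real \<Rightarrow> real \<Rightarrow> real \<Rightarrow> real \<Rightarrow> real" where
  "cutoff_const _ p q s t X = 2 * (kint TYPE('n) (p - s * p) + kint TYPE('n) (s * p))
     + 2 * (kint TYPE('n) (q - t * q) + kint TYPE('n) (t * q)) * (1 + X)"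

section \<open>Estimates at a single level\<close>

locale growth_level = growth p q s t \<alpha> La Ha a \<Omega> v \<xi>0 R \<rho> k \<epsilon>
  for p q s t \<alpha> La Ha :: real and a :: "'n::finite heis \<Rightarrow> 'n heis \<Rightarrow> real"
    and \<Omega> :: "'n heis set" and v :: "'n heis \<Rightarrow> real" and \<xi>0 :: "'n heis" and R \<rho> k \<epsilon> :: real +
  fixes \<psi> :: "'n heis \<Rightarrow> real" and l N \<Lambda> :: real
  assumes \<psi>: "\<psi> \<in> borel_measurable lebesgue" "\<And>x. 0 \<le> \<psi> x" "\<And>x. \<psi> x \<le> l" "\<And>x. x \<notin> kball \<xi>0 \<rho> \<Longrightarrow> \<psi> x = 0"
      "\<And>x y. \<bar>\<psi> x - \<psi> y\<bar> \<le> N * l / \<rho> * kern x y"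
    and N: "1 \<le> N" and l: "0 < l" "2 * l \<le> k" "l \<le> \<Lambda>"
    and \<epsilon>_le: "\<epsilon> \<le> tail_threshold TYPE('n) q t La Ha"
begin

abbreviation "B \<equiv> kball \<xi>0 R"
abbreviation "D \<equiv> kball \<xi>0 \<rho>"
definition \<phi> :: "'n heis \<Rightarrow> real" where "\<phi> = testfn \<psi> v"
definition S :: "'n heis set" where "S = {x. \<phi> x > 0}"
text \<open>The price of moving the excess of the coefficient from the q-phase to the p-phase:
  \<open>R_alpha\<close> accounts for the radii, and l^q \<le> \<Lambda>^(q-p) l^p for the heights.
  The radii enter only through their ratio.\<close>

definition X :: real where "X = 4 * Ha * ((R / \<rho>) powr \<alpha> * \<Lambda> powr (q - p))"

lemma X_nonneg: "X \<ge> 0" using Ha_nonneg by (simp add: X_def)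

lemma \<phi>_nonneg [simp]: "\<phi> x \<ge> 0" by (simp add: \<phi>_def)

lemma \<phi>_le: "\<phi> x \<le> l" using \<psi>(3)[of x] l unfolding \<phi>_def testfn_def by linarith

lemma S_subset_D: "S \<subseteq> D"
proof
  fix x assume "x \<in> S"
  thus "x \<in> D" using \<psi>(4)[of x] by (cases "x \<in> D") (auto simp: S_def \<phi>_def testfn_def)
qed

lemma \<phi>_measurable [measurable]: "\<phi> \<in> borel_measurable lebesgue"
  unfolding \<phi>_def by (rule testfn_measurable) (auto simp: \<psi>)

lemma \<psi>_measurable [measurable]: "\<psi> \<in> borel_measurable lebesgue"
  by (rule \<psi>)

lemma S_sets [measurable]: "S \<in> sets lebesgue"
proof -
  have "S = {x \<in> space lebesgue. \<phi> x > 0}" by (simp add: S_def)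
  also have "\<dots> \<in> sets lebesgue" by measurable
  finally show ?thesis .
qed

text \<open>Pairs inside the ball give the cost of the cutoff, pairs outside the tails. The tail
  part is kept proportional to \<phi> x instead of being bounded through l, so that half of the good
  term at the same x can absorb it.\<close>

lemma pair_pos_upper_bound:
  assumes x: "x \<in> S"
  shows "(\<integral>\<^sup>+y. ennreal (pair_pos p q s t a k B \<psi> v x y) \<partial>lebesgue)
    \<le> ennreal (cutoff_const TYPE('n) p q s t X * N powr q * G l + energy_const TYPE('n) q t / 2 * (\<phi> x * (G k / k)))"
proof -
  let ?Q = "hdim TYPE('n)"
  have xD: "x \<in> D" using x S_subset_D by auto
  hence xB: "x \<in> B" using D_subset_B by auto
  have \<phi>x: "testfn \<psi> v x > 0" "testfn \<psi> v x = \<phi> x" using x by (auto simp: S_def \<phi>_def)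
  define A where "A = am + 4 * Ha * R powr \<alpha>"
  define Ct where "Ct = max (4 * Ha) La"
  have A: "A \<ge> 0" using Ha_nonneg by (simp add: A_def)
  have Ct: "Ct \<ge> 0" using La_nonneg by (simp add: Ct_def)
  define w where "w y = k + max 0 (- v y)" for y
  define E1 where "E1 y = \<bar>\<psi> x - \<psi> y\<bar> powr p * Wt (s * p) x y" for y
  define E2 where "E2 y = \<bar>\<psi> x - \<psi> y\<bar> powr q * Wt (t * q) x y" for y
  define T1 where "T1 y = indicator (- B) y * ennreal ((w y powr (p - 1) + w y powr (q - 1)) * Wt (s * p) \<xi>0 y)" for y
  define T2 where "T2 y = indicator (- B) y * ennreal (w y powr (q - 1) * Wt (t * q) \<xi>0 y)" for y
  have [measurable]: "E1 \<in> borel_measurable lebesgue" "E2 \<in> borel_measurable lebesgue"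
    unfolding E1_def E2_def by measurable
  have [measurable]: "w \<in> borel_measurable lebesgue" unfolding w_def by measurable
  have [measurable]: "T1 \<in> borel_measurable lebesgue" "T2 \<in> borel_measurable lebesgue"
    unfolding T1_def T2_def by measurable
  define Z where "Z = \<phi> x * 2 powr (?Q + t * q)"
  have kk: "0 \<le> kint TYPE('n) (p - s * p) + kint TYPE('n) (s * p)" "0 \<le> kint TYPE('n) (q - t * q) + kint TYPE('n) (t * q)"
    using kint_pos[where 'n='n, of "p - s * p"] kint_pos[where 'n='n, of "s * p"]
      kint_pos[where 'n='n, of "q - t * q"] kint_pos[where 'n='n, of "t * q"] exponents by linarith+
  have Z: "Z \<ge> 0" by (simp add: Z_def)
  have "(\<integral>\<^sup>+y. ennreal (pair_pos p q s t a k B \<psi> v x y) \<partial>lebesgue)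
    \<le> (\<integral>\<^sup>+y. (ennreal 2 * ennreal (E1 y) + ennreal (2 * A) * ennreal (E2 y)) + (ennreal (Z * (1 + Ct)) * T1 y + ennreal (Z * am) * T2 y) \<partial>lebesgue)"
  proof (rule nn_integral_mono)
    fix y
    show "ennreal (pair_pos p q s t a k B \<psi> v x y)
      \<le> (ennreal 2 * ennreal (E1 y) + ennreal (2 * A) * ennreal (E2 y)) + (ennreal (Z * (1 + Ct)) * T1 y + ennreal (Z * am) * T2 y)"
    proof (cases "y \<in> B")
      case True
      have "pair_pos p q s t a k B \<psi> v x y = 2 * E1 y + a x y * (2 * E2 y)"
        using True \<phi>x by (simp add: pair_pos_def Gpos_def E1_def E2_def)
      also have "\<dots> \<le> 2 * E1 y + A * (2 * E2 y)"
        using a_near(2)[OF xB True] by (intro add_left_mono mult_right_mono) (auto simp: A_def E2_def)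
      finally have "ennreal (pair_pos p q s t a k B \<psi> v x y) \<le> ennreal (2 * E1 y + A * (2 * E2 y))" by (rule ennreal_leI)
      also have "\<dots> = ennreal 2 * ennreal (E1 y) + ennreal (2 * A) * ennreal (E2 y)"
      proof -
        have nn: "0 \<le> E1 y" "0 \<le> E2 y" by (simp_all add: E1_def E2_def)
        have "ennreal (2 * E1 y + A * (2 * E2 y)) = ennreal (2 * E1 y + (2 * A) * E2 y)" by (simp add: mult_ac)
        also have "\<dots> = ennreal (2 * E1 y) + ennreal ((2 * A) * E2 y)" using nn A by (intro ennreal_plus) auto
        also have "\<dots> = ennreal 2 * ennreal (E1 y) + ennreal (2 * A) * ennreal (E2 y)"
          using nn A by (simp only: ennreal_mult zero_le_numeral mult_nonneg_nonneg)
        finally show ?thesis .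
      qed
      finally show ?thesis by (rule order_trans) simp
    next
      case False
      define V1 where "V1 = w y powr (p - 1)"
      define V2 where "V2 = w y powr (q - 1)"
      have V: "V1 \<ge> 0" "V2 \<ge> 0" by (simp_all add: V1_def V2_def)
      define c where "c = 2 powr (?Q + t * q)"
      define W1 where "W1 = Wt (s * p) \<xi>0 y"
      define W2 where "W2 = Wt (t * q) \<xi>0 y"
      have c: "c \<ge> 0" by (simp add: c_def)
      have W: "W1 \<ge> 0" "W2 \<ge> 0" by (simp_all add: W1_def W2_def)
      have "pair_pos p q s t a k B \<psi> v x y = \<phi> x * V1 * Wt (s * p) x y + a x y * (\<phi> x * V2 * Wt (t * q) x y)"
        using False \<phi>x by (simp add: pair_pos_def Gpos_def V1_def V2_def w_def)
      also have "\<dots> \<le> \<phi> x * V1 * (c * W1) + a x y * (\<phi> x * V2 * (c * W2))"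
      proof -
        have "Wt (s * p) x y \<le> c * W1" "Wt (t * q) x y \<le> c * W2"
          unfolding c_def W1_def W2_def
          by (rule Wt_far[OF xD False less_imp_le[OF exponents(1)] exponents(5)],
              rule Wt_far[OF xD False less_imp_le[OF exponents(3)] order_refl])
        thus ?thesis using V a(2)[of x y] by (intro add_mono mult_left_mono mult_nonneg_nonneg[OF \<phi>_nonneg]) auto
      qed
      also have "\<dots> = Z * (V1 * W1 + V2 * (a x y * W2))"
        unfolding Z_def c_def[symmetric] by algebra
      also have "\<dots> \<le> Z * (V1 * W1 + V2 * (am * W2 + Ct * W1))"
        using a_Wt_far[OF xB False] V Z unfolding Ct_def W1_def W2_def
        by (intro mult_left_mono add_left_mono) auto
      also have "\<dots> \<le> Z * ((1 + Ct) * ((V1 + V2) * W1) + am * (V2 * W2))"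
      proof (rule mult_left_mono[OF _ Z])
        have "0 \<le> Ct * (V1 * W1) + V2 * W1" using V W Ct by simp
        thus "V1 * W1 + V2 * (am * W2 + Ct * W1) \<le> (1 + Ct) * ((V1 + V2) * W1) + am * (V2 * W2)"
          by (simp add: algebra_simps)
      qed
      also have "\<dots> = (Z * (1 + Ct)) * ((V1 + V2) * W1) + (Z * am) * (V2 * W2)"
        by (simp add: algebra_simps)
      finally have "ennreal (pair_pos p q s t a k B \<psi> v x y) \<le> ennreal ((Z * (1 + Ct)) * ((V1 + V2) * W1) + (Z * am) * (V2 * W2))"
        by (rule ennreal_leI)
      also have "\<dots> = ennreal (Z * (1 + Ct)) * ennreal ((V1 + V2) * W1) + ennreal (Z * am) * ennreal (V2 * W2)"
        using Z Ct V W by (simp add: ennreal_plus ennreal_mult)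
      also have "\<dots> = ennreal (Z * (1 + Ct)) * T1 y + ennreal (Z * am) * T2 y"
        using False by (simp add: T1_def T2_def V1_def V2_def W1_def W2_def)
      finally show ?thesis by (rule order_trans) simp
    qed
  qed
  also have "\<dots> = (ennreal 2 * (\<integral>\<^sup>+y. ennreal (E1 y) \<partial>lebesgue) + ennreal (2 * A) * (\<integral>\<^sup>+y. ennreal (E2 y) \<partial>lebesgue))
      + (ennreal (Z * (1 + Ct)) * (\<integral>\<^sup>+y. T1 y \<partial>lebesgue) + ennreal (Z * am) * (\<integral>\<^sup>+y. T2 y \<partial>lebesgue))"
    by (simp only: nn_integral_add nn_integral_cmult borel_measurable_add borel_measurable_times_ennreal
        borel_measurable_const measurable_compose[OF _ measurable_ennreal]
        \<open>E1 \<in> _\<close> \<open>E2 \<in> _\<close> \<open>T1 \<in> _\<close> \<open>T2 \<in> _\<close>)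
  also have "\<dots> \<le> (ennreal 2 * ennreal ((kint TYPE('n) (p - s * p) + kint TYPE('n) (s * p)) * (N powr p * l powr p * \<rho> powr - (s * p)))
      + ennreal (2 * A) * ennreal ((kint TYPE('n) (q - t * q) + kint TYPE('n) (t * q)) * (N powr q * l powr q * \<rho> powr - (t * q))))
      + (ennreal (Z * (1 + Ct)) * ennreal (\<epsilon> * (k powr (p - 1) * \<rho> powr - (s * p))) + ennreal (Z * am) * ennreal (\<epsilon> * (k powr (q - 1) * \<rho> powr - (t * q))))"
  proof (intro add_mono mult_left_mono)
    have c: "\<bar>\<psi> x - \<psi> y\<bar> \<le> l" "\<bar>\<psi> x - \<psi> y\<bar> \<le> N * l / \<rho> * kern y x" for y
      using \<psi>(2,3)[of x] \<psi>(2,3)[of y] \<psi>(5)[of x y] by (auto simp: kern_commute[of y x])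
    show "(\<integral>\<^sup>+y. ennreal (E1 y) \<partial>lebesgue) \<le> ennreal ((kint TYPE('n) (p - s * p) + kint TYPE('n) (s * p)) * (N powr p * l powr p * \<rho> powr - (s * p)))"
      unfolding E1_def by (rule nn_integral_cutoff) (use exponents N l \<rho> c in auto)
    show "(\<integral>\<^sup>+y. ennreal (E2 y) \<partial>lebesgue) \<le> ennreal ((kint TYPE('n) (q - t * q) + kint TYPE('n) (t * q)) * (N powr q * l powr q * \<rho> powr - (t * q)))"
      unfolding E2_def by (rule nn_integral_cutoff) (use exponents N l \<rho> c in auto)
    show "(\<integral>\<^sup>+y. T1 y \<partial>lebesgue) \<le> ennreal (\<epsilon> * (k powr (p - 1) * \<rho> powr - (s * p)))"
      unfolding T1_def w_def by (rule tail1)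
    show "(\<integral>\<^sup>+y. T2 y \<partial>lebesgue) \<le> ennreal (\<epsilon> * (k powr (q - 1) * \<rho> powr - (t * q)))"
      unfolding T2_def w_def by (rule tail2)
  qed auto
  also have "\<dots> = ennreal ((2 * ((kint TYPE('n) (p - s * p) + kint TYPE('n) (s * p)) * (N powr p * l powr p * \<rho> powr - (s * p)))
      + (2 * A) * ((kint TYPE('n) (q - t * q) + kint TYPE('n) (t * q)) * (N powr q * l powr q * \<rho> powr - (t * q))))
      + ((Z * (1 + Ct)) * (\<epsilon> * (k powr (p - 1) * \<rho> powr - (s * p))) + (Z * am) * (\<epsilon> * (k powr (q - 1) * \<rho> powr - (t * q)))))"
    using A Z Ct \<epsilon> kk by (simp add: ennreal_plus ennreal_mult)
  also have "\<dots> \<le> ennreal (cutoff_const TYPE('n) p q s t X * N powr q * G l + energy_const TYPE('n) q t / 2 * (\<phi> x * (G k / k)))"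
  proof (intro ennreal_leI add_mono)
    define k1 where "k1 = kint TYPE('n) (p - s * p) + kint TYPE('n) (s * p)"
    define k2 where "k2 = kint TYPE('n) (q - t * q) + kint TYPE('n) (t * q)"
    have kk: "k1 \<ge> 0" "k2 \<ge> 0" using kk by (simp_all add: k1_def k2_def)
    define P where "P = l powr p * \<rho> powr - (s * p)"
    define U where "U = l powr q * \<rho> powr - (t * q)"
    have Gl: "G l = P + am * U" by (simp add: G_def P_def U_def)
    have PU: "P \<ge> 0" "U \<ge> 0" by (simp_all add: P_def U_def)
    have "N powr p \<le> N powr q" using N pq by (intro powr_mono) auto
    hence 1: "2 * (k1 * (N powr p * l powr p * \<rho> powr - (s * p))) \<le> 2 * (k1 * (N powr q * P))"
      unfolding P_def using kk by (intro mult_left_mono) (auto simp: mult.assoc intro!: mult_right_mono)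
    have "R powr \<alpha> * U \<le> (R / \<rho>) powr \<alpha> * \<Lambda> powr (q - p) * P"
    proof -
      have "l powr q = l powr (q - p) * l powr p" by (subst powr_add[symmetric]) simp
      also have "\<dots> \<le> \<Lambda> powr (q - p) * l powr p" using l pq by (intro mult_right_mono powr_mono2) auto
      finally have lq: "l powr q \<le> \<Lambda> powr (q - p) * l powr p" .
      have "R powr \<alpha> * U = l powr q * (R powr \<alpha> * \<rho> powr - (t * q))" by (simp add: U_def)
      also have "\<dots> \<le> (\<Lambda> powr (q - p) * l powr p) * ((R / \<rho>) powr \<alpha> * \<rho> powr - (s * p))"
        by (intro mult_mono lq R_alpha) auto
      finally show ?thesis by (simp add: P_def mult_ac)
    qed
    hence "4 * Ha * (R powr \<alpha> * U) \<le> 4 * Ha * ((R / \<rho>) powr \<alpha> * \<Lambda> powr (q - p) * P)"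
      using Ha_nonneg by (intro mult_left_mono) auto
    hence AU: "A * U \<le> am * U + X * P" by (simp add: A_def X_def algebra_simps)
    have "(2 * A) * (k2 * (N powr q * l powr q * \<rho> powr - (t * q))) = 2 * k2 * N powr q * (A * U)"
      by (simp add: U_def mult_ac)
    also have "\<dots> \<le> 2 * k2 * N powr q * (am * U + X * P)" using kk AU by (intro mult_left_mono) auto
    finally have 2: "(2 * A) * (k2 * (N powr q * l powr q * \<rho> powr - (t * q))) \<le> 2 * k2 * N powr q * (am * U + X * P)" .
    have "2 * (k1 * (N powr q * P)) + 2 * k2 * N powr q * (am * U + X * P) \<le> (2 * k1 + 2 * k2 * (1 + X)) * N powr q * (P + am * U)"
    proof -
      have "0 \<le> N powr q * (2 * k1 * (am * U) + 2 * k2 * (P + X * (am * U)))"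
        using kk PU X_nonneg by simp
      thus ?thesis by (simp add: algebra_simps)
    qed
    with 1 2 show "2 * ((kint TYPE('n) (p - s * p) + kint TYPE('n) (s * p)) * (N powr p * l powr p * \<rho> powr - (s * p)))
      + (2 * A) * ((kint TYPE('n) (q - t * q) + kint TYPE('n) (t * q)) * (N powr q * l powr q * \<rho> powr - (t * q)))
      \<le> cutoff_const TYPE('n) p q s t X * N powr q * G l"
      unfolding cutoff_const_def Gl k1_def[symmetric] k2_def[symmetric] by linarith
  next
    have kp: "k powr (m - 1) = k powr m / k" for m using k by (simp add: powr_diff)
    have Gk: "k powr (p - 1) * \<rho> powr - (s * p) + am * (k powr (q - 1) * \<rho> powr - (t * q)) = G k / k"
      unfolding kp G_def by (simp add: add_divide_distrib)
    define g1 where "g1 = k powr (p - 1) * \<rho> powr - (s * p)"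
    define g2 where "g2 = k powr (q - 1) * \<rho> powr - (t * q)"
    have g: "g1 \<ge> 0" "g2 \<ge> 0" by (simp_all add: g1_def g2_def)
    have eps: "2 powr (?Q + t * q) * (1 + Ct) * \<epsilon> \<le> energy_const TYPE('n) q t / 2"
    proof -
      have "2 powr (?Q + t * q) * (1 + Ct) * \<epsilon> \<le> 2 powr (?Q + t * q) * (1 + Ct) * tail_threshold TYPE('n) q t La Ha"
        using \<epsilon>_le Ct by (intro mult_left_mono) auto
      also have "\<dots> = energy_const TYPE('n) q t / 2"
        using Ct unfolding tail_threshold_def Ct_def[symmetric] by simp
      finally show ?thesis .
    qed
    have "Z * (1 + Ct) * (\<epsilon> * g1) + Z * am * (\<epsilon> * g2) \<le> Z * (1 + Ct) * (\<epsilon> * g1) + Z * (1 + Ct) * (am * (\<epsilon> * g2))"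
    proof -
      have "0 \<le> Z * Ct * (am * (\<epsilon> * g2))" using Z Ct \<epsilon> g by simp
      thus ?thesis by (simp add: algebra_simps)
    qed
    also have "\<dots> = (2 powr (?Q + t * q) * (1 + Ct) * \<epsilon>) * (\<phi> x * (g1 + am * g2))"
      unfolding Z_def by algebra
    also have "\<dots> \<le> energy_const TYPE('n) q t / 2 * (\<phi> x * (g1 + am * g2))"
      using eps g by (intro mult_right_mono) auto
    finally show "Z * (1 + Ct) * (\<epsilon> * (k powr (p - 1) * \<rho> powr - (s * p))) + Z * am * (\<epsilon> * (k powr (q - 1) * \<rho> powr - (t * q)))
      \<le> energy_const TYPE('n) q t / 2 * (\<phi> x * (G k / k))"
      unfolding Gk[symmetric] g1_def g2_def .
  qed
  finally show ?thesis .
qed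

definition vol :: real where "vol = kvol TYPE('n) * \<rho> powr hdim TYPE('n)"
text \<open>The density of S relative to the volume bound of \<open>emeasure_kball_le\<close>. With
  \<open>vol\<close> an exact multiple of \<rho>^Q, the powers of \<rho> in the lower bound cancel
  exactly, while \<mu> \<le> 1 still holds.\<close>

definition \<mu> :: real where "\<mu> = measure lebesgue S / vol"

lemma vol_pos: "vol > 0" using \<rho> by (simp add: vol_def kvol_pos)

lemma emeasure_D_le: "emeasure lebesgue D \<le> ennreal vol"
  unfolding vol_def using \<rho> by (intro emeasure_kball_le) auto

lemma D_lmeasurable: "D \<in> lmeasurable"
  using emeasure_D_le by (intro fmeasurableI) (auto simp: le_less_trans[OF _ ennreal_less_top])

lemma S_lmeasurable: "S \<in> lmeasurable"
  by (rule fmeasurableI2[OF D_lmeasurable S_subset_D S_sets])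

lemma measure_S: "measure lebesgue S = vol * \<mu>"
  using vol_pos by (simp add: \<mu>_def)

lemma \<mu>_bounds: "0 \<le> \<mu>" "\<mu> \<le> 1"
proof -
  show "0 \<le> \<mu>" using vol_pos by (simp add: \<mu>_def)
  have "ennreal (measure lebesgue S) \<le> ennreal vol"
    using emeasure_mono[OF S_subset_D, of lebesgue] emeasure_D_le S_lmeasurable
    by (simp add: emeasure_eq_measure2 order_trans)
  thus "\<mu> \<le> 1" using vol_pos by (simp add: \<mu>_def)
qed

text \<open>A Sobolev inequality is not needed: every point of S sees at least the measure of S outside S
  within a distance comparable to the power 1 / Q of the measure of S. This produces the gain
  in the power of \<mu>.\<close>

lemma pair_neg_lower_bound:
  assumes x: "x \<in> S" and \<mu>: "\<mu> > 0"
  shows "ennreal (energy_const TYPE('n) q t * (\<mu> powr - (s * p / hdim TYPE('n)) * G (\<phi> x)) + energy_const TYPE('n) q t * (\<phi> x * (G k / k)))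
    \<le> (\<integral>\<^sup>+y. ennreal (pair_neg p q s t a k B \<psi> v x y) \<partial>lebesgue)"
proof -
  let ?Q = "hdim TYPE('n)"
  have Q: "?Q > 0" by (rule hdim_pos)
  have xD: "x \<in> D" using x S_subset_D by auto
  hence xB: "x \<in> B" using D_subset_B by auto
  have \<phi>x: "testfn \<psi> v x > 0" "testfn \<psi> v x = \<phi> x" "\<phi> x > 0" using x by (auto simp: S_def \<phi>_def)
  have xk: "v x < k" using \<phi>x \<psi>(3)[of x] l unfolding testfn_def by linarith
  \<comment> \<open>This radius makes kvol e0^Q equal to the measure of S. The ball of radius 2 e0
    then has at least twice that measure, so at least the measure of S is left outside S; and e0
    \<le> \<rho> keeps the ball inside B.\<close>
  define e0 where "e0 = \<rho> * \<mu> powr (1 / ?Q)"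
  have e0: "e0 > 0" using \<rho> \<mu> by (simp add: e0_def)
  have "\<mu> powr (1 / ?Q) \<le> 1" using \<mu> \<mu>_bounds Q by (intro powr_le1) auto
  hence e0\<rho>: "e0 \<le> \<rho>" using \<rho> by (simp add: e0_def)
  have e0Q: "e0 powr ?Q = \<rho> powr ?Q * \<mu>" using \<rho> \<mu> Q by (simp add: e0_def powr_mult powr_powr)
  define D0 where "D0 = kball x (2 * e0) - S"
  define A0 where "A0 = {y \<in> D. k \<le> v y}"
  have [measurable]: "D0 \<in> sets lebesgue" unfolding D0_def by measurable
  have [measurable]: "A0 \<in> sets lebesgue"
  proof -
    have "A0 = D \<inter> {y \<in> space lebesgue. k \<le> v y}" by (auto simp: A0_def)
    also have "\<dots> \<in> sets lebesgue" by measurable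
    finally show ?thesis .
  qed
  have eS: "emeasure lebesgue S = ennreal (vol * \<mu>)"
    using S_lmeasurable by (simp add: emeasure_eq_measure2 measure_S)
  have D0: "ennreal (vol * \<mu>) \<le> emeasure lebesgue D0"
  proof -
    have "ennreal (vol * \<mu>) + ennreal (vol * \<mu>) = ennreal (vol * \<mu> + vol * \<mu>)"
      using vol_pos \<mu> by (intro ennreal_plus[symmetric]) auto
    also have "vol * \<mu> + vol * \<mu> = 2 * kvol TYPE('n) * e0 powr ?Q" by (simp add: vol_def e0Q)
    also have "\<dots> \<le> emeasure lebesgue (kball x (2 * e0))"
      by (rule emeasure_kball_ge[OF e0])
    also have "\<dots> \<le> emeasure lebesgue (S \<union> D0)"
      by (rule emeasure_mono) (auto simp: D0_def)
    also have "\<dots> \<le> emeasure lebesgue S + emeasure lebesgue D0"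
      by (rule emeasure_subadditive) auto
    finally show ?thesis unfolding eS by (simp add: ennreal_add_left_cancel_le)
  qed
  have A0: "ennreal (kvol TYPE('n) * (\<rho> / 2) powr ?Q) \<le> emeasure lebesgue A0"
  proof -
    have "2 * ennreal (kvol TYPE('n) * (\<rho> / 2) powr ?Q) = ennreal (2 * kvol TYPE('n) * (\<rho> / 2) powr ?Q)"
      by (simp add: ennreal_mult' mult.assoc)
    also have "\<dots> \<le> emeasure lebesgue (kball \<xi>0 (2 * (\<rho> / 2)))"
      using \<rho> by (intro emeasure_kball_ge) auto
    also have "\<dots> \<le> 2 * emeasure lebesgue A0" using v_large by (simp add: A0_def)
    finally show ?thesis by (subst (asm) ennreal_mult_le_mult_iff) auto
  qed
  define f where "f m = \<phi> x powr m / 2 powr (m + 1)" for m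
  define h where "h m = (k / 2) powr (m - 1) * \<phi> x / 2" for m
  define w0 where "w0 e = 1 / (2 * e0) powr (?Q + e)" for e
  define w1 where "w1 e = 1 / (2 * \<rho>) powr (?Q + e)" for e
  have fh: "f m \<ge> 0" "h m \<ge> 0" for m by (simp_all add: f_def h_def)
  have w: "w0 e \<ge> 0" "w1 e \<ge> 0" for e by (simp_all add: w0_def w1_def)
  define K1 where "K1 = f p * w0 (s * p) + am * (f q * w0 (t * q))"
  define K2 where "K2 = h p * w1 (s * p) + am * (h q * w1 (t * q))"
  have K: "K1 \<ge> 0" "K2 \<ge> 0" using fh w by (simp_all add: K1_def K2_def)
  have WtD0: "w0 e \<le> Wt e x y" if "y \<in> D0" "e \<ge> 0" for y e
  proof -
    have "kern x y \<le> 2 * e0" "kern x y \<noteq> 0"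
      using that x by (auto simp: D0_def kball_def kern_commute[of y] kern_eq_0_iff)
    hence "0 < kern x y" "kern x y \<le> 2 * e0" by (auto simp: less_le)
    thus ?thesis unfolding w0_def Wt_def using Q that e0
      by (intro divide_left_mono powr_mono2 mult_pos_pos) (auto simp: powr_gt_zero)
  qed
  have WtA0: "w1 e \<le> Wt e x y" if "y \<in> A0" "e \<ge> 0" for y e
  proof -
    have "kern x y \<le> kern x \<xi>0 + kern \<xi>0 y" by (rule kern_triangle)
    hence "kern x y \<le> 2 * \<rho>" using that xD by (auto simp: A0_def kball_def kern_commute[of y])
    moreover have "kern x y \<noteq> 0" using that xk by (auto simp: A0_def kern_eq_0_iff)
    ultimately have "0 < kern x y" "kern x y \<le> 2 * \<rho>" by (auto simp: less_le)
    thus ?thesis unfolding w1_def Wt_def using Q that \<rho>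
      by (intro divide_left_mono powr_mono2 mult_pos_pos) (auto simp: powr_gt_zero)
  qed
  have sub: "D0 \<subseteq> B" "A0 \<subseteq> B"
  proof -
    show "A0 \<subseteq> B" using D_subset_B by (auto simp: A0_def)
    show "D0 \<subseteq> B"
    proof
      fix y assume "y \<in> D0"
      hence "kern y x < 2 * e0" by (simp add: D0_def kball_def)
      moreover have "kern y \<xi>0 \<le> kern y x + kern x \<xi>0" by (rule kern_triangle)
      ultimately show "y \<in> B" using xD e0\<rho> \<rho> by (simp add: kball_def)
    qed
  qed
  have point: "K1 * indicator D0 y + K2 * indicator A0 y \<le> pair_neg p q s t a k B \<psi> v x y" for y
  proof (cases "y \<in> B")
    case False
    hence "y \<notin> D0" "y \<notin> A0" using sub by auto
    thus ?thesis using False by (simp add: pair_neg_def Gneg_def)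
  next
    case yB: True
    have g: "Gneg m k B \<psi> v x y \<ge> f m * indicator D0 y + h m * indicator A0 y" for m
    proof -
      have "y \<in> D0 \<Longrightarrow> testfn \<psi> v y = 0"
        using testfn_nonneg[of \<psi> v y] by (auto simp: D0_def S_def \<phi>_def)
      thus ?thesis using yB \<phi>x fh[of m] unfolding Gneg_def f_def[symmetric] h_def[symmetric]
        by (auto simp: indicator_def A0_def f_def h_def)
    qed
    have ph: "(f m * indicator D0 y + h m * indicator A0 y) * Wt e x y \<ge> f m * w0 e * indicator D0 y + h m * w1 e * indicator A0 y"
      if "e \<ge> 0" for m e
    proof -
      have "f m * w0 e * indicator D0 y \<le> f m * indicator D0 y * Wt e x y"
        using WtD0[of y e] that fh[of m] by (auto simp: indicator_def intro!: mult_left_mono)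
      moreover have "h m * w1 e * indicator A0 y \<le> h m * indicator A0 y * Wt e x y"
        using WtA0[of y e] that fh[of m] by (auto simp: indicator_def intro!: mult_left_mono)
      ultimately show ?thesis by (simp add: distrib_right)
    qed
    have st: "0 \<le> s * p" "0 \<le> t * q" using exponents by auto
    have "K1 * indicator D0 y + K2 * indicator A0 y
      = (f p * w0 (s * p) * indicator D0 y + h p * w1 (s * p) * indicator A0 y)
        + am * (f q * w0 (t * q) * indicator D0 y + h q * w1 (t * q) * indicator A0 y)"
      unfolding K1_def K2_def by (simp add: algebra_simps)
    also have "\<dots> \<le> (f p * indicator D0 y + h p * indicator A0 y) * Wt (s * p) x y
        + am * ((f q * indicator D0 y + h q * indicator A0 y) * Wt (t * q) x y)"
      by (intro add_mono mult_left_mono ph st) auto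
    also have "\<dots> \<le> Gneg p k B \<psi> v x y * Wt (s * p) x y + a x y * (Gneg q k B \<psi> v x y * Wt (t * q) x y)"
      using a_near(1)[OF xB yB] a(2)[of x y] fh
      by (intro add_mono mult_mono g) (auto intro!: mult_nonneg_nonneg add_nonneg_nonneg Gneg_nonneg)
    finally show ?thesis unfolding pair_neg_def .
  qed
  \<comment> \<open>The kernel at distance 2 e0 times the measure of S yields \<rho>^(-e)
    \<mu>^(-e/Q) up to constants. Since s p \<le> e and \<mu> \<le> 1, the exponent s p / Q can be
    used for both phases.\<close>
  have faber_krahn_part: "energy_const TYPE('n) q t * (\<mu> powr - (s * p / ?Q) * (\<phi> x powr m * \<rho> powr - e)) \<le> f m * w0 e * (vol * \<mu>)"
    if m: "m \<le> q" and e: "s * p \<le> e" "e \<le> t * q" for m e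
  proof -
    have e0e: "e0 powr e = \<rho> powr e * \<mu> powr (e / ?Q)" using \<rho> \<mu> Q by (simp add: e0_def powr_mult powr_powr)
    have "(2 * e0) powr (?Q + e) = 2 powr (?Q + e) * (e0 powr ?Q * e0 powr e)"
      using e0 by (simp add: powr_mult powr_add)
    hence "w0 e * (vol * \<mu>) = kvol TYPE('n) * (\<rho> powr ?Q * \<mu>) / (2 powr (?Q + e) * ((\<rho> powr ?Q * \<mu>) * (\<rho> powr e * \<mu> powr (e / ?Q))))"
      unfolding w0_def vol_def e0Q e0e by simp
    also have "\<dots> = kvol TYPE('n) * (2 powr - (?Q + e) * \<rho> powr - e * \<mu> powr - (e / ?Q))"
    proof -
      have "\<rho> powr ?Q * \<mu> \<noteq> 0" using \<rho> \<mu> by simp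
      thus ?thesis unfolding powr_minus_divide by simp
    qed
    finally have eq: "w0 e * (vol * \<mu>) = kvol TYPE('n) * (2 powr - (?Q + e) * \<rho> powr - e * \<mu> powr - (e / ?Q))" .
    have f': "f m = \<phi> x powr m * 2 powr - (m + 1)" by (simp only: f_def powr_minus_divide mult_1_right times_divide_eq_right)
    have "energy_const TYPE('n) q t * (\<mu> powr - (s * p / ?Q) * (\<phi> x powr m * \<rho> powr - e))
      = \<phi> x powr m * \<rho> powr - e * kvol TYPE('n) * (2 powr - (q + 1 + 2 * ?Q + t * q) * \<mu> powr - (s * p / ?Q))"
      by (simp only: energy_const_def mult_ac)
    also have "\<dots> \<le> \<phi> x powr m * \<rho> powr - e * kvol TYPE('n) * (2 powr (- (m + 1) + - (?Q + e)) * \<mu> powr - (e / ?Q))"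
      using m e Q \<mu> \<mu>_bounds kvol_pos[where 'n='n]
      by (intro mult_left_mono mult_mono powr_mono powr_mono') (auto simp: divide_right_mono)
    also have "\<dots> = f m * (kvol TYPE('n) * (2 powr - (?Q + e) * \<rho> powr - e * \<mu> powr - (e / ?Q)))"
      unfolding f' powr_add[of 2 "- (m + 1)"] by (simp only: mult_ac)
    finally show ?thesis unfolding eq[symmetric] by (simp only: mult.assoc)
  qed
  \<comment> \<open>Points of A0 lie within 2 \<rho> of x. Their contribution is linear in \<phi> x
    with a factor of the size of the flux of height k, the same shape as the tails.\<close>
  have good_set_part: "energy_const TYPE('n) q t * (\<phi> x * (k powr m * \<rho> powr - e / k)) \<le> h m * w1 e * (kvol TYPE('n) * (\<rho> / 2) powr ?Q)"
    if m: "m \<le> q" and e: "s * p \<le> e" "e \<le> t * q" for m e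
  proof -
    have "w1 e * (kvol TYPE('n) * (\<rho> / 2) powr ?Q) = kvol TYPE('n) * (\<rho> powr ?Q / 2 powr ?Q / (2 powr (?Q + e) * (\<rho> powr ?Q * \<rho> powr e)))"
      using \<rho> by (simp add: w1_def powr_mult powr_divide powr_add)
    also have "\<dots> = kvol TYPE('n) * (2 powr - ?Q * 2 powr - (?Q + e) * \<rho> powr - e)"
      using \<rho> unfolding powr_minus_divide by simp
    finally have eq: "w1 e * (kvol TYPE('n) * (\<rho> / 2) powr ?Q) = kvol TYPE('n) * (2 powr - ?Q * 2 powr - (?Q + e) * \<rho> powr - e)" .
    have h': "h m = \<phi> x * (k powr m / k) * 2 powr - m"
      using k by (simp add: h_def powr_divide powr_diff powr_minus_divide mult_ac)
    have "energy_const TYPE('n) q t * (\<phi> x * (k powr m * \<rho> powr - e / k))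
      = \<phi> x * (k powr m / k) * \<rho> powr - e * kvol TYPE('n) * 2 powr - (q + 1 + 2 * ?Q + t * q)"
      by (simp add: energy_const_def mult_ac)
    also have "\<dots> \<le> \<phi> x * (k powr m / k) * \<rho> powr - e * kvol TYPE('n) * 2 powr (- m + (- ?Q + - (?Q + e)))"
      using m e k kvol_pos[where 'n='n]
      by (intro mult_left_mono powr_mono) (auto intro!: mult_nonneg_nonneg)
    also have "\<dots> = h m * (kvol TYPE('n) * (2 powr - ?Q * 2 powr - (?Q + e) * \<rho> powr - e))"
      unfolding h' powr_add[of 2 "- m"] powr_add[of 2 "- ?Q"] by (simp only: mult_ac)
    finally show ?thesis unfolding eq[symmetric] by (simp only: mult.assoc)
  qed
  have "energy_const TYPE('n) q t * (\<mu> powr - (s * p / ?Q) * G (\<phi> x)) + energy_const TYPE('n) q t * (\<phi> x * (G k / k))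
    = (energy_const TYPE('n) q t * (\<mu> powr - (s * p / ?Q) * (\<phi> x powr p * \<rho> powr - (s * p)))
       + am * (energy_const TYPE('n) q t * (\<mu> powr - (s * p / ?Q) * (\<phi> x powr q * \<rho> powr - (t * q)))))
     + (energy_const TYPE('n) q t * (\<phi> x * (k powr p * \<rho> powr - (s * p) / k))
       + am * (energy_const TYPE('n) q t * (\<phi> x * (k powr q * \<rho> powr - (t * q) / k))))"
    unfolding G_def by (simp add: algebra_simps add_divide_distrib)
  also have "\<dots> \<le> (f p * w0 (s * p) * (vol * \<mu>) + am * (f q * w0 (t * q) * (vol * \<mu>)))
     + (h p * w1 (s * p) * (kvol TYPE('n) * (\<rho> / 2) powr ?Q) + am * (h q * w1 (t * q) * (kvol TYPE('n) * (\<rho> / 2) powr ?Q)))"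
    using pq exponents by (intro add_mono mult_left_mono faber_krahn_part good_set_part) auto
  also have "\<dots> = K1 * (vol * \<mu>) + K2 * (kvol TYPE('n) * (\<rho> / 2) powr ?Q)"
    unfolding K1_def K2_def by (simp only: distrib_right mult.assoc)
  finally have "ennreal (energy_const TYPE('n) q t * (\<mu> powr - (s * p / ?Q) * G (\<phi> x)) + energy_const TYPE('n) q t * (\<phi> x * (G k / k)))
    \<le> ennreal (K1 * (vol * \<mu>) + K2 * (kvol TYPE('n) * (\<rho> / 2) powr ?Q))" by (rule ennreal_leI)
  also have "\<dots> = ennreal K1 * ennreal (vol * \<mu>) + ennreal K2 * ennreal (kvol TYPE('n) * (\<rho> / 2) powr ?Q)"
    using K vol_pos \<mu> kvol_pos[where 'n='n] by (simp add: ennreal_plus ennreal_mult)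
  also have "\<dots> \<le> ennreal K1 * emeasure lebesgue D0 + ennreal K2 * emeasure lebesgue A0"
    by (intro add_mono mult_left_mono D0 A0) auto
  also have "\<dots> = (\<integral>\<^sup>+y. ennreal K1 * indicator D0 y + ennreal K2 * indicator A0 y \<partial>lebesgue)"
    by (subst nn_integral_add) (auto simp: nn_integral_cmult_indicator)
  also have "\<dots> \<le> (\<integral>\<^sup>+y. ennreal (pair_neg p q s t a k B \<psi> v x y) \<partial>lebesgue)"
  proof (rule nn_integral_mono)
    fix y
    have "ennreal K1 * indicator D0 y + ennreal K2 * indicator A0 y = ennreal (K1 * indicator D0 y + K2 * indicator A0 y)"
      using K by (auto simp: indicator_def ennreal_plus)
    also have "\<dots> \<le> ennreal (pair_neg p q s t a k B \<psi> v x y)" by (rule ennreal_leI[OF point])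
    finally show "ennreal K1 * indicator D0 y + ennreal K2 * indicator A0 y \<le> ennreal (pair_neg p q s t a k B \<psi> v x y)" .
  qed
  finally show ?thesis .
qed

text \<open>\<open>J\<close> is the half of the good-set term that pays for the tails. Its integral
  is finite because \<phi> \<le> l on a set of finite measure, so it can be subtracted from both
  sides. The remaining good terms are restricted to S', where monotonicity allows \<phi> to be
  replaced by \<eta>.\<close>

lemma energy_level:
  assumes \<mu>: "\<mu> > 0" and S': "S' \<in> sets lebesgue" "\<And>x. x \<in> S' \<Longrightarrow> \<eta> \<le> \<phi> x" and \<eta>: "0 < \<eta>"
  shows "measure lebesgue S' * (energy_const TYPE('n) q t * (\<mu> powr - (s * p / hdim TYPE('n)) * G \<eta>) + energy_const TYPE('n) q t / 2 * (\<eta> * (G k / k)))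
    \<le> cutoff_const TYPE('n) p q s t X * N powr q * G l * measure lebesgue S"
proof -
  let ?c = "energy_const TYPE('n) q t"
  define Y where "Y = \<mu> powr - (s * p / hdim TYPE('n))"
  define E where "E = cutoff_const TYPE('n) p q s t X * N powr q * G l"
  define g where "g = G k / k"
  have c: "?c > 0" by (rule energy_const_pos)
  have g: "g \<ge> 0" using k by (simp add: g_def)
  have Y: "Y \<ge> 0" by (simp add: Y_def)
  have E: "E \<ge> 0"
  proof -
    have "cutoff_const TYPE('n) p q s t X \<ge> 0"
      unfolding cutoff_const_def using X_nonneg kint_pos[where 'n='n, of "p - s * p"] kint_pos[where 'n='n, of "s * p"]
      kint_pos[where 'n='n, of "q - t * q"] kint_pos[where 'n='n, of "t * q"] exponents
      by (intro add_nonneg_nonneg mult_nonneg_nonneg) auto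
    thus ?thesis by (simp add: E_def)
  qed
  define J where "J x = ennreal (?c / 2 * (\<phi> x * g)) * indicator S x" for x
  define H where "H x = ennreal (?c * (Y * G (\<phi> x)) + ?c / 2 * (\<phi> x * g)) * indicator S x" for x
  have [measurable]: "J \<in> borel_measurable lebesgue" "H \<in> borel_measurable lebesgue"
    unfolding J_def H_def G_def by measurable
  have S'S: "S' \<subseteq> S"
  proof
    fix x assume "x \<in> S'"
    thus "x \<in> S" using S'(2)[of x] \<eta> by (simp add: S_def)
  qed
  have S'l: "S' \<in> lmeasurable" by (rule fmeasurableI2[OF S_lmeasurable S'S S'(1)])
  have Jfin: "(\<integral>\<^sup>+x. J x \<partial>lebesgue) < \<infinity>"
  proof -
    have "(\<integral>\<^sup>+x. J x \<partial>lebesgue) \<le> (\<integral>\<^sup>+x. ennreal (?c / 2 * (l * g)) * indicator S x \<partial>lebesgue)"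
    proof (rule nn_integral_mono)
      fix x
      have "?c / 2 * (\<phi> x * g) \<le> ?c / 2 * (l * g)" using c g \<phi>_le by (intro mult_left_mono mult_right_mono) auto
      thus "J x \<le> ennreal (?c / 2 * (l * g)) * indicator S x"
        unfolding J_def by (intro mult_right_mono ennreal_leI) auto
    qed
    also have "\<dots> = ennreal (?c / 2 * (l * g)) * ennreal (measure lebesgue S)"
      using S_lmeasurable by (simp add: nn_integral_cmult_indicator emeasure_eq_measure2)
    also have "\<dots> < \<infinity>" by (simp add: ennreal_mult_less_top)
    finally show ?thesis .
  qed
  have Dfin: "emeasure lebesgue D < \<infinity>" using D_lmeasurable unfolding fmeasurable_def by blast
  have ei: "(\<integral>\<^sup>+x. \<integral>\<^sup>+y. ennreal (pair_neg p q s t a k B \<psi> v x y) \<partial>lebesgue \<partial>lebesgue)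
    \<le> (\<integral>\<^sup>+x. \<integral>\<^sup>+y. ennreal (pair_pos p q s t a k B \<psi> v x y) \<partial>lebesgue \<partial>lebesgue)"
    by (rule energy_inequality[OF pq a \<psi> N less_imp_le[OF l(1)] \<rho>(1) sets_kball Dfin \<Omega> v sets_kball D_subset_B B v_nonneg k l(2)])
  have "(\<integral>\<^sup>+x. H x \<partial>lebesgue) + (\<integral>\<^sup>+x. J x \<partial>lebesgue) = (\<integral>\<^sup>+x. H x + J x \<partial>lebesgue)"
    by (rule nn_integral_add[symmetric]) auto
  also have "\<dots> \<le> (\<integral>\<^sup>+x. \<integral>\<^sup>+y. ennreal (pair_neg p q s t a k B \<psi> v x y) \<partial>lebesgue \<partial>lebesgue)"
  proof (rule nn_integral_mono)
    fix x
    show "H x + J x \<le> (\<integral>\<^sup>+y. ennreal (pair_neg p q s t a k B \<psi> v x y) \<partial>lebesgue)"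
    proof (cases "x \<in> S")
      case True
      have "H x + J x = ennreal (?c * (Y * G (\<phi> x)) + ?c / 2 * (\<phi> x * g)) + ennreal (?c / 2 * (\<phi> x * g))"
        using True by (simp add: H_def J_def)
      also have "\<dots> = ennreal ((?c * (Y * G (\<phi> x)) + ?c / 2 * (\<phi> x * g)) + ?c / 2 * (\<phi> x * g))"
        using c g Y by (intro ennreal_plus[symmetric]) auto
      also have "(?c * (Y * G (\<phi> x)) + ?c / 2 * (\<phi> x * g)) + ?c / 2 * (\<phi> x * g) = ?c * (Y * G (\<phi> x)) + ?c * (\<phi> x * g)"
        by simp
      finally show ?thesis using pair_neg_lower_bound[OF True \<mu>] by (simp add: Y_def g_def)
    qed (simp add: H_def J_def)
  qed
  also note ei
  also have "(\<integral>\<^sup>+x. \<integral>\<^sup>+y. ennreal (pair_pos p q s t a k B \<psi> v x y) \<partial>lebesgue \<partial>lebesgue)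
     \<le> (\<integral>\<^sup>+x. ennreal E * indicator S x + J x \<partial>lebesgue)"
  proof (rule nn_integral_mono)
    fix x
    show "(\<integral>\<^sup>+y. ennreal (pair_pos p q s t a k B \<psi> v x y) \<partial>lebesgue) \<le> ennreal E * indicator S x + J x"
    proof (cases "x \<in> S")
      case True
      have "ennreal E * indicator S x + J x = ennreal (E + ?c / 2 * (\<phi> x * g))"
        using True E c g by (simp add: J_def ennreal_plus)
      thus ?thesis using pair_pos_upper_bound[OF True] by (simp add: E_def g_def)
    next
      case False
      hence "testfn \<psi> v x = 0" using testfn_nonneg[of \<psi> v x] by (simp add: S_def \<phi>_def)
      thus ?thesis by (simp add: pair_pos_def Gpos_def)
    qed
  qed
  also have "\<dots> = ennreal E * emeasure lebesgue S + (\<integral>\<^sup>+x. J x \<partial>lebesgue)"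
    by (subst nn_integral_add) (auto simp: nn_integral_cmult_indicator)
  finally have "(\<integral>\<^sup>+x. J x \<partial>lebesgue) + (\<integral>\<^sup>+x. H x \<partial>lebesgue) \<le> (\<integral>\<^sup>+x. J x \<partial>lebesgue) + ennreal E * emeasure lebesgue S"
    by (simp add: add.commute)
  hence HE: "(\<integral>\<^sup>+x. H x \<partial>lebesgue) \<le> ennreal E * emeasure lebesgue S"
    using Jfin by (subst (asm) ennreal_add_left_cancel_le) auto
  define Z where "Z = ?c * (Y * G \<eta>) + ?c / 2 * (\<eta> * g)"
  have Z: "Z \<ge> 0" using c g Y \<eta> by (simp add: Z_def)
  have "ennreal (measure lebesgue S' * Z) = (\<integral>\<^sup>+x. ennreal Z * indicator S' x \<partial>lebesgue)"
    using S'l Z by (simp add: nn_integral_cmult_indicator emeasure_eq_measure2 ennreal_mult mult.commute)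
  also have "\<dots> \<le> (\<integral>\<^sup>+x. H x \<partial>lebesgue)"
  proof (rule nn_integral_mono)
    fix x
    show "ennreal Z * indicator S' x \<le> H x"
    proof (cases "x \<in> S'")
      case True
      hence xS: "x \<in> S" using S'S by auto
      have "Z \<le> ?c * (Y * G (\<phi> x)) + ?c / 2 * (\<phi> x * g)"
        unfolding Z_def using c g Y \<eta> S'(2)[OF True] by (intro add_mono mult_left_mono mult_right_mono G_mono) auto
      thus ?thesis using True xS by (simp add: H_def ennreal_leI)
    qed simp
  qed
  also note HE
  also have "ennreal E * emeasure lebesgue S = ennreal (E * measure lebesgue S)"
    using S_lmeasurable E by (simp add: emeasure_eq_measure2 ennreal_mult)
  finally have "measure lebesgue S' * Z \<le> E * measure lebesgue S"
    using E by (simp add: ennreal_le_iff)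
  thus ?thesis by (simp add: Z_def E_def Y_def g_def)
qed

lemma cutoff_const_nonneg: "cutoff_const TYPE('n) p q s t X \<ge> 0"
  unfolding cutoff_const_def using X_nonneg kint_pos[where 'n='n, of "p - s * p"] kint_pos[where 'n='n, of "s * p"]
  kint_pos[where 'n='n, of "q - t * q"] kint_pos[where 'n='n, of "t * q"] exponents
  by (intro add_nonneg_nonneg mult_nonneg_nonneg) auto

text \<open>Each bound keeps one of the two good terms of \<open>energy_level\<close>. The
  self-interaction of S gives the superlinear power of \<mu> that drives the iteration; the
  interaction with the set of large values gives a bound that is small when l is small compared with
  k, and this starts it.\<close>

lemma level_bounds:
  assumes S': "S' \<in> sets lebesgue" "\<And>x. x \<in> S' \<Longrightarrow> \<eta> \<le> \<phi> x" and \<eta>: "0 < \<eta>" "\<eta> \<le> l"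
  shows "measure lebesgue S' / vol \<le> cutoff_const TYPE('n) p q s t X / energy_const TYPE('n) q t * (N powr q * (l / \<eta>) powr q)
      * \<mu> powr (1 + s * p / hdim TYPE('n))"
    and "measure lebesgue S' / vol \<le> 2 * (cutoff_const TYPE('n) p q s t X / energy_const TYPE('n) q t) * N powr q * ((l / k) powr p * (k / \<eta>))"
proof -
  let ?K = "cutoff_const TYPE('n) p q s t X"
  let ?c = "energy_const TYPE('n) q t"
  define m where "m = measure lebesgue S'"
  define \<gamma> where "\<gamma> = s * p / hdim TYPE('n)"
  have c: "?c > 0" by (rule energy_const_pos)
  have S'S: "S' \<subseteq> S"
  proof
    fix x assume "x \<in> S'"
    thus "x \<in> S" using S'(2)[of x] \<eta> by (simp add: S_def)
  qed
  have m: "0 \<le> m" "m \<le> measure lebesgue S"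
    unfolding m_def by (auto intro!: measure_mono_fmeasurable S'S S'(1) S_lmeasurable)
  have r: "0 \<le> ?K / ?c * (N powr q * (l / \<eta>) powr q) * \<mu> powr (1 + \<gamma>)"
    using cutoff_const_nonneg c by simp
  have r2: "0 \<le> 2 * (?K / ?c) * N powr q * ((l / k) powr p * (k / \<eta>))"
    using cutoff_const_nonneg c k \<eta> by simp
  show "measure lebesgue S' / vol \<le> ?K / ?c * (N powr q * (l / \<eta>) powr q) * \<mu> powr (1 + s * p / hdim TYPE('n))"
   and "measure lebesgue S' / vol \<le> 2 * (?K / ?c) * N powr q * ((l / k) powr p * (k / \<eta>))"
    unfolding \<gamma>_def[symmetric] m_def[symmetric]
  proof (atomize(full), cases "\<mu> = 0")
    case True
    hence "m = 0" using m measure_S by simp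
    thus "m / vol \<le> ?K / ?c * (N powr q * (l / \<eta>) powr q) * \<mu> powr (1 + \<gamma>) \<and>
       m / vol \<le> 2 * (?K / ?c) * N powr q * ((l / k) powr p * (k / \<eta>))" using r r2 by simp
  next
    case False
    hence \<mu>: "\<mu> > 0" using \<mu>_bounds by simp
    have main: "m * (?c * (\<mu> powr - \<gamma> * G \<eta>) + ?c / 2 * (\<eta> * (G k / k))) \<le> ?K * N powr q * G l * (vol * \<mu>)"
      using energy_level[OF \<mu> S' \<eta>(1)] unfolding m_def \<gamma>_def measure_S .
    have Ge: "G \<eta> > 0" "G k > 0" using \<eta> k by (auto intro: G_pos)
    have "m * (?c * (\<mu> powr - \<gamma> * G \<eta>)) \<le> m * (?c * (\<mu> powr - \<gamma> * G \<eta>) + ?c / 2 * (\<eta> * (G k / k)))"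
      using m c \<eta> Ge k by (intro mult_left_mono) auto
    also note main
    also have "?K * N powr q * G l * (vol * \<mu>) \<le> ?K * N powr q * ((l / \<eta>) powr q * G \<eta>) * (vol * \<mu>)"
      using cutoff_const_nonneg vol_pos \<mu> by (intro mult_left_mono mult_right_mono G_scale_up[OF \<eta>]) auto
    finally have "(m * ?c * \<mu> powr - \<gamma>) * G \<eta> \<le> (?K * N powr q * (l / \<eta>) powr q * (vol * \<mu>)) * G \<eta>"
      by (simp add: mult_ac)
    hence "m * ?c * \<mu> powr - \<gamma> \<le> ?K * N powr q * (l / \<eta>) powr q * (vol * \<mu>)"
      using Ge by simp
    hence "(m * ?c * \<mu> powr - \<gamma>) * \<mu> powr \<gamma> \<le> ?K * N powr q * (l / \<eta>) powr q * (vol * \<mu>) * \<mu> powr \<gamma>"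
      by (rule mult_right_mono) simp
    hence "m * ?c * (\<mu> powr - \<gamma> * \<mu> powr \<gamma>) \<le> ?K * N powr q * (l / \<eta>) powr q * (vol * \<mu>) * \<mu> powr \<gamma>"
      by (simp only: mult.assoc)
    also have "\<mu> powr - \<gamma> * \<mu> powr \<gamma> = 1" using \<mu> by (simp add: powr_minus)
    finally have "m * ?c \<le> ?K * N powr q * (l / \<eta>) powr q * vol * \<mu> powr (1 + \<gamma>)"
      using \<mu> by (simp add: powr_add mult_ac)
    hence 1: "m / vol \<le> ?K / ?c * (N powr q * (l / \<eta>) powr q) * \<mu> powr (1 + \<gamma>)"
      using vol_pos c by (simp add: field_simps)
    have "m * (?c / 2 * (\<eta> * (G k / k))) \<le> m * (?c * (\<mu> powr - \<gamma> * G \<eta>) + ?c / 2 * (\<eta> * (G k / k)))"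
      using m c Ge by (intro mult_left_mono) auto
    also note main
    also have "?K * N powr q * G l * (vol * \<mu>) \<le> ?K * N powr q * ((l / k) powr p * G k) * (vol * 1)"
      using cutoff_const_nonneg vol_pos \<mu> \<mu>_bounds l by (intro mult_mono mult_left_mono G_scale_down) auto
    finally have "(m * ?c / 2 * \<eta> / k) * G k \<le> (?K * N powr q * (l / k) powr p * vol) * G k"
      by (simp add: mult_ac)
    hence "m * ?c / 2 * \<eta> / k \<le> ?K * N powr q * (l / k) powr p * vol"
      using mult_le_cancel_right_pos[OF Ge(2)] by blast
    hence 2: "m / vol \<le> 2 * (?K / ?c) * N powr q * ((l / k) powr p * (k / \<eta>))"
      using vol_pos c k \<eta> by (simp add: field_simps)
    show "m / vol \<le> ?K / ?c * (N powr q * (l / \<eta>) powr q) * \<mu> powr (1 + \<gamma>) \<and>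
       m / vol \<le> 2 * (?K / ?c) * N powr q * ((l / k) powr p * (k / \<eta>))" using 1 2 by blast
  qed
qed

end

section \<open>The De Giorgi iteration over levels and radii\<close>

lemma fast_geometric_decay:
  fixes Y :: "nat \<Rightarrow> real"
  assumes C: "C > 0" and b: "b > 1" and \<gamma>: "\<gamma> > 0" and Y: "\<And>i. 0 \<le> Y i"
    and step: "\<And>i. Y (Suc i) \<le> C * b ^ i * Y i powr (1 + \<gamma>)"
    and start: "Y 0 \<le> C powr - (1 / \<gamma>) * b powr - (1 / \<gamma>\<^sup>2)"
  shows "Y \<longlonglongrightarrow> 0"
proof -
  \<comment> \<open>Z and w solve Z^\<gamma> = w / C and w^\<gamma> = 1 / b. Thus in the induction
    the growing factor b^i is cancelled by (w^\<gamma>)^i, and C Z^\<gamma> supplies exactly one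
    more factor w.\<close>
  define Z where "Z = C powr - (1 / \<gamma>) * b powr - (1 / \<gamma>\<^sup>2)"
  define w where "w = b powr - (1 / \<gamma>)"
  have Z: "Z > 0" using C b by (simp add: Z_def)
  have w: "0 < w" "w < 1" using b \<gamma> by (auto simp: w_def powr_less_one)
  have Zg: "Z powr \<gamma> = w / C"
  proof -
    have "Z powr \<gamma> = C powr (- (1 / \<gamma>) * \<gamma>) * b powr (- (1 / \<gamma>\<^sup>2) * \<gamma>)"
      using C b by (simp add: Z_def powr_mult powr_powr)
    also have "- (1 / \<gamma>) * \<gamma> = - 1" using \<gamma> by simp
    also have "- (1 / \<gamma>\<^sup>2) * \<gamma> = - (1 / \<gamma>)" using \<gamma> by (simp add: power2_eq_square)
    finally show ?thesis using C by (simp add: w_def powr_minus_divide)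
  qed
  have wg: "w powr \<gamma> = 1 / b" proof -
    have "w powr \<gamma> = b powr (- (1 / \<gamma>) * \<gamma>)" unfolding w_def by (rule powr_powr)
    also have "- (1 / \<gamma>) * \<gamma> = - 1" using \<gamma> by simp
    finally show ?thesis using b by (simp add: powr_minus_divide)
  qed
  have bound: "Y i \<le> Z * w ^ i" for i
  proof (induction i)
    case 0 thus ?case using start by (simp add: Z_def)
  next
    case (Suc i)
    have "Y (Suc i) \<le> C * b ^ i * Y i powr (1 + \<gamma>)" by (rule step)
    also have "\<dots> \<le> C * b ^ i * (Z * w ^ i) powr (1 + \<gamma>)"
      using C b \<gamma> Y Suc by (intro mult_left_mono powr_mono2) auto
    also have "(Z * w ^ i) powr (1 + \<gamma>) = (Z * w ^ i) * (Z powr \<gamma> * (w powr \<gamma>) ^ i)"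
    proof -
      have "(w ^ i) powr \<gamma> = (w powr \<gamma>) ^ i"
        using w by (simp add: powr_realpow[symmetric] powr_powr powr_power mult.commute)
      thus ?thesis using Z w by (simp add: powr_add powr_mult)
    qed
    also have "C * b ^ i * ((Z * w ^ i) * (Z powr \<gamma> * (w powr \<gamma>) ^ i)) = Z * w ^ Suc i"
      unfolding Zg wg using C b by (simp add: field_simps)
    finally show ?case .
  qed
  have "(\<lambda>i. Z * w ^ i) \<longlonglongrightarrow> Z * 0"
    using w by (intro tendsto_mult_left LIMSEQ_power_zero) auto
  hence "(\<lambda>i. Z * w ^ i) \<longlonglongrightarrow> 0" by simp
  from tendsto_sandwich[OF _ _ tendsto_const this] show ?thesis using Y bound by auto
qed

definition cutoff :: "'n::finite heis \<Rightarrow> real \<Rightarrow> real \<Rightarrow> 'n heis \<Rightarrow> real" where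
  "cutoff \<xi>0 r r' x = max 0 (min 1 ((r - kern x \<xi>0) / (r - r')))"

lemma cutoff_bounds: "0 \<le> cutoff \<xi>0 r r' x" "cutoff \<xi>0 r r' x \<le> 1"
  by (auto simp: cutoff_def)

lemma cutoff_eq_0: "r' < r \<Longrightarrow> x \<notin> kball \<xi>0 r \<Longrightarrow> cutoff \<xi>0 r r' x = 0"
proof -
  assume "r' < r" "x \<notin> kball \<xi>0 r"
  hence "(r - kern x \<xi>0) / (r - r') \<le> 0" by (intro divide_nonpos_pos) (auto simp: kball_def)
  thus ?thesis unfolding cutoff_def by linarith
qed

lemma cutoff_eq_1: "r' < r \<Longrightarrow> kern x \<xi>0 \<le> r' \<Longrightarrow> cutoff \<xi>0 r r' x = 1"
  by (simp add: cutoff_def max_def min_def)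

lemma cutoff_lipschitz:
  assumes "r' < r" shows "\<bar>cutoff \<xi>0 r r' x - cutoff \<xi>0 r r' y\<bar> \<le> kern x y / (r - r')"
proof -
  have *: "\<bar>max 0 (min 1 a) - max 0 (min 1 b)\<bar> \<le> \<bar>a - b\<bar>" for a b :: real by linarith
  have "\<bar>cutoff \<xi>0 r r' x - cutoff \<xi>0 r r' y\<bar> \<le> \<bar>(r - kern x \<xi>0) / (r - r') - (r - kern y \<xi>0) / (r - r')\<bar>"
    unfolding cutoff_def by (rule *)
  also have "\<dots> = \<bar>kern y \<xi>0 - kern x \<xi>0\<bar> / (r - r')"
    using assms by (simp add: diff_divide_distrib[symmetric] abs_divide)
  also have "\<dots> \<le> kern x y / (r - r')"
    using assms kern_triangle[of x \<xi>0 y] kern_triangle[of y \<xi>0 x] kern_commute[of y x]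
    by (intro divide_right_mono) auto
  finally show ?thesis .
qed

lemma cutoff_measurable: "cutoff \<xi>0 r r' \<in> borel_measurable lebesgue"
  unfolding cutoff_def by measurable

text \<open>At step i the Lipschitz factor of the cutoff is 2^(i+2) and the ratio of the level to
  the gap is at most 2^(i+2). Raised to the power q, their product is 2^(4q) (4^q)^i. The summand 1
  only secures positivity.\<close>

definition growth_const :: "'n::finite itself \<Rightarrow> real \<Rightarrow> real \<Rightarrow> real \<Rightarrow> real \<Rightarrow> real \<Rightarrow> real" where
  "growth_const _ p q s t X = (1 + cutoff_const TYPE('n) p q s t X / energy_const TYPE('n) q t) * 2 powr (4 * q)"

text \<open>The threshold of \<open>fast_geometric_decay\<close> with \<gamma> = s p / Q and b =
  4^q. The constant is C b instead of C because the iteration runs on the sequence shifted by one: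
  smallness is established for the index 1.\<close>

definition decay_start :: "'n::finite itself \<Rightarrow> real \<Rightarrow> real \<Rightarrow> real \<Rightarrow> real \<Rightarrow> real \<Rightarrow> real" where
  "decay_start _ p q s t X = (growth_const TYPE('n) p q s t X * 4 powr q) powr - (1 / (s * p / hdim TYPE('n)))
     * (4 powr q) powr - (1 / (s * p / hdim TYPE('n))\<^sup>2)"

context growth
begin

lemma growth_conclusion:
  fixes \<Lambda> \<delta> :: real
  defines "X \<equiv> 4 * Ha * ((R / \<rho>) powr \<alpha> * \<Lambda> powr (q - p))"
  assumes \<epsilon>_le: "\<epsilon> \<le> tail_threshold TYPE('n) q t La Ha" and k\<Lambda>: "k \<le> \<Lambda>"
    and \<delta>: "0 < \<delta>" "\<delta> \<le> 1/4" and start: "growth_const TYPE('n) p q s t X * 2 powr (p + 2) * \<delta> powr (p - 1) \<le> decay_start TYPE('n) p q s t X"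
  shows "AE x in lebesgue. x \<in> kball \<xi>0 (\<rho> / 2) \<longrightarrow> \<delta> * k \<le> v x"
proof -
  \<comment> \<open>Levels decrease from 2 \<delta> k to \<delta> k and radii from \<rho> to \<rho>
    / 2. Since \<psi> i equals l i on the ball of radius r (i+1), a point of S (i+1) has test
    function at least l i - l (i+1) at step i; this gap is the \<eta> of
    \<open>level_bounds\<close>.\<close>
  define l where "l i = \<delta> * k * (1 + (1/2) ^ i)" for i :: nat
  define r where "r i = \<rho> / 2 * (1 + (1/2) ^ i)" for i :: nat
  define \<psi> where "\<psi> i x = l i * cutoff \<xi>0 (r i) (r (Suc i)) x" for i x
  define \<gamma> where "\<gamma> = s * p / hdim TYPE('n)"
  define vol where "vol = kvol TYPE('n) * \<rho> powr hdim TYPE('n)"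
  define S where "S i = {x. testfn (\<psi> i) v x > 0}" for i
  define Y where "Y i = measure lebesgue (S i) / vol" for i
  define K where "K = cutoff_const TYPE('n) p q s t X / energy_const TYPE('n) q t"
  have pw: "0 < (1/2::real) ^ i" "(1/2::real) ^ i \<le> 1" for i :: nat by (auto intro: power_le_one)
  have lpos: "0 < l i" "l i \<le> 2 * \<delta> * k" for i
  proof -
    show "0 < l i" using \<delta> k pw[of i] by (simp add: l_def add_pos_pos)
    have "\<delta> * k * (1 + (1/2) ^ i) \<le> \<delta> * k * 2" using \<delta> k pw[of i] by (intro mult_left_mono) auto
    thus "l i \<le> 2 * \<delta> * k" by (simp add: l_def)
  qed
  have lk: "2 * l i \<le> k" for i
  proof -
    have "2 * \<delta> * k \<le> 1/2 * k" using \<delta> k by (intro mult_right_mono) auto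
    thus ?thesis using lpos(2)[of i] by simp
  qed
  have l\<Lambda>: "l i \<le> \<Lambda>" for i using lk[of i] lpos(1)[of i] k\<Lambda> by linarith
  have rdiff: "r i - r (Suc i) = \<rho> / 2 ^ (i + 2)" for i
    by (simp add: r_def power_divide field_simps)
  have r\<rho>: "r i \<le> \<rho>" "\<rho> / 2 < r i" "r (Suc i) < r i" for i
  proof -
    show "r i \<le> \<rho>" using \<rho> pw[of i] mult_left_mono[of "1 + (1/2) ^ i" 2 "\<rho> / 2"] by (simp add: r_def)
    show "\<rho> / 2 < r i" using \<rho> pw[of i] by (simp add: r_def distrib_left)
    have "\<rho> / 2 ^ (i + 2) > 0" using \<rho> by simp
    thus "r (Suc i) < r i" using rdiff[of i] by linarith
  qed
  have \<psi>0: "\<psi> i x = 0" if "x \<notin> kball \<xi>0 (r i)" for i x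
    using cutoff_eq_0[OF r\<rho>(3) that] by (simp add: \<psi>_def)
  have \<psi>_le: "\<psi> i x \<le> l i" "0 \<le> \<psi> i x" for i x
    unfolding \<psi>_def using cutoff_bounds[of \<xi>0 "r i" "r (Suc i)" x] lpos(1)[of i]
    by (auto simp: mult_le_cancel_left2 intro!: mult_nonneg_nonneg)
  have lev: "growth_level p q s t \<alpha> La Ha a \<Omega> v \<xi>0 R \<rho> k \<epsilon> (\<psi> i) (l i) (2 ^ (i + 2)) \<Lambda>" for i
  proof (unfold_locales)
    show "\<psi> i \<in> borel_measurable lebesgue"
      unfolding \<psi>_def by (rule borel_measurable_times[OF borel_measurable_const cutoff_measurable])
    show "\<psi> i x = 0" if "x \<notin> kball \<xi>0 \<rho>" for x
      using that r\<rho>(1)[of i] by (intro \<psi>0) (auto simp: kball_def)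
    show "\<bar>\<psi> i x - \<psi> i y\<bar> \<le> 2 ^ (i + 2) * l i / \<rho> * kern x y" for x y
    proof -
      have "\<bar>\<psi> i x - \<psi> i y\<bar> = l i * \<bar>cutoff \<xi>0 (r i) (r (Suc i)) x - cutoff \<xi>0 (r i) (r (Suc i)) y\<bar>"
        unfolding \<psi>_def right_diff_distrib[symmetric] abs_mult using lpos(1)[of i] by simp
      also have "\<dots> \<le> l i * (kern x y / (r i - r (Suc i)))"
        using lpos(1)[of i] by (intro mult_left_mono cutoff_lipschitz r\<rho>) auto
      also have "\<dots> = 2 ^ (i + 2) * l i / \<rho> * kern x y"
        unfolding rdiff by simp
      finally show ?thesis .
    qed
    show "1 \<le> (2::real) ^ (i + 2)" by (rule one_le_power) simp
  qed (use \<psi>_le lpos lk l\<Lambda> \<epsilon>_le in auto)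
  have Seq: "growth_level.S v (\<psi> i) = S i" and \<phi>eq: "growth_level.\<phi> v (\<psi> i) = testfn (\<psi> i) v"
    and voleq: "growth_level.vol TYPE('n) \<rho> = vol" and Xeq: "growth_level.X p q \<alpha> Ha R \<rho> \<Lambda> = X"
    and \<mu>eq: "growth_level.\<mu> v \<rho> (\<psi> i) = Y i" for i
    by (simp_all add: growth_level.S_def[OF lev[of i]] growth_level.\<phi>_def[OF lev[of i]] S_def
      growth_level.vol_def[OF lev[of i]] vol_def growth_level.X_def[OF lev[of i]] X_def growth_level.\<mu>_def[OF lev[of i]] Y_def)
  have K: "K \<ge> 0" using growth_level.cutoff_const_nonneg[OF lev] energy_const_pos[where 'n='n, of q t] unfolding Xeq K_def by simp
  define C where "C = growth_const TYPE('n) p q s t X"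
  have C: "C > 0" "C = (1 + K) * 2 powr (4 * q)" using K by (simp_all add: C_def growth_const_def K_def add_pos_nonneg)
  define b where "b = (4::real) powr q"
  have b: "b > 1" using pq by (simp add: b_def gr_one_powr)
  have \<gamma>: "\<gamma> > 0" using exponents hdim_pos[where 'n='n] by (simp add: \<gamma>_def)
  have vol: "vol > 0" using \<rho> by (simp add: vol_def kvol_pos)
  have Y0: "0 \<le> Y i" for i using vol by (simp add: Y_def)
  have S_sets: "S i \<in> sets lebesgue" for i using growth_level.S_sets[OF lev[of i]] unfolding Seq .
  have S_fm: "S i \<in> lmeasurable" for i using growth_level.S_lmeasurable[OF lev[of i]] unfolding Seq .
  define \<eta> where "\<eta> i = l i - l (Suc i)" for i
  have \<eta>eq: "\<eta> i = \<delta> * k / 2 ^ (i + 1)" for i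
    by (simp add: \<eta>_def l_def power_divide field_simps)
  have \<eta>: "0 < \<eta> i" "\<eta> i \<le> l i" for i
  proof -
    show "0 < \<eta> i" using \<delta> k unfolding \<eta>eq by simp
    show "\<eta> i \<le> l i" using lpos(1)[of "Suc i"] unfolding \<eta>_def by simp
  qed
  have l\<eta>: "l i / \<eta> i \<le> 2 ^ (i + 2)" for i
  proof -
    have "l i \<le> 2 ^ (i + 2) * \<eta> i" using lpos(2)[of i] by (simp add: \<eta>eq)
    thus ?thesis using \<eta>(1)[of i] by (simp add: pos_divide_le_eq)
  qed
  have incl: "\<eta> i \<le> testfn (\<psi> i) v x" if "x \<in> S (Suc i)" for i x
  proof -
    have *: "max 0 (v x) < \<psi> (Suc i) x" using that unfolding S_def testfn_def by auto
    hence "x \<in> kball \<xi>0 (r (Suc i))" using \<psi>0[of x "Suc i"] by (cases "x \<in> kball \<xi>0 (r (Suc i))") auto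
    hence "\<psi> i x = l i" using cutoff_eq_1[OF r\<rho>(3)[of i], of x \<xi>0] by (simp add: \<psi>_def kball_def)
    thus ?thesis using * \<psi>_le(1)[of "Suc i" x] unfolding testfn_def \<eta>_def by linarith
  qed
  have step: "Y (Suc i) \<le> C * b ^ i * Y i powr (1 + \<gamma>)" for i
  proof -
    have "Y (Suc i) \<le> K * ((2 ^ (i + 2)) powr q * (l i / \<eta> i) powr q) * Y i powr (1 + \<gamma>)"
      using growth_level.level_bounds(1)[OF lev[of i] S_sets[of "Suc i"] _ \<eta>(1)[of i] \<eta>(2)[of i]] incl
      unfolding \<phi>eq voleq Xeq \<mu>eq Y_def[symmetric] K_def \<gamma>_def by blast
    also have "\<dots> \<le> (1 + K) * ((2 ^ (i + 2)) powr q * (2 ^ (i + 2)) powr q) * Y i powr (1 + \<gamma>)"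
      using K l\<eta>[of i] \<eta>(1)[of i] lpos(1)[of i] pq
      by (intro mult_right_mono mult_mono mult_left_mono powr_mono2) auto
    also have "((2 ^ (i + 2)) powr q * (2 ^ (i + 2)) powr q) = 2 powr (4 * q) * b ^ i"
    proof -
      have "(2 ^ (i + 2)) powr q * (2 ^ (i + 2)) powr q = (2::real) powr (real (i + 2) * q + real (i + 2) * q)"
        by (simp only: powr_realpow[symmetric] zero_less_numeral powr_powr powr_add)
      also have "real (i + 2) * q + real (i + 2) * q = 4 * q + real i * (2 * q)" by (simp add: algebra_simps)
      also have "2 powr (4 * q + real i * (2 * q)) = 2 powr (4 * q) * (2 powr (2 * q)) ^ i"
        by (simp add: powr_add powr_power)
      also have "2 powr (2 * q) = b"
      proof -
        have "(4::real) = 2 powr 2" by simp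
        thus ?thesis unfolding b_def by (metis powr_powr)
      qed
      finally show ?thesis .
    qed
    also have "(1 + K) * (2 powr (4 * q) * b ^ i) = C * b ^ i" by (simp add: C(2))
    finally show ?thesis .
  qed
  \<comment> \<open>With l 0 / k = 2 \<delta> and k / \<eta> 0 = 2 / \<delta> the second level bound
    is of order \<delta>^(p-1). Because p > 1, a small \<delta> brings it below the starting
    threshold.\<close>
  have Y1: "Y 1 \<le> decay_start TYPE('n) p q s t X"
  proof -
    have "Y (Suc 0) \<le> 2 * K * (2 ^ (0 + 2)) powr q * ((l 0 / k) powr p * (k / \<eta> 0))"
      using growth_level.level_bounds(2)[OF lev[of 0] S_sets[of "Suc 0"] _ \<eta>(1)[of 0] \<eta>(2)[of 0]] incl
      unfolding \<phi>eq voleq Xeq \<mu>eq Y_def[symmetric] K_def by blast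
    also have "l 0 / k = 2 * \<delta>" using k by (simp add: l_def)
    also have "k / \<eta> 0 = 2 / \<delta>" using k \<delta> by (simp add: \<eta>eq)
    also have "(2 * \<delta>) powr p * (2 / \<delta>) = 2 powr (p + 1) * \<delta> powr (p - 1)"
      using \<delta> by (simp add: powr_mult powr_add powr_diff)
    also have "2 * K * (2 ^ (0 + 2)) powr q * (2 powr (p + 1) * \<delta> powr (p - 1)) = K * b * (2 powr (p + 2) * \<delta> powr (p - 1))"
      by (simp add: b_def powr_add)
    also have "\<dots> \<le> C * (2 powr (p + 2) * \<delta> powr (p - 1))"
    proof (intro mult_right_mono)
      have "b \<le> 2 powr (4 * q)"
      proof -
        have "b = (2 powr 2) powr q" by (simp add: b_def)
        also have "\<dots> = 2 powr (2 * q)" by (rule powr_powr)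
        also have "\<dots> \<le> 2 powr (4 * q)" using pq by (intro powr_mono) auto
        finally show ?thesis .
      qed
      thus "K * b \<le> C" unfolding C(2) using K b by (intro mult_mono) auto
    qed auto
    also have "\<dots> \<le> decay_start TYPE('n) p q s t X" using start by (simp add: C_def mult_ac)
    finally show ?thesis by simp
  qed
  have lim: "(\<lambda>i. Y (Suc i)) \<longlonglongrightarrow> 0"
  proof (rule fast_geometric_decay[where C="C * b" and b=b and \<gamma>=\<gamma>])
    show "Y (Suc 0) \<le> (C * b) powr - (1 / \<gamma>) * b powr - (1 / \<gamma>\<^sup>2)"
      using Y1 by (simp add: decay_start_def C_def b_def \<gamma>_def)
    show "Y (Suc (Suc i)) \<le> C * b * b ^ i * Y (Suc i) powr (1 + \<gamma>)" for i
      using step[of "Suc i"] by (simp add: mult_ac)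
  qed (use C b \<gamma> Y0 in auto)
  define W where "W = {x \<in> kball \<xi>0 (\<rho> / 2). v x < \<delta> * k}"
  have WS: "W \<subseteq> S i" for i
  proof
    fix x assume x: "x \<in> W"
    hence "kern x \<xi>0 \<le> r (Suc i)" using r\<rho>(2)[of "Suc i"] by (simp add: W_def kball_def)
    hence "\<psi> i x = l i" using cutoff_eq_1[OF r\<rho>(3)[of i], of x \<xi>0] by (simp add: \<psi>_def)
    moreover have "\<delta> * k < l i" using \<delta> k pw[of i] by (simp add: l_def)
    moreover have "v x < \<delta> * k" using x by (simp add: W_def)
    ultimately have "testfn (\<psi> i) v x > 0" unfolding testfn_def using lpos(1)[of i] by linarith
    thus "x \<in> S i" by (simp add: S_def)
  qed
  have Wm: "W \<in> sets lebesgue"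
  proof -
    have "W = kball \<xi>0 (\<rho> / 2) \<inter> {x \<in> space lebesgue. v x < \<delta> * k}" by (auto simp: W_def)
    also have "\<dots> \<in> sets lebesgue" by measurable
    finally show ?thesis .
  qed
  have Wfm: "W \<in> lmeasurable" by (rule fmeasurableI2[OF S_fm WS Wm])
  have "measure lebesgue W \<le> vol * Y (Suc i)" for i
    using measure_mono_fmeasurable[OF WS[of "Suc i"] Wm S_fm] vol by (simp add: Y_def)
  moreover have "(\<lambda>i. vol * Y (Suc i)) \<longlonglongrightarrow> vol * 0" by (intro tendsto_mult_left lim)
  ultimately have "measure lebesgue W \<le> vol * 0" by (intro LIMSEQ_le_const) auto
  hence "measure lebesgue W = 0" using measure_nonneg[of lebesgue W] by linarith
  hence "emeasure lebesgue W = 0" using Wfm by (simp add: emeasure_eq_measure2)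
  hence "W \<in> null_sets lebesgue" using Wm by blast
  thus ?thesis by (rule AE_I') (auto simp: W_def)
qed

end

section \<open>Oscillation decay\<close>

lemma Jp_mult_sign: "e = 1 \<or> e = -1 \<Longrightarrow> Jp m (e * x) = e * Jp m x"
  using Jp_uminus[of m x] by auto

text \<open>The equation sees only increments, \<open>Jp\<close> is odd, and a constant is
  p-integrable on the bounded set. Hence the growth lemma applies both to u minus a lower bound and
  to an upper bound minus u.\<close>

lemma weak_solution_affine:
  fixes u :: "'n::finite heis \<Rightarrow> real"
  assumes pq: "1 < p" and \<Omega>: "open \<Omega>" "bounded \<Omega>" and u: "weak_solution p q s t a \<Omega> u" and e: "e = 1 \<or> e = -1"
  shows "weak_solution p q s t a \<Omega> (\<lambda>x. e * u x + d)"
proof -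
  have uA: "u \<in> Aspace p q s t a \<Omega>" using u by (simp add: weak_solution_iff)
  have um [measurable]: "u \<in> borel_measurable lebesgue" using uA unfolding Aspace_iff_hpair by auto
  have \<Omega>m [measurable]: "\<Omega> \<in> sets lebesgue" using \<Omega> by (simp add: borel_open)
  have diff: "(e * u x + d) - (e * u y + d) = e * (u x - u y)" for x y by (simp add: algebra_simps)
  have ab: "\<bar>e * z\<bar> = \<bar>z\<bar>" for z using e by auto
  have hp: "hpair p q s t a (\<lambda>x. e * u x + d) = hpair p q s t a u"
    by (intro ext) (simp only: hpair_def diff ab)
  have "(\<integral>\<^sup>+ x. indicator \<Omega> x * ennreal (\<bar>e * u x + d\<bar> powr p) \<partial>lebesgue)
    \<le> (\<integral>\<^sup>+ x. ennreal (2 powr p) * (indicator \<Omega> x * ennreal (\<bar>u x\<bar> powr p)) + ennreal (2 powr p * \<bar>d\<bar> powr p) * indicator \<Omega> x \<partial>lebesgue)"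
  proof (rule nn_integral_mono)
    fix x
    have "\<bar>e * u x + d\<bar> powr p \<le> (\<bar>u x\<bar> + \<bar>d\<bar>) powr p"
      using pq abs_triangle_ineq[of "e * u x" d] ab[of "u x"] by (intro powr_mono2) auto
    also have "\<dots> \<le> 2 powr p * (\<bar>u x\<bar> powr p + \<bar>d\<bar> powr p)" using pq by (intro powr_add_le) auto
    finally have "ennreal (\<bar>e * u x + d\<bar> powr p) \<le> ennreal (2 powr p * \<bar>u x\<bar> powr p + 2 powr p * \<bar>d\<bar> powr p)"
      by (intro ennreal_leI) (simp add: distrib_left)
    also have "\<dots> = ennreal (2 powr p) * ennreal (\<bar>u x\<bar> powr p) + ennreal (2 powr p * \<bar>d\<bar> powr p)"
      by (subst ennreal_plus) (simp_all add: ennreal_mult)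
    finally show "indicator \<Omega> x * ennreal (\<bar>e * u x + d\<bar> powr p)
      \<le> ennreal (2 powr p) * (indicator \<Omega> x * ennreal (\<bar>u x\<bar> powr p)) + ennreal (2 powr p * \<bar>d\<bar> powr p) * indicator \<Omega> x"
      by (simp add: indicator_def)
  qed
  also have "\<dots> = ennreal (2 powr p) * (\<integral>\<^sup>+ x. indicator \<Omega> x * ennreal (\<bar>u x\<bar> powr p) \<partial>lebesgue) + ennreal (2 powr p * \<bar>d\<bar> powr p) * emeasure lebesgue \<Omega>"
    by (subst nn_integral_add) (auto simp: nn_integral_cmult nn_integral_cmult_indicator)
  also have "\<dots> < \<infinity>"
  proof -
    have "\<Omega> \<in> lmeasurable" using \<Omega> by (simp add: lmeasurable_open)
    hence "emeasure lebesgue \<Omega> < top" unfolding fmeasurable_def infinity_ennreal_def by blast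
    moreover have "(\<integral>\<^sup>+ x. indicator \<Omega> x * ennreal (\<bar>u x\<bar> powr p) \<partial>lebesgue) < top"
      using uA unfolding Aspace_iff_hpair by simp
    ultimately show ?thesis
      by (simp only: ennreal_add_less_top ennreal_mult_less_top infinity_ennreal_def ennreal_less_top simp_thms)
  qed
  finally have fin: "(\<integral>\<^sup>+ x. indicator \<Omega> x * ennreal (\<bar>e * u x + d\<bar> powr p) \<partial>lebesgue) < \<infinity>" .
  have vA: "(\<lambda>x. e * u x + d) \<in> Aspace p q s t a \<Omega>"
    unfolding Aspace_iff_hpair hp using uA fin unfolding Aspace_iff_hpair by simp
  have fl: "flux_pair p q s t a (\<lambda>x. e * u x + d) \<phi> x y = e * flux_pair p q s t a u \<phi> x y" for \<phi> x y
    unfolding flux_pair_def diff Jp_mult_sign[OF e] by (simp add: algebra_simps)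
  have int: "(\<integral>z. indicator (CC \<Omega>) z * flux_pair p q s t a (\<lambda>x. e * u x + d) \<phi> (fst z) (snd z) \<partial>(lebesgue \<Otimes>\<^sub>M lebesgue))
     = e * (\<integral>z. indicator (CC \<Omega>) z * flux_pair p q s t a u \<phi> (fst z) (snd z) \<partial>(lebesgue \<Otimes>\<^sub>M lebesgue))" for \<phi>
    unfolding fl by (subst integral_mult_right_zero[symmetric]) (simp add: mult_ac)
  show ?thesis unfolding weak_solution_iff int using vA u by (simp add: weak_solution_iff)
qed

text \<open>Half of the decay of the kernel is spent on a growing factor, and the other half keeps
  the integral convergent. This is the origin of the half in the condition \<beta> (q - 1) \<le> s p
  / 2.\<close>

lemma kint_far_power:
  fixes \<xi>0 :: "'n::finite heis"
  assumes e: "e > 0" and d: "d > 0"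
  shows "(\<integral>\<^sup>+y. indicator {y. d \<le> kern y \<xi>0} y * ennreal ((kern y \<xi>0 / d) powr (e / 2) * Wt e \<xi>0 y) \<partial>lebesgue)
    \<le> ennreal (kint TYPE('n) (e / 2) * d powr - e)"
proof -
  let ?Q = "hdim TYPE('n)"
  have "(\<integral>\<^sup>+y. indicator {y. d \<le> kern y \<xi>0} y * ennreal ((kern y \<xi>0 / d) powr (e / 2) * Wt e \<xi>0 y) \<partial>lebesgue)
    = (\<integral>\<^sup>+y. ennreal (d powr - (e / 2)) * (indicator {y. d \<le> kern y \<xi>0} y * ennreal (1 / kern y \<xi>0 powr (?Q + e / 2))) \<partial>lebesgue)"
  proof (rule nn_integral_cong)
    fix y
    show "indicator {y. d \<le> kern y \<xi>0} y * ennreal ((kern y \<xi>0 / d) powr (e / 2) * Wt e \<xi>0 y)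
      = ennreal (d powr - (e / 2)) * (indicator {y. d \<le> kern y \<xi>0} y * ennreal (1 / kern y \<xi>0 powr (?Q + e / 2)))"
    proof (cases "d \<le> kern y \<xi>0")
      case True
      hence K: "kern y \<xi>0 > 0" using d by linarith
      have "kern y \<xi>0 powr (?Q + e) = kern y \<xi>0 powr (?Q + e / 2) * kern y \<xi>0 powr (e / 2)"
        by (subst powr_add[symmetric]) (simp add: add_ac)
      hence "(kern y \<xi>0 / d) powr (e / 2) * Wt e \<xi>0 y = d powr - (e / 2) * (1 / kern y \<xi>0 powr (?Q + e / 2))"
        using K d by (simp add: Wt_def kern_commute[of \<xi>0] powr_divide powr_minus_divide)
      hence "ennreal ((kern y \<xi>0 / d) powr (e / 2) * Wt e \<xi>0 y) = ennreal (d powr - (e / 2)) * ennreal (1 / kern y \<xi>0 powr (?Q + e / 2))"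
        using ennreal_mult[of "d powr - (e / 2)" "1 / kern y \<xi>0 powr (?Q + e / 2)"] by simp
      thus ?thesis using True by simp
    qed simp
  qed
  also have "\<dots> = ennreal (d powr - (e / 2)) * (\<integral>\<^sup>+y. indicator {y. d \<le> kern y \<xi>0} y * ennreal (1 / kern y \<xi>0 powr (?Q + e / 2)) \<partial>lebesgue)"
    by (rule nn_integral_cmult) measurable
  also have "\<dots> \<le> ennreal (d powr - (e / 2)) * ennreal (kint TYPE('n) (e / 2) * d powr - (e / 2))"
    using e d by (intro mult_left_mono nn_integral_kern_far) auto
  also have "\<dots> = ennreal (kint TYPE('n) (e / 2) * (d powr - (e / 2) * d powr - (e / 2)))"
    using kint_pos[where 'n='n, of "e / 2"] e by (simp add: ennreal_mult[symmetric] mult_ac)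
  also have "d powr - (e / 2) * d powr - (e / 2) = d powr - e"
    by (subst powr_add[symmetric]) simp
  finally show ?thesis .
qed

text \<open>In the iteration the bounds on successive annuli are rewritten as one power of the distance
  with exponent at most e / 2, so that no sum over annuli is needed.\<close>

lemma tail_estimate:
  fixes \<xi>0 :: "'n::finite heis" and w b u :: "'n heis \<Rightarrow> real"
  assumes e: "e > 0" and d: "d > 0" and m: "0 \<le> m" "m \<le> q" and W0: "W0 \<ge> 0"
    and u: "u \<in> borel_measurable lebesgue" and O: "Out \<in> sets lebesgue"
    and w: "AE y in lebesgue. d \<le> kern y \<xi>0 \<longrightarrow> 0 \<le> w y \<and> 0 \<le> b y \<and> w y \<le> b y + indicator Out y * \<bar>u y\<bar>
        \<and> b y powr m \<le> W0 * (kern y \<xi>0 / d) powr (e / 2)"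
    and out: "(\<integral>\<^sup>+y. indicator Out y * ennreal (\<bar>u y\<bar> powr m * Wt e \<xi>0 y) \<partial>lebesgue) \<le> ennreal I"
    and I: "I \<ge> 0"
  shows "(\<integral>\<^sup>+y. indicator (- kball \<xi>0 d) y * ennreal (w y powr m * Wt e \<xi>0 y) \<partial>lebesgue)
    \<le> ennreal (2 powr q * (W0 * (kint TYPE('n) (e / 2) * d powr - e) + I))"
proof -
  note [measurable] = u O
  define f1 where "f1 y = indicator {y. d \<le> kern y \<xi>0} y * ennreal ((kern y \<xi>0 / d) powr (e / 2) * Wt e \<xi>0 y)" for y
  define f2 where "f2 y = indicator Out y * ennreal (\<bar>u y\<bar> powr m * Wt e \<xi>0 y)" for y
  have [measurable]: "f1 \<in> borel_measurable lebesgue" "f2 \<in> borel_measurable lebesgue"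
    unfolding f1_def f2_def by measurable
  have "(\<integral>\<^sup>+y. indicator (- kball \<xi>0 d) y * ennreal (w y powr m * Wt e \<xi>0 y) \<partial>lebesgue)
    \<le> (\<integral>\<^sup>+y. ennreal (2 powr q) * (ennreal W0 * f1 y + f2 y) \<partial>lebesgue)"
  proof (rule nn_integral_mono_AE, use w in eventually_elim)
    fix y assume *: "d \<le> kern y \<xi>0 \<longrightarrow> 0 \<le> w y \<and> 0 \<le> b y \<and> w y \<le> b y + indicator Out y * \<bar>u y\<bar>
        \<and> b y powr m \<le> W0 * (kern y \<xi>0 / d) powr (e / 2)"
    show "indicator (- kball \<xi>0 d) y * ennreal (w y powr m * Wt e \<xi>0 y) \<le> ennreal (2 powr q) * (ennreal W0 * f1 y + f2 y)"
    proof (cases "d \<le> kern y \<xi>0")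
      case True
      define z where "z = (kern y \<xi>0 / d) powr (e / 2)"
      have "w y powr m \<le> (b y + indicator Out y * \<bar>u y\<bar>) powr m"
        using * True m by (intro powr_mono2) auto
      also have "\<dots> \<le> 2 powr m * (b y powr m + (indicator Out y * \<bar>u y\<bar>) powr m)"
        using * True m by (intro powr_add_le) (auto simp: indicator_def)
      also have "\<dots> \<le> 2 powr q * (W0 * z + indicator Out y * \<bar>u y\<bar> powr m)"
        using * True m by (intro mult_mono powr_mono add_mono) (auto simp: indicator_def z_def)
      finally have "w y powr m * Wt e \<xi>0 y \<le> 2 powr q * (W0 * z + indicator Out y * \<bar>u y\<bar> powr m) * Wt e \<xi>0 y"
        by (rule mult_right_mono) simp
      hence "ennreal (w y powr m * Wt e \<xi>0 y) \<le> ennreal (2 powr q * (W0 * (z * Wt e \<xi>0 y) + indicator Out y * (\<bar>u y\<bar> powr m * Wt e \<xi>0 y)))"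
        by (intro ennreal_leI) (simp add: algebra_simps)
      also have "\<dots> = ennreal (2 powr q) * (ennreal (W0 * (z * Wt e \<xi>0 y)) + ennreal (indicator Out y * (\<bar>u y\<bar> powr m * Wt e \<xi>0 y)))"
        using W0 by (subst ennreal_plus[symmetric]) (simp_all add: z_def ennreal_mult)
      also have "ennreal (W0 * (z * Wt e \<xi>0 y)) = ennreal W0 * f1 y"
        using W0 True by (simp add: f1_def z_def ennreal_mult)
      also have "ennreal (indicator Out y * (\<bar>u y\<bar> powr m * Wt e \<xi>0 y)) = f2 y"
        by (simp add: f2_def indicator_def)
      finally show ?thesis using True by (simp add: kball_def)
    qed (simp add: kball_def)
  qed
  also have "\<dots> = ennreal (2 powr q) * (ennreal W0 * (\<integral>\<^sup>+y. f1 y \<partial>lebesgue) + (\<integral>\<^sup>+y. f2 y \<partial>lebesgue))"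
    by (simp add: nn_integral_cmult nn_integral_add)
  also have "\<dots> \<le> ennreal (2 powr q) * (ennreal W0 * ennreal (kint TYPE('n) (e / 2) * d powr - e) + ennreal I)"
    using kint_far_power[OF e d, of \<xi>0] out unfolding f1_def[symmetric] f2_def[symmetric]
    by (intro mult_left_mono add_mono) auto
  also have "\<dots> = ennreal (2 powr q * (W0 * (kint TYPE('n) (e / 2) * d powr - e) + I))"
    using W0 I kint_pos[where 'n='n, of "e / 2"] e by (simp add: ennreal_mult ennreal_plus)
  finally show ?thesis .
qed

text \<open>The powers of 4 come from the bound 4 \<omega> j in \<open>step_tails\<close>, the outer
  2^q from splitting powers of sums, and 1 + \<Lambda>^(q-p) from measuring the power q - 1 on the
  scale of the p-phase. The summands 2 and 1 count the integrals over the complement of the first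
  ball.\<close>

definition tail_const :: "'n::finite itself \<Rightarrow> real \<Rightarrow> real \<Rightarrow> real \<Rightarrow> real \<Rightarrow> real \<Rightarrow> real" where
  "tail_const _ p q s t \<Lambda> = 2 powr q * ((1 + \<Lambda> powr (q - p)) * 4 powr (p - 1) * kint TYPE('n) (s * p / 2) + 2)
     + 2 powr q * (4 powr (q - 1) * kint TYPE('n) (t * q / 2) + 1)"

text \<open>M is the bound on u that the constants may depend on, S0 the supremum on the first ball,
  which enters \<omega>0. The ratio of the two radii in a growth step is \<theta>. The next
  Carnot-Caratheodory ball lies in the gauge ball of radius 2 \<sigma> \<open>rr j\<close>, which
  must fit into radius \<theta> R / 2 with R = \<open>rr j / 5\<close>; this requires \<sigma> \<le>
  \<theta> / 20.\<close>

locale osc_decay = double_phase p q s t \<alpha> La Ha a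
  for p q s t \<alpha> La Ha :: real and a :: "'n::finite heis \<Rightarrow> 'n heis \<Rightarrow> real" +
  fixes \<Omega> :: "'n heis set" and u :: "'n heis \<Rightarrow> real" and \<xi>0 :: "'n heis"
    and r M S0 \<omega>0 \<theta> \<sigma> \<beta> \<delta> \<Lambda> :: real
  assumes \<Omega>: "open \<Omega>" "bounded \<Omega>" and u: "weak_solution p q s t a \<Omega> u"
    and hb: "hball \<xi>0 r \<subseteq> \<Omega>" and r: "0 < r" "r \<le> 1"
    and M: "AE x in lebesgue. x \<in> hball \<xi>0 r \<longrightarrow> \<bar>u x\<bar> \<le> M"
    and S0: "AE x in lebesgue. x \<in> hball \<xi>0 r \<longrightarrow> \<bar>u x\<bar> \<le> S0" "0 \<le> S0" "S0 \<le> M" "2 * S0 \<le> \<omega>0"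
    and out1: "(\<integral>\<^sup>+y. indicator (- hball \<xi>0 r) y * ennreal (\<bar>u y\<bar> powr (p - 1) * Wt (s * p) \<xi>0 y) \<partial>lebesgue) \<le> ennreal (r powr - (s * p) * \<omega>0 powr (p - 1))"
    and out2: "(\<integral>\<^sup>+y. indicator (- hball \<xi>0 r) y * ennreal (\<bar>u y\<bar> powr (q - 1) * Wt (s * p) \<xi>0 y) \<partial>lebesgue) \<le> ennreal (r powr - (s * p) * \<omega>0 powr (p - 1))"
    and out3: "(\<integral>\<^sup>+y. indicator (- hball \<xi>0 r) y * ennreal (\<bar>u y\<bar> powr (q - 1) * Wt (t * q) \<xi>0 y) \<partial>lebesgue) \<le> ennreal (r powr - (t * q) * \<omega>0 powr (q - 1))"
    and \<Lambda>: "4 * M \<le> \<Lambda>" "0 < \<Lambda>"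
    and \<theta>: "0 < \<theta>" "\<theta> \<le> 1/4" "tail_const TYPE('n) p q s t \<Lambda> * 2 powr q * \<theta> powr (s * p) \<le> tail_threshold TYPE('n) q t La Ha"
    and \<delta>: "0 < \<delta>" "\<delta> \<le> 1/4"
      "growth_const TYPE('n) p q s t (4 * Ha * ((1 / \<theta>) powr \<alpha> * \<Lambda> powr (q - p))) * 2 powr (p + 2) * \<delta> powr (p - 1)
        \<le> decay_start TYPE('n) p q s t (4 * Ha * ((1 / \<theta>) powr \<alpha> * \<Lambda> powr (q - p)))"
    and \<sigma>: "0 < \<sigma>" "\<sigma> \<le> \<theta> / 20"
    and \<beta>: "0 < \<beta>" "\<beta> * (q - 1) \<le> s * p / 2" "1 - \<delta> / 2 \<le> \<sigma> powr \<beta>"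
begin

definition \<kappa> :: real where "\<kappa> = \<sigma> powr \<beta>"
definition rr :: "nat \<Rightarrow> real" where "rr j = \<sigma> ^ j * r"
definition \<omega> :: "nat \<Rightarrow> real" where "\<omega> j = \<kappa> ^ j * \<omega>0"

lemma \<kappa>: "1/2 \<le> \<kappa>" "0 < \<kappa>" "\<kappa> < 1"
proof -
  show "1/2 \<le> \<kappa>" using \<beta>(3) \<delta> unfolding \<kappa>_def by linarith
  thus "0 < \<kappa>" by linarith
  have "\<sigma> < 1" using \<sigma> \<theta> by linarith
  thus "\<kappa> < 1" unfolding \<kappa>_def using \<sigma> \<beta> powr_less_mono2[of \<beta> \<sigma> 1] by simp
qed

lemma \<sigma>_lt_1: "\<sigma> < 1" using \<sigma> \<theta> by linarith

lemma \<omega>0_nonneg: "0 \<le> \<omega>0" using S0 by linarith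

lemma \<omega>_nonneg: "0 \<le> \<omega> j" using \<kappa> \<omega>0_nonneg by (simp add: \<omega>_def)

lemma rr_pos: "0 < rr j" "rr j \<le> r" "rr j \<le> 1"
proof -
  show "0 < rr j" using \<sigma> r by (simp add: rr_def)
  have "\<sigma> ^ j \<le> 1" using \<sigma> \<sigma>_lt_1 by (intro power_le_one) auto
  thus "rr j \<le> r" using r by (simp add: rr_def mult_left_le_one_le)
  thus "rr j \<le> 1" using r by simp
qed

lemma hball_rr_mono: "hball \<xi>0 (rr j) \<subseteq> hball \<xi>0 r"
  using rr_pos(2)[of j] by (auto simp: hball_def)

lemma u_measurable [measurable]: "u \<in> borel_measurable lebesgue"
  using u unfolding weak_solution_iff Aspace_iff_hpair by auto

lemma hball_sets [measurable]: "hball \<xi>0 d \<in> sets lebesgue"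
  using open_hball[of \<xi>0 d] by (simp add: borel_open)

text \<open>Radii shrink by \<sigma> and oscillation bounds by \<sigma>^\<beta>, so the bound that
  belongs to a ball missing y is at most \<omega> j times the power \<beta> of the relative distance
  of y.\<close>

lemma kern_ratio:
  assumes "\<sigma> ^ n * r / 5 \<le> kern y \<xi>0"
  shows "\<kappa> ^ n * \<omega>0 \<le> \<omega> j * (kern y \<xi>0 / (rr j / 5)) powr \<beta>"
proof -
  have "\<sigma> ^ n / \<sigma> ^ j = (\<sigma> ^ n * r / 5) / (rr j / 5)" using r by (simp add: rr_def)
  also have "\<dots> \<le> kern y \<xi>0 / (rr j / 5)" using assms rr_pos[of j] by (intro divide_right_mono) auto
  finally have "(\<sigma> ^ n / \<sigma> ^ j) powr \<beta> \<le> (kern y \<xi>0 / (rr j / 5)) powr \<beta>"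
    using \<sigma> \<beta> by (intro powr_mono2) auto
  moreover have "(\<sigma> ^ n / \<sigma> ^ j) powr \<beta> = \<kappa> ^ n / \<kappa> ^ j"
  proof -
    have "(\<sigma> ^ i) powr \<beta> = \<kappa> ^ i" for i
      using \<sigma> by (simp add: \<kappa>_def powr_realpow[symmetric] powr_powr powr_power mult.commute)
    thus ?thesis using \<sigma> by (simp add: powr_divide)
  qed
  ultimately have "\<omega> j * (\<kappa> ^ n / \<kappa> ^ j) \<le> \<omega> j * (kern y \<xi>0 / (rr j / 5)) powr \<beta>"
    using \<omega>_nonneg by (intro mult_left_mono) auto
  thus ?thesis using \<kappa> by (simp add: \<omega>_def mult.commute)
qed

text \<open>When the radius shrinks, the admissible size \<omega>^m r^(-e) of a tail does not
  decrease, because \<beta> m \<le> e. So the tail of u outside the first ball, controlled by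
  \<omega>0, remains admissible at every later scale.\<close>

lemma out_scale:
  assumes "0 \<le> m" "\<beta> * m \<le> e"
  shows "r powr - e * \<omega>0 powr m \<le> \<omega> j powr m * (rr j / 5) powr - e"
proof -
  have e: "0 \<le> e" using assms \<beta> by (meson mult_nonneg_nonneg less_imp_le order_trans)
  have "\<sigma> powr e \<le> \<sigma> powr (\<beta> * m)" using \<sigma> \<sigma>_lt_1 assms by (intro powr_mono') auto
  hence "\<sigma> powr e \<le> \<kappa> powr m" by (simp add: \<kappa>_def powr_powr)
  hence "(\<sigma> powr e) ^ j \<le> (\<kappa> powr m) ^ j" by (intro power_mono) auto
  moreover have "(\<sigma> powr e) ^ j = (\<sigma> ^ j) powr e" "(\<kappa> powr m) ^ j = (\<kappa> ^ j) powr m"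
    using \<sigma> \<kappa> by (simp_all add: powr_realpow[symmetric] powr_powr powr_power mult.commute)
  ultimately have 1: "(\<sigma> ^ j) powr e \<le> (\<kappa> ^ j) powr m" by simp
  have "1 = (\<sigma> ^ j) powr e * (\<sigma> ^ j) powr - e" using \<sigma> by (simp add: powr_minus)
  also have "\<dots> \<le> (\<kappa> ^ j) powr m * (\<sigma> ^ j) powr - e" by (intro mult_right_mono 1) simp
  finally have 2: "1 \<le> (\<kappa> ^ j) powr m * (\<sigma> ^ j) powr - e" .
  have "r powr - e * \<omega>0 powr m \<le> (\<kappa> ^ j) powr m * (\<sigma> ^ j) powr - e * (r powr - e * \<omega>0 powr m)"
    using mult_right_mono[OF 2, of "r powr - e * \<omega>0 powr m"] by simp
  also have "\<dots> = \<omega> j powr m * (rr j) powr - e"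
    using \<kappa> \<omega>0_nonneg \<sigma> r by (simp add: \<omega>_def rr_def powr_mult mult_ac)
  also have "\<dots> \<le> \<omega> j powr m * (rr j / 5) powr - e"
    using rr_pos[of j] e by (intro mult_left_mono powr_mono2') auto
  finally show ?thesis .
qed

lemma step_tails:
  fixes v :: "'n heis \<Rightarrow> real" and j :: nat
  defines "k \<equiv> \<omega> j / 2" and "R \<equiv> rr j / 5"
  assumes [measurable]: "v \<in> borel_measurable lebesgue"
    and v1: "AE y in lebesgue. \<forall>i\<le>j. y \<in> hball \<xi>0 (rr i) \<longrightarrow> - v y \<le> \<omega> i"
    and v2: "AE y in lebesgue. - v y \<le> S0 + \<bar>u y\<bar>"
    and v3: "AE y in lebesgue. y \<in> hball \<xi>0 (rr j) \<longrightarrow> 0 \<le> v y"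
    and \<omega>j: "\<omega> j \<le> 4 * M"
  shows "(\<integral>\<^sup>+y. indicator (- kball \<xi>0 R) y * ennreal (((k + max 0 (- v y)) powr (p - 1)
        + (k + max 0 (- v y)) powr (q - 1)) * Wt (s * p) \<xi>0 y) \<partial>lebesgue)
        \<le> ennreal (tail_threshold TYPE('n) q t La Ha * (k powr (p - 1) * (\<theta> * R) powr - (s * p)))" (is "?I1 \<le> _")
    and "(\<integral>\<^sup>+y. indicator (- kball \<xi>0 R) y * ennreal ((k + max 0 (- v y)) powr (q - 1) * Wt (t * q) \<xi>0 y) \<partial>lebesgue)
        \<le> ennreal (tail_threshold TYPE('n) q t La Ha * (k powr (q - 1) * (\<theta> * R) powr - (t * q)))" (is "?I2 \<le> _")
proof -
  define w where "w y = k + max 0 (- v y)" for y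
  \<comment> \<open>Outside the first ball u is known only through its tail integrals. There |u| is
    split off, and only the constant k + S0 remains to be compared with a power of the
    distance.\<close>
  define b where "b y = (if y \<in> hball \<xi>0 r then w y else k + S0)" for y
  define W where "W = 4 * \<omega> j"
  have k0: "0 \<le> k" using \<omega>_nonneg by (simp add: k_def)
  have R: "0 < R" using rr_pos by (simp add: R_def)
  have W: "0 \<le> W" using \<omega>_nonneg by (simp add: W_def)
  have M0: "0 \<le> M" using S0 by simp
  have [measurable]: "w \<in> borel_measurable lebesgue" unfolding w_def by measurable
  have Out: "- hball \<xi>0 r \<in> sets lebesgue" using sets.compl_sets[OF hball_sets[of r]] by (simp add: Compl_eq_Diff_UNIV)
  have main: "AE y in lebesgue. R \<le> kern y \<xi>0 \<longrightarrow> 0 \<le> w y \<and> 0 \<le> b y \<and> w y \<le> b y + indicator (- hball \<xi>0 r) y * \<bar>u y\<bar>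
      \<and> b y \<le> W * (kern y \<xi>0 / R) powr \<beta> \<and> b y \<le> \<Lambda>"
    using v1 v2 v3 M
  proof eventually_elim
    case (elim y)
    show ?case
    proof (intro impI conjI)
      assume y: "R \<le> kern y \<xi>0"
      define z where "z = (kern y \<xi>0 / R) powr \<beta>"
      have z: "1 \<le> z" unfolding z_def using y R \<beta> by (intro ge_one_powr_ge_zero) auto
      show w0: "0 \<le> w y" using k0 by (simp add: w_def)
      show "0 \<le> b y" using w0 k0 S0 by (simp add: b_def)
      show "w y \<le> b y + indicator (- hball \<xi>0 r) y * \<bar>u y\<bar>"
        using elim(2) S0 by (simp add: b_def w_def)
      have kz: "k \<le> \<omega> j * z" using mult_left_mono[OF z \<omega>_nonneg[of j]] \<omega>_nonneg[of j] by (simp add: k_def)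
      have kM: "k \<le> 2 * M" using \<omega>j by (simp add: k_def)
      have ratio: "\<kappa> ^ n * \<omega>0 \<le> \<omega> j * z" if "y \<notin> hball \<xi>0 (\<sigma> ^ n * r)" for n
      proof -
        have "y \<notin> kball \<xi>0 (\<sigma> ^ n * r / 5)" using that kball_subset_hball by blast
        hence "\<sigma> ^ n * r / 5 \<le> kern y \<xi>0" by (simp add: kball_def)
        thus ?thesis using kern_ratio[of n y j] by (simp add: z_def R_def)
      qed
      have "b y \<le> 4 * (\<omega> j * z) \<and> b y \<le> \<Lambda>"
      proof (cases "y \<in> hball \<xi>0 r")
        case False
        have "\<omega>0 \<le> \<omega> j * z" using ratio[of 0] False by simp
        hence "b y \<le> 4 * (\<omega> j * z)" using False kz S0 by (simp add: b_def)
        moreover have "b y \<le> \<Lambda>" using False kM S0 \<Lambda> M0 by (simp add: b_def)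
        ultimately show ?thesis ..
      next
        case yr: True
        have "b y = w y" using yr by (simp add: b_def)
        moreover have "w y \<le> \<Lambda>"
        proof -
          have "\<bar>u y\<bar> \<le> M" using elim(4) yr by simp
          hence "max 0 (- v y) \<le> 2 * M" using elim(2) S0 M0 by linarith
          thus ?thesis using kM \<Lambda> unfolding w_def by linarith
        qed
        moreover have "w y \<le> 4 * (\<omega> j * z)"
        proof (cases "y \<in> hball \<xi>0 (rr j)")
          case True
          hence "w y = k" using elim(3) by (simp add: w_def)
          thus ?thesis using kz k0 by simp
        next
          case False
          \<comment> \<open>The first ball that misses y. Missing it bounds the distance of y from
            below, while y still lies in the preceding ball, where v is bounded through \<omega> i.
            The condition \<kappa> \<ge> 1/2 bridges the two indices at the cost of a factor
            2.\<close>
          define n where "n = (LEAST n. y \<notin> hball \<xi>0 (rr n))"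
          have n: "y \<notin> hball \<xi>0 (rr n)" unfolding n_def using False by (rule LeastI)
          have nj: "n \<le> j" unfolding n_def using False by (rule Least_le)
          have "n \<noteq> 0" using n yr by (intro notI) (simp add: rr_def)
          then obtain i where i: "n = Suc i" by (cases n) auto
          hence "y \<in> hball \<xi>0 (rr i)" using not_less_Least[of i "\<lambda>n. y \<notin> hball \<xi>0 (rr n)"] unfolding n_def by auto
          hence "- v y \<le> \<omega> i" using elim(1) nj i by simp
          moreover have "\<kappa> * \<omega> i \<le> \<omega> j * z"
            using ratio[of n] n unfolding i rr_def \<omega>_def by (simp add: mult_ac)
          hence "\<omega> i \<le> 2 * (\<omega> j * z)"
            using mult_right_mono[OF \<kappa>(1) \<omega>_nonneg[of i]] by linarith
          ultimately have "max 0 (- v y) \<le> 2 * (\<omega> j * z)" using \<omega>_nonneg[of i] by linarith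
          moreover have "0 \<le> \<omega> j * z" using \<omega>_nonneg z by simp
          ultimately show ?thesis using kz unfolding w_def by linarith
        qed
        ultimately show ?thesis by simp
      qed
      thus "b y \<le> W * (kern y \<xi>0 / R) powr \<beta>" "b y \<le> \<Lambda>" by (simp_all add: W_def z_def)
    qed
  qed
  have zpow: "((kern y \<xi>0 / R) powr \<beta>) powr m \<le> (kern y \<xi>0 / R) powr (e / 2)" if "R \<le> kern y \<xi>0" "\<beta> * m \<le> e / 2" for y m e
  proof -
    have "1 \<le> kern y \<xi>0 / R" using that R by simp
    thus ?thesis using that by (simp add: powr_powr powr_mono)
  qed
  have bp: "b y powr m \<le> W powr m * (kern y \<xi>0 / R) powr (e / 2)"
    if "R \<le> kern y \<xi>0" "0 \<le> b y" "b y \<le> W * (kern y \<xi>0 / R) powr \<beta>" "0 \<le> m" "\<beta> * m \<le> e / 2" for y m e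
  proof -
    have "b y powr m \<le> (W * (kern y \<xi>0 / R) powr \<beta>) powr m" using that by (intro powr_mono2) auto
    also have "\<dots> = W powr m * ((kern y \<xi>0 / R) powr \<beta>) powr m" using W by (simp add: powr_mult)
    also have "\<dots> \<le> W powr m * (kern y \<xi>0 / R) powr (e / 2)" using that by (intro mult_left_mono zpow) auto
    finally show ?thesis .
  qed
  have \<beta>p: "\<beta> * (p - 1) \<le> s * p / 2"
  proof -
    have "\<beta> * (p - 1) \<le> \<beta> * (q - 1)" using \<beta> pq by (intro mult_left_mono) auto
    thus ?thesis using \<beta> by linarith
  qed
  have \<beta>q: "\<beta> * (q - 1) \<le> t * q / 2" using \<beta> exponents by linarith
  have \<beta>': "\<beta> * (p - 1) \<le> s * p" "\<beta> * (q - 1) \<le> t * q" using \<beta>p \<beta>q exponents by linarith+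
  let ?h = "indicator (- kball \<xi>0 R)"
  have T1: "(\<integral>\<^sup>+y. ?h y * ennreal (w y powr (p - 1) * Wt (s * p) \<xi>0 y) \<partial>lebesgue)
    \<le> ennreal (2 powr q * (W powr (p - 1) * (kint TYPE('n) (s * p / 2) * R powr - (s * p)) + r powr - (s * p) * \<omega>0 powr (p - 1)))"
  proof (rule tail_estimate[where b=b and u=u and Out="- hball \<xi>0 r"])
    show "AE y in lebesgue. R \<le> kern y \<xi>0 \<longrightarrow> 0 \<le> w y \<and> 0 \<le> b y \<and> w y \<le> b y + indicator (- hball \<xi>0 r) y * \<bar>u y\<bar>
        \<and> b y powr (p - 1) \<le> W powr (p - 1) * (kern y \<xi>0 / R) powr (s * p / 2)"
      using main by eventually_elim (use pq \<beta>p bp in auto)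
  qed (use exponents R pq W out1 Out in auto)
  \<comment> \<open>The power q - 1 has to be compared with \<omega> j to the power p - 1. The
    surplus power q - p is bounded by \<Lambda>, which is where b \<le> \<Lambda> and hence \<omega>
    j \<le> 4 M are used.\<close>
  have T2: "(\<integral>\<^sup>+y. ?h y * ennreal (w y powr (q - 1) * Wt (s * p) \<xi>0 y) \<partial>lebesgue)
    \<le> ennreal (2 powr q * (\<Lambda> powr (q - p) * W powr (p - 1) * (kint TYPE('n) (s * p / 2) * R powr - (s * p)) + r powr - (s * p) * \<omega>0 powr (p - 1)))"
  proof (rule tail_estimate[where b=b and u=u and Out="- hball \<xi>0 r"])
    show "AE y in lebesgue. R \<le> kern y \<xi>0 \<longrightarrow> 0 \<le> w y \<and> 0 \<le> b y \<and> w y \<le> b y + indicator (- hball \<xi>0 r) y * \<bar>u y\<bar>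
        \<and> b y powr (q - 1) \<le> \<Lambda> powr (q - p) * W powr (p - 1) * (kern y \<xi>0 / R) powr (s * p / 2)"
      using main
    proof eventually_elim
      case (elim y)
      have "b y powr (q - 1) \<le> \<Lambda> powr (q - p) * W powr (p - 1) * (kern y \<xi>0 / R) powr (s * p / 2)" if y: "R \<le> kern y \<xi>0"
      proof -
        have *: "0 \<le> b y" "b y \<le> \<Lambda>" "b y \<le> W * (kern y \<xi>0 / R) powr \<beta>" using elim y by auto
        have "b y powr (q - 1) = b y powr (q - p) * b y powr (p - 1)" by (subst powr_add[symmetric]) simp
        also have "\<dots> \<le> \<Lambda> powr (q - p) * (W powr (p - 1) * (kern y \<xi>0 / R) powr (s * p / 2))"
          using * pq \<beta>p y by (intro mult_mono powr_mono2 bp) auto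
        finally show ?thesis by (simp add: mult.assoc)
      qed
      thus ?case using elim by blast
    qed
  qed (use exponents R pq W out2 Out in auto)
  have T3: "(\<integral>\<^sup>+y. ?h y * ennreal (w y powr (q - 1) * Wt (t * q) \<xi>0 y) \<partial>lebesgue)
    \<le> ennreal (2 powr q * (W powr (q - 1) * (kint TYPE('n) (t * q / 2) * R powr - (t * q)) + r powr - (t * q) * \<omega>0 powr (q - 1)))"
  proof (rule tail_estimate[where b=b and u=u and Out="- hball \<xi>0 r"])
    show "AE y in lebesgue. R \<le> kern y \<xi>0 \<longrightarrow> 0 \<le> w y \<and> 0 \<le> b y \<and> w y \<le> b y + indicator (- hball \<xi>0 r) y * \<bar>u y\<bar>
        \<and> b y powr (q - 1) \<le> W powr (q - 1) * (kern y \<xi>0 / R) powr (t * q / 2)"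
      using main by eventually_elim (use pq \<beta>q bp in auto)
  qed (use exponents R pq W out3 Out in auto)
  define C1 where "C1 = 2 powr q * ((1 + \<Lambda> powr (q - p)) * 4 powr (p - 1) * kint TYPE('n) (s * p / 2) + 2)"
  define C2 where "C2 = 2 powr q * (4 powr (q - 1) * kint TYPE('n) (t * q / 2) + 1)"
  have C: "C1 \<ge> 0" "C2 \<ge> 0"
    using kint_pos[where 'n='n, of "s * p / 2"] kint_pos[where 'n='n, of "t * q / 2"] exponents by (auto simp: C1_def C2_def)
  have tC: "tail_const TYPE('n) p q s t \<Lambda> = C1 + C2" by (simp add: tail_const_def C1_def C2_def)
  have W4: "W powr m = 4 powr m * \<omega> j powr m" for m unfolding W_def using \<omega>_nonneg[of j] by (simp add: powr_mult)
  \<comment> \<open>Measuring the tail at radius \<theta> R instead of R gains \<theta>^e, at most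
    \<theta>^(sp); the choice of \<theta> makes this gain beat all constants. The factor 2^m
    converts \<omega> j into k.\<close>
  have fin: "C' * (\<omega> j powr m * R powr - e) \<le> tail_threshold TYPE('n) q t La Ha * (k powr m * (\<theta> * R) powr - e)"
    if C': "0 \<le> C'" "C' \<le> tail_const TYPE('n) p q s t \<Lambda>" and m: "0 \<le> m" "m \<le> q" and e: "s * p \<le> e" for C' m e
  proof -
    have "\<theta> powr e \<le> \<theta> powr (s * p)" using \<theta> e by (intro powr_mono') auto
    moreover have "2 powr m \<le> 2 powr q" using m by (intro powr_mono) auto
    ultimately have "C' * 2 powr m * \<theta> powr e \<le> tail_const TYPE('n) p q s t \<Lambda> * 2 powr q * \<theta> powr (s * p)"
      using C' by (intro mult_mono) auto
    also note \<theta>(3)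
    finally have "(C' * 2 powr m * \<theta> powr e) * (k powr m * (\<theta> * R) powr - e) \<le> tail_threshold TYPE('n) q t La Ha * (k powr m * (\<theta> * R) powr - e)"
      by (rule mult_right_mono) simp
    moreover have "(C' * 2 powr m * \<theta> powr e) * (k powr m * (\<theta> * R) powr - e) = C' * (\<omega> j powr m * R powr - e)"
    proof -
      have "\<theta> powr e * \<theta> powr - e = 1" using \<theta> by (simp add: powr_minus)
      moreover have "2 powr m * k powr m = \<omega> j powr m" using \<omega>_nonneg[of j] by (simp add: k_def powr_divide)
      moreover have "(\<theta> * R) powr - e = \<theta> powr - e * R powr - e" using \<theta> R by (simp add: powr_mult)
      ultimately show ?thesis by algebra
    qed
    ultimately show ?thesis by simp
  qed
  have m1: "(\<lambda>y. ?h y * ennreal (w y powr m * Wt e \<xi>0 y)) \<in> borel_measurable lebesgue" for m e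
    by measurable
  have "?I1 = (\<integral>\<^sup>+y. ?h y * ennreal (w y powr (p - 1) * Wt (s * p) \<xi>0 y) + ?h y * ennreal (w y powr (q - 1) * Wt (s * p) \<xi>0 y) \<partial>lebesgue)"
    unfolding w_def[symmetric] distrib_right by (intro nn_integral_cong) (simp add: ennreal_plus distrib_left)
  also have "\<dots> = (\<integral>\<^sup>+y. ?h y * ennreal (w y powr (p - 1) * Wt (s * p) \<xi>0 y) \<partial>lebesgue) + (\<integral>\<^sup>+y. ?h y * ennreal (w y powr (q - 1) * Wt (s * p) \<xi>0 y) \<partial>lebesgue)"
    by (rule nn_integral_add[OF m1 m1])
  also have "\<dots> \<le> ennreal (2 powr q * (W powr (p - 1) * (kint TYPE('n) (s * p / 2) * R powr - (s * p)) + r powr - (s * p) * \<omega>0 powr (p - 1)))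
     + ennreal (2 powr q * (\<Lambda> powr (q - p) * W powr (p - 1) * (kint TYPE('n) (s * p / 2) * R powr - (s * p)) + r powr - (s * p) * \<omega>0 powr (p - 1)))"
    by (intro add_mono T1 T2)
  also have "\<dots> = ennreal (2 powr q * ((1 + \<Lambda> powr (q - p)) * W powr (p - 1) * (kint TYPE('n) (s * p / 2) * R powr - (s * p)) + 2 * (r powr - (s * p) * \<omega>0 powr (p - 1))))"
    using kint_pos[where 'n='n, of "s * p / 2"] exponents
    by (subst ennreal_plus[symmetric]) (auto simp: algebra_simps)
  also have "\<dots> \<le> ennreal (2 powr q * ((1 + \<Lambda> powr (q - p)) * W powr (p - 1) * (kint TYPE('n) (s * p / 2) * R powr - (s * p)) + 2 * (\<omega> j powr (p - 1) * R powr - (s * p))))"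
    unfolding R_def using pq by (intro ennreal_leI mult_left_mono add_left_mono out_scale \<beta>') auto
  also have "\<dots> = ennreal (C1 * (\<omega> j powr (p - 1) * R powr - (s * p)))"
    unfolding W4 C1_def by (simp add: algebra_simps)
  also have "\<dots> \<le> ennreal (tail_threshold TYPE('n) q t La Ha * (k powr (p - 1) * (\<theta> * R) powr - (s * p)))"
    using C pq by (intro ennreal_leI fin) (auto simp: tC)
  finally show "?I1 \<le> ennreal (tail_threshold TYPE('n) q t La Ha * (k powr (p - 1) * (\<theta> * R) powr - (s * p)))" .
  have "?I2 \<le> ennreal (2 powr q * (W powr (q - 1) * (kint TYPE('n) (t * q / 2) * R powr - (t * q)) + r powr - (t * q) * \<omega>0 powr (q - 1)))"
    using T3 unfolding w_def .
  also have "\<dots> \<le> ennreal (2 powr q * (W powr (q - 1) * (kint TYPE('n) (t * q / 2) * R powr - (t * q)) + \<omega> j powr (q - 1) * R powr - (t * q)))"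
    unfolding R_def using pq by (intro ennreal_leI mult_left_mono add_left_mono out_scale \<beta>') auto
  also have "\<dots> = ennreal (C2 * (\<omega> j powr (q - 1) * R powr - (t * q)))"
    unfolding W4 C2_def by (simp add: algebra_simps)
  also have "\<dots> \<le> ennreal (tail_threshold TYPE('n) q t La Ha * (k powr (q - 1) * (\<theta> * R) powr - (t * q)))"
    using C pq exponents by (intro ennreal_leI fin) (auto simp: tC)
  finally show "?I2 \<le> ennreal (tail_threshold TYPE('n) q t La Ha * (k powr (q - 1) * (\<theta> * R) powr - (t * q)))" .
qed

end

section \<open>Induction over the shrinking balls\<close>

lemma AE_kball_witness:
  assumes "AE y in lebesgue. P y" "d > 0" shows "\<exists>y\<in>kball (\<xi>::'n::finite heis) d. P y"
proof (rule ccontr)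
  assume "\<not> ?thesis"
  hence "AE y in lebesgue. y \<notin> kball \<xi> d" using assms(1) by (auto elim: eventually_mono)
  hence "emeasure lebesgue (kball \<xi> d) = 0"
    by (subst (asm) AE_iff_measurable[OF sets_kball]) auto
  moreover have "0 < ennreal (2 * kvol TYPE('n) * (d / 2) powr hdim TYPE('n))"
    using assms kvol_pos[where 'n='n] by simp
  ultimately show False using emeasure_kball_ge[of "d / 2" \<xi>] assms(2) by simp
qed

context osc_decay
begin

lemma hball_rr_antimono: "i \<le> j \<Longrightarrow> hball \<xi>0 (rr j) \<subseteq> hball \<xi>0 (rr i)"
proof -
  assume "i \<le> j"
  hence "rr j \<le> rr i" using \<sigma> \<sigma>_lt_1 r by (simp add: rr_def mult_right_mono power_decreasing)
  thus ?thesis by (auto simp: hball_def)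
qed

lemma AE_hball_witness:
  assumes "AE y in lebesgue. P y" shows "\<exists>y\<in>hball \<xi>0 (rr j). P y"
  using AE_kball_witness[OF assms, of "rr j / 5" \<xi>0] rr_pos[of j] kball_subset_hball[of \<xi>0 "rr j"] by auto

lemma growth_step:
  fixes e d :: real and j :: nat
  assumes e: "e = 1 \<or> e = -1" and \<omega>j: "0 < \<omega> j" "\<omega> j \<le> 4 * M"
    and v1: "AE y in lebesgue. \<forall>i\<le>j. y \<in> hball \<xi>0 (rr i) \<longrightarrow> - (e * u y + d) \<le> \<omega> i"
    and v2: "AE y in lebesgue. - (e * u y + d) \<le> S0 + \<bar>u y\<bar>"
    and v3: "AE y in lebesgue. y \<in> hball \<xi>0 (rr j) \<longrightarrow> 0 \<le> e * u y + d"
    and large: "emeasure lebesgue (kball \<xi>0 (\<theta> * (rr j / 5)))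
      \<le> 2 * emeasure lebesgue {y \<in> kball \<xi>0 (\<theta> * (rr j / 5)). \<omega> j / 2 \<le> e * u y + d}"
  shows "AE y in lebesgue. y \<in> hball \<xi>0 (rr (Suc j)) \<longrightarrow> \<delta> * (\<omega> j / 2) \<le> e * u y + d"
proof -
  define v where "v y = e * u y + d" for y
  define R where "R = rr j / 5"
  have R: "0 < R" "R \<le> 1" using rr_pos[of j] by (simp_all add: R_def)
  have vm: "v \<in> borel_measurable lebesgue" unfolding v_def by measurable
  have eps: "0 \<le> tail_threshold TYPE('n) q t La Ha"
    using energy_const_pos[where 'n='n, of q t] La_nonneg by (simp add: tail_threshold_def)
  have kb: "kball \<xi>0 R \<subseteq> hball \<xi>0 (rr j)" unfolding R_def by (rule kball_subset_hball)
  have gr: "growth p q s t \<alpha> La Ha a \<Omega> v \<xi>0 R (\<theta> * R) (\<omega> j / 2) (tail_threshold TYPE('n) q t La Ha)"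
  proof (unfold_locales)
    show "weak_solution p q s t a \<Omega> v"
      unfolding v_def by (rule weak_solution_affine[OF pq(1) \<Omega> u e])
    show "kball \<xi>0 R \<subseteq> \<Omega>" using kb hball_rr_mono[of j] hb by blast
    show "0 < \<theta> * R" using \<theta> R by simp
    have "\<theta> * R \<le> 1/4 * R" using \<theta> R by (intro mult_right_mono) auto
    thus "4 * (\<theta> * R) \<le> R" by simp
    show "AE x in lebesgue. x \<in> kball \<xi>0 R \<longrightarrow> 0 \<le> v x"
      using v3
    proof eventually_elim
      case (elim x)
      show ?case
      proof
        assume "x \<in> kball \<xi>0 R"
        hence "x \<in> hball \<xi>0 (rr j)" using kb by (rule subsetD[rotated])
        with elim show "0 \<le> v x" by (simp add: v_def)
      qed
    qed
    show "emeasure lebesgue (kball \<xi>0 (\<theta> * R)) \<le> 2 * emeasure lebesgue {y \<in> kball \<xi>0 (\<theta> * R). \<omega> j / 2 \<le> v y}"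
      using large unfolding v_def R_def .
    show "(\<integral>\<^sup>+y. indicator (- kball \<xi>0 R) y * ennreal (((\<omega> j / 2 + max 0 (- v y)) powr (p - 1)
        + (\<omega> j / 2 + max 0 (- v y)) powr (q - 1)) * Wt (s * p) \<xi>0 y) \<partial>lebesgue)
        \<le> ennreal (tail_threshold TYPE('n) q t La Ha * ((\<omega> j / 2) powr (p - 1) * (\<theta> * R) powr - (s * p)))"
      unfolding R_def by (rule step_tails(1)[OF vm _ _ _ \<omega>j(2)]) (use v1 v2 v3 in \<open>auto simp: v_def\<close>)
    show "(\<integral>\<^sup>+y. indicator (- kball \<xi>0 R) y * ennreal ((\<omega> j / 2 + max 0 (- v y)) powr (q - 1) * Wt (t * q) \<xi>0 y) \<partial>lebesgue)
        \<le> ennreal (tail_threshold TYPE('n) q t La Ha * ((\<omega> j / 2) powr (q - 1) * (\<theta> * R) powr - (t * q)))"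
      unfolding R_def by (rule step_tails(2)[OF vm _ _ _ \<omega>j(2)]) (use v1 v2 v3 in \<open>auto simp: v_def\<close>)
  qed (use \<Omega> R eps \<omega>j in auto)
  \<comment> \<open>The ratio of the radii is 1 / \<theta> at every scale, so one choice of \<delta>
    serves all j.\<close>
  have X: "R / (\<theta> * R) = 1 / \<theta>" using R by simp
  have "AE x in lebesgue. x \<in> kball \<xi>0 (\<theta> * R / 2) \<longrightarrow> \<delta> * (\<omega> j / 2) \<le> v x"
    by (rule growth.growth_conclusion[OF gr order_refl, where \<Lambda>=\<Lambda>, unfolded X, OF _ \<delta>])
       (use \<omega>j \<Lambda> in linarith)
  thus ?thesis
  proof eventually_elim
    case (elim y)
    show ?case
    proof
      assume "y \<in> hball \<xi>0 (rr (Suc j))"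
      hence "kern y \<xi>0 < 2 * rr (Suc j)" using hball_subset_kball[of \<xi>0] by (auto simp: kball_def)
      also have "\<dots> = 2 * \<sigma> * rr j" by (simp add: rr_def)
      also have "\<dots> \<le> 2 * (\<theta> / 20) * rr j" using \<sigma> rr_pos[of j] by (intro mult_right_mono mult_left_mono) auto
      also have "\<dots> = \<theta> * R / 2" by (simp add: R_def)
      finally show "\<delta> * (\<omega> j / 2) \<le> e * u y + d" using elim by (simp add: kball_def v_def)
    qed
  qed
qed

lemma oscillation: "\<exists>c. AE y in lebesgue. y \<in> hball \<xi>0 (rr j) \<longrightarrow> c \<le> u y \<and> u y \<le> c + \<omega> j"
\<comment> \<open>The growth lemma needs a positive height. If \<omega>0 = 0, then S0 = 0 and u
  vanishes almost everywhere in the first ball.\<close>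
proof (cases "\<omega>0 = 0")
  case True
  have "S0 = 0" using S0(2,4) True by linarith
  have "AE y in lebesgue. y \<in> hball \<xi>0 (rr j) \<longrightarrow> 0 \<le> u y \<and> u y \<le> 0 + \<omega> j"
    using S0(1)
  proof eventually_elim
    case (elim y)
    show ?case
    proof
      assume "y \<in> hball \<xi>0 (rr j)"
      hence "u y = 0" using elim hball_rr_mono[of j] \<open>S0 = 0\<close> by auto
      thus "0 \<le> u y \<and> u y \<le> 0 + \<omega> j" using \<omega>_nonneg[of j] by linarith
    qed
  qed
  thus ?thesis by blast
next
  case False
  hence \<omega>0: "\<omega>0 > 0" using \<omega>0_nonneg by simp
  have \<omega>pos: "\<omega> i > 0" for i using \<omega>0 \<kappa> by (simp add: \<omega>_def)
  show ?thesis
  proof (induction j rule: less_induct)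
    case (less n)
    show ?case
    proof (cases n)
      case 0
      have "AE y in lebesgue. y \<in> hball \<xi>0 (rr n) \<longrightarrow> - S0 \<le> u y \<and> u y \<le> - S0 + \<omega> n"
        using S0(1) by eventually_elim (use S0(4) hball_rr_mono[of n] in \<open>auto simp: \<omega>_def 0\<close>)
      thus ?thesis by blast
    next
      case (Suc j)
      \<comment> \<open>Levels above the supremum of u are trivial; below it all levels are bounded by \<open>\<Lambda>\<close>,
        which makes the q-phase comparable to the p-phase.\<close>
      show ?thesis
      proof (cases "2 * M \<le> \<omega> n")
        case True
        have "AE y in lebesgue. y \<in> hball \<xi>0 (rr n) \<longrightarrow> - M \<le> u y \<and> u y \<le> - M + \<omega> n"
          using M by eventually_elim (use True hball_rr_mono[of n] in auto)
        thus ?thesis by blast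
      next
        case False
        have "\<omega> n = \<kappa> * \<omega> j" by (simp add: Suc \<omega>_def)
        \<comment> \<open>The bound \<omega> n < 2 M is carried back one index, where \<kappa> \<ge>
          1/2 costs a factor 2.\<close>
        hence \<omega>j: "\<omega> j \<le> 4 * M" using False mult_right_mono[OF \<kappa>(1) \<omega>_nonneg[of j]] by linarith
        have "\<forall>i\<in>{..j}. \<exists>c. AE y in lebesgue. y \<in> hball \<xi>0 (rr i) \<longrightarrow> c \<le> u y \<and> u y \<le> c + \<omega> i"
          using less Suc by auto
        then obtain c where c: "\<forall>i\<in>{..j}. AE y in lebesgue. y \<in> hball \<xi>0 (rr i) \<longrightarrow> c i \<le> u y \<and> u y \<le> c i + \<omega> i"
          unfolding bchoice_iff by blast
        hence cc: "AE y in lebesgue. \<forall>i\<in>{..j}. y \<in> hball \<xi>0 (rr i) \<longrightarrow> c i \<le> u y \<and> u y \<le> c i + \<omega> i"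
          by (intro AE_finite_allI) auto
        \<comment> \<open>At one point of the smallest ball all almost everywhere bounds hold
          simultaneously. This shows that the intervals from c i to c i + \<omega> i pairwise
          overlap with the last one, whence both candidates for v are at least -\<omega> i on the
          larger balls, as the tails require.\<close>
        have "AE y in lebesgue. (\<forall>i\<in>{..j}. y \<in> hball \<xi>0 (rr i) \<longrightarrow> c i \<le> u y \<and> u y \<le> c i + \<omega> i) \<and> (y \<in> hball \<xi>0 r \<longrightarrow> \<bar>u y\<bar> \<le> S0)"
          using cc S0(1) by eventually_elim auto
        then obtain x where x: "x \<in> hball \<xi>0 (rr j)"
          "\<forall>i\<in>{..j}. x \<in> hball \<xi>0 (rr i) \<longrightarrow> c i \<le> u x \<and> u x \<le> c i + \<omega> i" "x \<in> hball \<xi>0 r \<longrightarrow> \<bar>u x\<bar> \<le> S0"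
          using AE_hball_witness[of _ j] by blast
        have xi: "c i \<le> u x \<and> u x \<le> c i + \<omega> i" if "i \<le> j" for i
          using x that hball_rr_antimono[OF that] by auto
        have xS: "\<bar>u x\<bar> \<le> S0" using x hball_rr_mono[of j] by auto
        have ov: "c j \<le> c i + \<omega> i" "c i \<le> c j + \<omega> j" if "i \<le> j" for i
          using xi[OF that] xi[of j] by auto
        have ovS: "c j \<le> S0" "- S0 \<le> c j + \<omega> j" using xi[of j] xS by auto
        define D where "D = kball \<xi>0 (\<theta> * (rr j / 5))"
        \<comment> \<open>On at least half of D, u lies on one side of the midpoint of its interval.
          The distance of u to the opposite end of the interval is then at least \<omega> j / 2
          there, which is the k of the growth lemma.\<close>
        define A1 where "A1 = {y \<in> D. \<omega> j / 2 \<le> 1 * u y + (- c j)}"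
        define A2 where "A2 = {y \<in> D. \<omega> j / 2 \<le> (-1) * u y + (c j + \<omega> j)}"
        have Am: "A1 \<in> sets lebesgue" "A2 \<in> sets lebesgue"
        proof -
          have "A1 = D \<inter> {y \<in> space lebesgue. \<omega> j / 2 \<le> 1 * u y + (- c j)}" "A2 = D \<inter> {y \<in> space lebesgue. \<omega> j / 2 \<le> (-1) * u y + (c j + \<omega> j)}"
            by (auto simp: A1_def A2_def)
          moreover have "D \<inter> {y \<in> space lebesgue. \<omega> j / 2 \<le> 1 * u y + (- c j)} \<in> sets lebesgue"
            "D \<inter> {y \<in> space lebesgue. \<omega> j / 2 \<le> (-1) * u y + (c j + \<omega> j)} \<in> sets lebesgue"
            unfolding D_def by measurable
          ultimately show "A1 \<in> sets lebesgue" "A2 \<in> sets lebesgue" by simp_all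
        qed
        have "D \<subseteq> A1 \<union> A2" by (auto simp: A1_def A2_def)
        hence "emeasure lebesgue D \<le> emeasure lebesgue (A1 \<union> A2)" using Am by (intro emeasure_mono) auto
        also have "\<dots> \<le> emeasure lebesgue A1 + emeasure lebesgue A2" by (rule emeasure_subadditive[OF Am])
        finally have DA: "emeasure lebesgue D \<le> emeasure lebesgue A1 + emeasure lebesgue A2" .
        have \<kappa>\<delta>: "\<omega> j - \<delta> * (\<omega> j / 2) \<le> \<omega> n"
        proof -
          have "(1 - \<delta> / 2) * \<omega> j \<le> \<kappa> * \<omega> j" using \<beta>(3) \<omega>_nonneg by (intro mult_right_mono) (auto simp: \<kappa>_def)
          thus ?thesis using \<open>\<omega> n = \<kappa> * \<omega> j\<close> by (simp add: algebra_simps)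
        qed
        have sub: "hball \<xi>0 (rr n) \<subseteq> hball \<xi>0 (rr j)" by (rule hball_rr_antimono) (simp add: Suc)
        show ?thesis
        proof (cases "emeasure lebesgue A2 \<le> emeasure lebesgue A1")
          case True
          have lg: "emeasure lebesgue D \<le> 2 * emeasure lebesgue A1"
          proof -
            have "emeasure lebesgue A1 + emeasure lebesgue A2 \<le> 2 * emeasure lebesgue A1"
              unfolding mult_2 by (rule add_left_mono[OF True])
            thus ?thesis using DA by (rule order_trans[rotated])
          qed
          have "AE y in lebesgue. y \<in> hball \<xi>0 (rr (Suc j)) \<longrightarrow> \<delta> * (\<omega> j / 2) \<le> 1 * u y + (- c j)"
          proof (rule growth_step[OF _ \<omega>pos \<omega>j _ _ _ lg[unfolded A1_def, unfolded D_def]])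
            show "AE y in lebesgue. \<forall>i\<le>j. y \<in> hball \<xi>0 (rr i) \<longrightarrow> - (1 * u y + - c j) \<le> \<omega> i"
              using cc
            proof eventually_elim
              case (elim y)
              show ?case
              proof (intro allI impI)
                fix i assume "i \<le> j" "y \<in> hball \<xi>0 (rr i)"
                hence "c i \<le> u y" using elim by auto
                thus "- (1 * u y + - c j) \<le> \<omega> i" using ov(1)[OF \<open>i \<le> j\<close>] by simp
              qed
            qed
            show "AE y in lebesgue. - (1 * u y + - c j) \<le> S0 + \<bar>u y\<bar>"
              using ovS by (intro AE_I2) simp
            show "AE y in lebesgue. y \<in> hball \<xi>0 (rr j) \<longrightarrow> 0 \<le> 1 * u y + - c j"
              using cc by eventually_elim auto
          qed simp
          hence "AE y in lebesgue. y \<in> hball \<xi>0 (rr n) \<longrightarrow> c j + \<delta> * (\<omega> j / 2) \<le> u y \<and> u y \<le> (c j + \<delta> * (\<omega> j / 2)) + \<omega> n"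
            using cc
          proof eventually_elim
            case (elim y)
            show ?case
            proof
              assume y: "y \<in> hball \<xi>0 (rr n)"
              hence "u y \<le> c j + \<omega> j" using elim sub by auto
              moreover have "\<delta> * (\<omega> j / 2) \<le> 1 * u y + (- c j)" using elim y Suc by simp
              ultimately show "c j + \<delta> * (\<omega> j / 2) \<le> u y \<and> u y \<le> (c j + \<delta> * (\<omega> j / 2)) + \<omega> n"
                using \<kappa>\<delta> by linarith
            qed
          qed
          thus ?thesis by blast
        next
          case False
          have lg: "emeasure lebesgue D \<le> 2 * emeasure lebesgue A2"
          proof -
            have "emeasure lebesgue A1 \<le> emeasure lebesgue A2" using False by (metis linorder_linear)
            hence "emeasure lebesgue A1 + emeasure lebesgue A2 \<le> 2 * emeasure lebesgue A2"
              unfolding mult_2 by (rule add_right_mono)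
            thus ?thesis using DA by (rule order_trans[rotated])
          qed
          have "AE y in lebesgue. y \<in> hball \<xi>0 (rr (Suc j)) \<longrightarrow> \<delta> * (\<omega> j / 2) \<le> (-1) * u y + (c j + \<omega> j)"
          proof (rule growth_step[OF _ \<omega>pos \<omega>j _ _ _ lg[unfolded A2_def, unfolded D_def]])
            show "AE y in lebesgue. \<forall>i\<le>j. y \<in> hball \<xi>0 (rr i) \<longrightarrow> - (-1 * u y + (c j + \<omega> j)) \<le> \<omega> i"
              using cc
            proof eventually_elim
              case (elim y)
              show ?case
              proof (intro allI impI)
                fix i assume "i \<le> j" "y \<in> hball \<xi>0 (rr i)"
                hence "u y \<le> c i + \<omega> i" using elim by auto
                thus "- (-1 * u y + (c j + \<omega> j)) \<le> \<omega> i" using ov(2)[OF \<open>i \<le> j\<close>] by simp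
              qed
            qed
            show "AE y in lebesgue. - (-1 * u y + (c j + \<omega> j)) \<le> S0 + \<bar>u y\<bar>"
              using ovS by (intro AE_I2) simp
            show "AE y in lebesgue. y \<in> hball \<xi>0 (rr j) \<longrightarrow> 0 \<le> -1 * u y + (c j + \<omega> j)"
              using cc by eventually_elim auto
          qed simp
          hence "AE y in lebesgue. y \<in> hball \<xi>0 (rr n) \<longrightarrow> c j \<le> u y \<and> u y \<le> c j + \<omega> n"
            using cc
          proof eventually_elim
            case (elim y)
            show ?case
            proof
              assume y: "y \<in> hball \<xi>0 (rr n)"
              hence "c j \<le> u y" using elim sub by auto
              moreover have "\<delta> * (\<omega> j / 2) \<le> (-1) * u y + (c j + \<omega> j)" using elim y Suc by simp
              ultimately show "c j \<le> u y \<and> u y \<le> c j + \<omega> n"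
                using \<kappa>\<delta> by linarith
            qed
          qed
          thus ?thesis by blast
        qed
      qed
    qed
  qed
qed

end

section \<open>Essential suprema, choice of constants and the tails in \<omega>0\<close>

lemma ess_sup_on_le:
  fixes f :: "'n::finite heis \<Rightarrow> real"
  assumes [measurable]: "f \<in> borel_measurable lebesgue" and B: "B \<in> sets lebesgue"
    and "AE x in lebesgue. x \<in> B \<longrightarrow> f x \<le> c"
  shows "ess_sup_on B f \<le> ereal c"
  unfolding ess_sup_on_def
proof (rule esssup_I)
  show "(\<lambda>x. ereal (f x)) \<in> borel_measurable (restrict_space lebesgue B)"
    by (rule measurable_restrict_space1) measurable
  show "AE x in restrict_space lebesgue B. ereal (f x) \<le> ereal c"
    using assms(3) B by (subst AE_restrict_space_iff) auto
qed

lemma ess_sup_on_AE: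
  fixes f :: "'n::finite heis \<Rightarrow> real"
  assumes B: "B \<in> sets lebesgue"
  shows "AE x in lebesgue. x \<in> B \<longrightarrow> ereal (f x) \<le> ess_sup_on B f"
  using esssup_AE[where M="restrict_space lebesgue B" and f="\<lambda>x. ereal (f x)"] B
  unfolding ess_sup_on_def by (subst (asm) AE_restrict_space_iff) auto

text \<open>The ball inside B guarantees positive measure. On a null set the essential supremum can
  be minus infinity, and its conversion to a real number would lose the bound.\<close>

lemma ess_sup_on_abs:
  fixes f :: "'n::finite heis \<Rightarrow> real"
  assumes B: "B \<in> sets lebesgue" "kball \<xi> d \<subseteq> B" "d > 0" and fin: "ess_sup_on B (\<lambda>x. \<bar>f x\<bar>) < \<infinity>"
  shows "0 \<le> real_of_ereal (ess_sup_on B (\<lambda>x. \<bar>f x\<bar>))"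
    and "AE x in lebesgue. x \<in> B \<longrightarrow> \<bar>f x\<bar> \<le> real_of_ereal (ess_sup_on B (\<lambda>x. \<bar>f x\<bar>))"
    and "ess_sup_on B (\<lambda>x. \<bar>f x\<bar>) = ereal (real_of_ereal (ess_sup_on B (\<lambda>x. \<bar>f x\<bar>)))"
proof -
  let ?E = "ess_sup_on B (\<lambda>x. \<bar>f x\<bar>)"
  have ae: "AE x in lebesgue. x \<in> B \<longrightarrow> ereal \<bar>f x\<bar> \<le> ?E" by (rule ess_sup_on_AE[OF B(1)])
  obtain x where "x \<in> kball \<xi> d" "x \<in> B \<longrightarrow> ereal \<bar>f x\<bar> \<le> ?E"
    using AE_kball_witness[OF ae B(3)] by blast
  hence "ereal \<bar>f x\<bar> \<le> ?E" using B(2) by blast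
  moreover have "0 \<le> ereal \<bar>f x\<bar>" by simp
  ultimately have E0: "0 \<le> ?E" by (rule order_trans[rotated])
  show eq: "?E = ereal (real_of_ereal ?E)" using E0 fin by (cases ?E) auto
  show "0 \<le> real_of_ereal ?E" using E0 by (simp add: real_of_ereal_pos)
  show "AE x in lebesgue. x \<in> B \<longrightarrow> \<bar>f x\<bar> \<le> real_of_ereal ?E"
    using ae
  proof eventually_elim
    case (elim x)
    show ?case
    proof
      assume "x \<in> B"
      hence "ereal \<bar>f x\<bar> \<le> ereal (real_of_ereal ?E)" using elim eq by simp
      thus "\<bar>f x\<bar> \<le> real_of_ereal ?E" by simp
    qed
  qed
qed

lemma small_powr_exists:
  fixes T \<epsilon> e b :: real
  assumes "T \<ge> 0" "\<epsilon> > 0" "e > 0" "b > 0"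
  shows "\<exists>x. 0 < x \<and> x \<le> b \<and> T * x powr e \<le> \<epsilon>"
proof (intro exI conjI)
  define x where "x = min b ((\<epsilon> / (T + 1)) powr (1 / e))"
  show "0 < min b ((\<epsilon> / (T + 1)) powr (1 / e))" "min b ((\<epsilon> / (T + 1)) powr (1 / e)) \<le> b" using assms by auto
  have "x powr e \<le> ((\<epsilon> / (T + 1)) powr (1 / e)) powr e"
    using assms by (intro powr_mono2) (auto simp: x_def)
  also have "\<dots> = \<epsilon> / (T + 1)" using assms by (simp add: powr_powr)
  finally have "T * x powr e \<le> (T + 1) * (\<epsilon> / (T + 1))" using assms by (intro mult_mono) auto
  thus "T * (min b ((\<epsilon> / (T + 1)) powr (1 / e))) powr e \<le> \<epsilon>" using assms by (simp add: x_def)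
qed

text \<open>The order of the choices avoids a circle. \<theta> is fixed by the tails alone; it
  determines X, and X determines \<delta>; \<sigma> depends on \<theta>. Only then is \<beta>
  chosen, which is possible because \<sigma>^\<beta> tends to 1 as \<beta> tends to 0.\<close>

lemma decay_constants_exist:
  fixes p q s t \<alpha> La Ha \<Lambda> :: real
  assumes pq: "1 < p" "p \<le> q" "0 < s" "s \<le> t" "t < 1" and nn: "0 \<le> La" "0 \<le> Ha"
  shows "\<exists>\<theta> \<delta> \<sigma> \<beta>. 0 < \<theta> \<and> \<theta> \<le> 1/4 \<and> tail_const TYPE('n::finite) p q s t \<Lambda> * 2 powr q * \<theta> powr (s * p) \<le> tail_threshold TYPE('n) q t La Ha
    \<and> 0 < \<delta> \<and> \<delta> \<le> 1/4 \<and> growth_const TYPE('n) p q s t (4 * Ha * ((1 / \<theta>) powr \<alpha> * \<Lambda> powr (q - p))) * 2 powr (p + 2) * \<delta> powr (p - 1)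
        \<le> decay_start TYPE('n) p q s t (4 * Ha * ((1 / \<theta>) powr \<alpha> * \<Lambda> powr (q - p)))
    \<and> 0 < \<sigma> \<and> \<sigma> \<le> \<theta> / 20 \<and> 0 < \<beta> \<and> \<beta> * (q - 1) \<le> s * p / 2 \<and> 1 - \<delta> / 2 \<le> \<sigma> powr \<beta>"
proof -
  have e: "0 < s * p" "0 < t * q" "s * p < p" "t * q < q" using pq by auto
  have eps: "0 < tail_threshold TYPE('n) q t La Ha" using nn by (simp add: tail_threshold_def energy_const_pos add_pos_nonneg)
  have tC: "0 \<le> tail_const TYPE('n) p q s t \<Lambda> * 2 powr q"
    using kint_pos[where 'n='n, of "s * p / 2"] kint_pos[where 'n='n, of "t * q / 2"] e
    unfolding tail_const_def by (intro mult_nonneg_nonneg add_nonneg_nonneg) auto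
  obtain \<theta> :: real where \<theta>: "0 < \<theta>" "\<theta> \<le> 1/4" "tail_const TYPE('n) p q s t \<Lambda> * 2 powr q * \<theta> powr (s * p) \<le> tail_threshold TYPE('n) q t La Ha"
    using small_powr_exists[OF tC eps e(1), of "1/4"] by auto
  define X where "X = 4 * Ha * ((1 / \<theta>) powr \<alpha> * \<Lambda> powr (q - p))"
  have X: "X \<ge> 0" using nn by (simp add: X_def)
  have "0 \<le> cutoff_const TYPE('n) p q s t X"
    unfolding cutoff_const_def using X kint_pos[where 'n='n, of "p - s * p"] kint_pos[where 'n='n, of "s * p"]
      kint_pos[where 'n='n, of "q - t * q"] kint_pos[where 'n='n, of "t * q"] e
    by (intro add_nonneg_nonneg mult_nonneg_nonneg) auto
  hence gC: "0 < growth_const TYPE('n) p q s t X"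
    unfolding growth_const_def using energy_const_pos[where 'n='n, of q t] by (intro mult_pos_pos add_pos_nonneg) auto
  hence gs: "0 < decay_start TYPE('n) p q s t X" by (simp add: decay_start_def)
  have "0 \<le> growth_const TYPE('n) p q s t X * 2 powr (p + 2)" "0 < p - 1" using gC pq by auto
  then obtain \<delta> :: real where \<delta>: "0 < \<delta>" "\<delta> \<le> 1/4" "growth_const TYPE('n) p q s t X * 2 powr (p + 2) * \<delta> powr (p - 1) \<le> decay_start TYPE('n) p q s t X"
    using small_powr_exists[OF _ gs, of "growth_const TYPE('n) p q s t X * 2 powr (p + 2)" "p - 1" "1/4"] by auto
  define \<sigma> where "\<sigma> = \<theta> / 20"
  have \<sigma>: "0 < \<sigma>" "\<sigma> < 1" using \<theta> by (auto simp: \<sigma>_def)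
  hence ls: "ln \<sigma> < 0" by simp
  have ld: "ln (1 - \<delta> / 2) < 0" using \<delta> by simp
  \<comment> \<open>The first entry is the largest exponent the tails tolerate, the second solves
    \<sigma>^\<beta> = 1 - \<delta> / 2. Both logarithms are negative, so their quotient is
    positive.\<close>
  define \<beta> where "\<beta> = min (s * p / (2 * (q - 1))) (ln (1 - \<delta> / 2) / ln \<sigma>)"
  have \<beta>0: "0 < \<beta>" unfolding \<beta>_def using e pq ls ld by (simp add: divide_neg_neg)
  have "\<beta> * (q - 1) \<le> s * p / (2 * (q - 1)) * (q - 1)" unfolding \<beta>_def using pq by (intro mult_right_mono) auto
  also have "\<dots> = s * p / 2"
  proof -
    have *: "x / (2 * b) * b = x / 2" if "b \<noteq> 0" for x b :: real using that by simp
    show ?thesis by (rule *) (use pq in simp)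
  qed
  finally have \<beta>1: "\<beta> * (q - 1) \<le> s * p / 2" .
  have "\<beta> \<le> ln (1 - \<delta> / 2) / ln \<sigma>" by (simp add: \<beta>_def)
  hence "ln (1 - \<delta> / 2) \<le> \<beta> * ln \<sigma>" using ls by (simp add: neg_le_divide_eq)
  hence "exp (ln (1 - \<delta> / 2)) \<le> \<sigma> powr \<beta>" using \<sigma> by (simp add: powr_def)
  hence "1 - \<delta> / 2 \<le> \<sigma> powr \<beta>" using \<delta> by simp
  thus ?thesis using \<theta> \<delta> \<sigma> \<beta>0 \<beta>1 unfolding X_def by (intro exI[of _ \<theta>] exI[of _ \<delta>] exI[of _ \<sigma>] exI[of _ \<beta>]) (simp add: \<sigma>_def)
qed

text \<open>The integrals inside \<omega>0 would be 0 by convention if they diverged, and \<omega>0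
  would then not control the tails. They converge: off the ball 1 + hnorm y is at most a multiple of
  the distance to \<xi>0, so the weight of the tail space dominates the kernel, and the summand 1 is
  handled by \<open>nn_integral_kern_far\<close>.\<close>

lemma tail_space_integrable:
  fixes u :: "'n::finite heis \<Rightarrow> real"
  assumes u: "u \<in> tail_space (q - 1) (s * p)" and pq: "1 < p" "p \<le> q" and e: "0 < s * p" "s * p \<le> e" and r: "0 < r"
    and w: "w \<in> borel_measurable lebesgue" "\<And>y. 0 \<le> w y" "\<And>y. w y \<le> 1 + 2 * \<bar>u y\<bar> powr (q - 1)"
  shows "set_integrable lebesgue (UNIV - hball \<xi>0 r) (\<lambda>y. w y / kern y \<xi>0 powr (hdim TYPE('n) + e))"
  unfolding set_integrable_def
proof (rule integrableI_bounded)
  let ?Q = "hdim TYPE('n)"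
  let ?A = "UNIV - hball \<xi>0 r"
  note w(1) [measurable]
  have um [measurable]: "u \<in> borel_measurable lebesgue"
    and ufin: "(\<integral>\<^sup>+ x. ennreal (\<bar>u x\<bar> powr (q - 1) * (1 + hnorm x) powr (- ?Q - s * p)) \<partial>lebesgue) < \<infinity>"
    using u unfolding tail_space_def by auto
  have [measurable]: "?A \<in> sets lebesgue" using open_hball[of \<xi>0 r] by (simp add: borel_open Compl_eq_Diff_UNIV[symmetric])
  have hm [measurable]: "(\<lambda>x::'n heis. hnorm x) \<in> borel_measurable lebesgue"
    by (rule measurable_lebesgue_borel[OF borel_measurable_continuous_onI[OF continuous_hnorm]])
  show "(\<lambda>y. indicat_real ?A y *\<^sub>R (w y / kern y \<xi>0 powr (?Q + e))) \<in> borel_measurable lebesgue" by measurable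
  define c where "c = (1 + hnorm \<xi>0) * (5 / r) + 1"
  have c: "c > 0" using r by (simp add: c_def add_nonneg_pos)
  define d where "d = (r / 5) powr - (e - s * p)"
  define f1 where "f1 y = indicator {y. r / 5 \<le> kern y \<xi>0} y * ennreal (1 / kern y \<xi>0 powr (?Q + s * p))" for y
  define f2 where "f2 y = ennreal (\<bar>u y\<bar> powr (q - 1) * (1 + hnorm y) powr (- ?Q - s * p))" for y
  have fm [measurable]: "f1 \<in> borel_measurable lebesgue" "f2 \<in> borel_measurable lebesgue"
    unfolding f1_def f2_def by measurable
  define c2 where "c2 = 2 * c powr (?Q + s * p)"
  have "(\<integral>\<^sup>+ y. ennreal (norm (indicat_real ?A y *\<^sub>R (w y / kern y \<xi>0 powr (?Q + e)))) \<partial>lebesgue)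
    \<le> (\<integral>\<^sup>+ y. ennreal d * (f1 y + ennreal c2 * f2 y) \<partial>lebesgue)"
  proof (rule nn_integral_mono)
    fix y
    show "ennreal (norm (indicat_real ?A y *\<^sub>R (w y / kern y \<xi>0 powr (?Q + e)))) \<le> ennreal d * (f1 y + ennreal c2 * f2 y)"
    proof (cases "y \<in> ?A")
      case True
      hence "y \<notin> kball \<xi>0 (r / 5)" using kball_subset_hball by blast
      hence K: "r / 5 \<le> kern y \<xi>0" by (simp add: kball_def)
      hence K0: "kern y \<xi>0 > 0" using r by linarith
      have "hnorm y = kern y 0" "hnorm \<xi>0 = kern \<xi>0 0" by (simp_all add: kern_def hinv_eq_uminus)
      hence "1 + hnorm y \<le> (1 + hnorm \<xi>0) * 1 + kern y \<xi>0" using kern_triangle[of y 0 \<xi>0] by simp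
      also have "\<dots> \<le> (1 + hnorm \<xi>0) * (5 / r * kern y \<xi>0) + kern y \<xi>0"
        using K r by (intro add_right_mono mult_left_mono) (auto simp: field_simps)
      also have "\<dots> = c * kern y \<xi>0" by (simp add: c_def algebra_simps)
      finally have hk: "1 + hnorm y \<le> c * kern y \<xi>0" .
      have h0: "0 < 1 + hnorm y" by (simp add: add_pos_nonneg)
      define g where "g = kern y \<xi>0 powr (?Q + s * p)"
      have g: "g > 0" using K0 by (simp add: g_def)
      have Q: "0 < ?Q + s * p" using hdim_pos[where 'n='n] e by linarith
      have "(1 + hnorm y) powr (?Q + s * p) \<le> (c * kern y \<xi>0) powr (?Q + s * p)"
        using hk h0 Q by (intro powr_mono2) auto
      also have "\<dots> = c powr (?Q + s * p) * g" using c by (simp add: powr_mult g_def)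
      finally have "1 / g \<le> c powr (?Q + s * p) / (1 + hnorm y) powr (?Q + s * p)"
        using g h0 by (simp add: field_simps)
      also have "\<dots> = c powr (?Q + s * p) * (1 + hnorm y) powr (- ?Q - s * p)"
      proof -
        have "- ?Q - s * p = - (?Q + s * p)" by simp
        thus ?thesis by (simp only: powr_minus_divide times_divide_eq_right mult_1_right)
      qed
      finally have g1: "1 / g \<le> c powr (?Q + s * p) * (1 + hnorm y) powr (- ?Q - s * p)" .
      have "kern y \<xi>0 powr (?Q + e) = g * kern y \<xi>0 powr (e - s * p)"
        unfolding g_def by (subst powr_add[symmetric]) simp
      moreover have "(r / 5) powr (e - s * p) \<le> kern y \<xi>0 powr (e - s * p)" using K r e by (intro powr_mono2) auto
      moreover have "0 < (r / 5) powr (e - s * p)" using r by simp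
      ultimately have "1 / kern y \<xi>0 powr (?Q + e) \<le> 1 / (g * (r / 5) powr (e - s * p))"
        using g by (simp add: frac_le)
      hence "1 / kern y \<xi>0 powr (?Q + e) \<le> d * (1 / g)"
        unfolding d_def powr_minus_divide by (simp add: mult.commute)
      hence "w y / kern y \<xi>0 powr (?Q + e) \<le> d * (w y * (1 / g))"
        using mult_left_mono[OF _ w(2)[of y], of "1 / kern y \<xi>0 powr (?Q + e)" "d * (1 / g)"] by (simp add: mult_ac)
      also have "\<dots> \<le> d * ((1 + 2 * \<bar>u y\<bar> powr (q - 1)) * (1 / g))"
        using g w(3) by (intro mult_left_mono mult_right_mono) (auto simp: d_def)
      also have "\<dots> = d * (1 / g + 2 * \<bar>u y\<bar> powr (q - 1) * (1 / g))"
        by (simp only: distrib_right mult_1_left)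
      also have "\<dots> \<le> d * (1 / g + 2 * \<bar>u y\<bar> powr (q - 1) * (c powr (?Q + s * p) * (1 + hnorm y) powr (- ?Q - s * p)))"
        by (intro mult_left_mono add_left_mono g1) (auto simp: d_def)
      also have "\<dots> = d * (1 / g + c2 * (\<bar>u y\<bar> powr (q - 1) * (1 + hnorm y) powr (- ?Q - s * p)))"
        by (simp add: c2_def mult_ac)
      finally have "ennreal (w y / kern y \<xi>0 powr (?Q + e)) \<le> ennreal (d * (1 / g + c2 * (\<bar>u y\<bar> powr (q - 1) * (1 + hnorm y) powr (- ?Q - s * p))))"
        by (rule ennreal_leI)
      also have "\<dots> = ennreal d * (ennreal (1 / g) + ennreal c2 * ennreal (\<bar>u y\<bar> powr (q - 1) * (1 + hnorm y) powr (- ?Q - s * p)))"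
      proof -
        have "ennreal (d * (A + c2 * B)) = ennreal d * (ennreal A + ennreal c2 * ennreal B)" if "0 \<le> A" "0 \<le> B" for A B
          using that by (simp add: ennreal_mult d_def c2_def ennreal_plus)
        thus ?thesis using g by simp
      qed
      finally show ?thesis using True K w(2)[of y] by (simp add: f1_def f2_def g_def)
    qed simp
  qed
  also have "\<dots> = ennreal d * ((\<integral>\<^sup>+ y. f1 y \<partial>lebesgue) + ennreal c2 * (\<integral>\<^sup>+ y. f2 y \<partial>lebesgue))"
    by (simp add: nn_integral_cmult nn_integral_add)
  also have "\<dots> < \<infinity>"
  proof -
    have "(\<integral>\<^sup>+ y. f1 y \<partial>lebesgue) \<le> ennreal (kint TYPE('n) (s * p) * (r / 5) powr - (s * p))"
      unfolding f1_def using e r by (intro nn_integral_kern_far) auto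
    hence "(\<integral>\<^sup>+ y. f1 y \<partial>lebesgue) < top" by (rule le_less_trans) simp
    moreover have "(\<integral>\<^sup>+ y. f2 y \<partial>lebesgue) < top" using ufin by (simp add: f2_def)
    ultimately show ?thesis
      by (simp only: ennreal_add_less_top ennreal_mult_less_top infinity_ennreal_def ennreal_less_top simp_thms)
  qed
  finally show "(\<integral>\<^sup>+ y. ennreal (norm (indicat_real ?A y *\<^sub>R (w y / kern y \<xi>0 powr (?Q + e)))) \<partial>lebesgue) < \<infinity>" .
qed

text \<open>Undoes the root and the scaling of one summand of \<omega>0. Allowing w' below w lets
  the two powers of the first summand be used separately.\<close>

lemma tail_bound_from_omega:
  fixes \<xi>0 :: "'n::finite heis" and w :: "'n heis \<Rightarrow> real"
  assumes int: "set_integrable lebesgue (UNIV - hball \<xi>0 r) (\<lambda>y. w y / kern y \<xi>0 powr (hdim TYPE('n) + e))"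
    and w: "\<And>y. 0 \<le> w y" "\<And>y. w' y \<le> w y" "\<And>y. 0 \<le> w' y" and r: "0 < r" and m: "0 < m"
    and le: "(r powr e * set_lebesgue_integral lebesgue (UNIV - hball \<xi>0 r) (\<lambda>y. w y / kern y \<xi>0 powr (hdim TYPE('n) + e))) powr (1 / m) \<le> \<omega>0"
  shows "(\<integral>\<^sup>+y. indicator (- hball \<xi>0 r) y * ennreal (w' y * Wt e \<xi>0 y) \<partial>lebesgue) \<le> ennreal (r powr - e * \<omega>0 powr m)"
proof -
  let ?f = "\<lambda>y. indicat_real (UNIV - hball \<xi>0 r) y *\<^sub>R (w y / kern y \<xi>0 powr (hdim TYPE('n) + e))"
  define I where "I = integral\<^sup>L lebesgue ?f"
  have I0: "0 \<le> I" unfolding I_def using w by (intro integral_nonneg_AE AE_I2) simp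
  have "(\<integral>\<^sup>+y. indicator (- hball \<xi>0 r) y * ennreal (w' y * Wt e \<xi>0 y) \<partial>lebesgue) \<le> (\<integral>\<^sup>+y. ennreal (?f y) \<partial>lebesgue)"
  proof (rule nn_integral_mono)
    fix y
    have "w' y * Wt e \<xi>0 y \<le> w y / kern y \<xi>0 powr (hdim TYPE('n) + e)"
      using mult_right_mono[OF w(2)[of y] Wt_nonneg[of e \<xi>0 y]] by (simp add: Wt_def kern_commute[of \<xi>0])
    thus "indicator (- hball \<xi>0 r) y * ennreal (w' y * Wt e \<xi>0 y) \<le> ennreal (?f y)"
      by (simp add: indicator_def ennreal_leI)
  qed
  also have "\<dots> = ennreal I"
    unfolding I_def using int w by (intro nn_integral_eq_integral AE_I2) (auto simp: set_integrable_def)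
  also have "\<dots> \<le> ennreal (r powr - e * \<omega>0 powr m)"
  proof (rule ennreal_leI)
    have le': "(r powr e * I) powr (1 / m) \<le> \<omega>0" using le unfolding I_def set_lebesgue_integral_def .
    have "r powr e * I = ((r powr e * I) powr (1 / m)) powr m" using I0 m by (simp add: powr_powr)
    also have "\<dots> \<le> \<omega>0 powr m" using le' m by (intro powr_mono2) auto
    finally have "r powr - e * (r powr e * I) \<le> r powr - e * \<omega>0 powr m" by (rule mult_left_mono) simp
    moreover have "r powr - e * (r powr e * I) = I" using r by (simp add: powr_minus)
    ultimately show "I \<le> r powr - e * \<omega>0 powr m" by simp
  qed
  finally show ?thesis .
qed

lemma powr_le_one_plus:
  fixes x :: real assumes "0 \<le> x" "0 \<le> e" "e \<le> e'" shows "x powr e \<le> 1 + x powr e'"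
proof (cases "x \<le> 1")
  case True
  hence "x powr e \<le> 1" using assms by (intro powr_le1) auto
  thus ?thesis using powr_ge_zero[of x e'] by linarith
next
  case False
  hence "x powr e \<le> x powr e'" using assms by (intro powr_mono) auto
  thus ?thesis by simp
qed

theorem theorem4p3:
  fixes p q s t \<alpha> La Ha M :: real
  assumes "1 < p" "p \<le> q" "0 < s" "s \<le> t" "t < 1" "0 < \<alpha>" "\<alpha> \<le> 1" "t * q \<le> s * p + \<alpha>"
  shows "\<exists>\<sigma> \<beta> :: real. 0 < \<sigma> \<and> \<sigma> \<le> 1/4 \<and> 0 < \<beta> \<and> \<beta> < s * p / (q - 1) \<and>
    (\<forall>(\<Omega> :: 'n::finite heis set) \<Omega>' a u \<xi>0 r.
       open \<Omega> \<and> bounded \<Omega> \<and>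
       \<comment> \<open>(A1)\<close>
       (\<lambda>z. a (fst z) (snd z)) \<in> borel_measurable (lebesgue \<Otimes>\<^sub>M lebesgue) \<and>
       (\<forall>\<xi> \<eta>. 0 \<le> a \<xi> \<eta> \<and> a \<xi> \<eta> = a \<eta> \<xi> \<and> a \<xi> \<eta> \<le> La) \<and> La = a_sup_norm a \<and>
       \<comment> \<open>(A2)\<close>
       holder_cond \<alpha> Ha a \<and> Ha = a_holder \<alpha> a \<and>
       \<comment> \<open>\<Omega>' compactly contained in \<Omega>\<close>
       open \<Omega>' \<and> compact (closure \<Omega>') \<and> closure \<Omega>' \<subseteq> \<Omega> \<and>
       weak_solution p q s t a \<Omega> u \<and> u \<in> tail_space (q - 1) (s * p) \<and>
       ess_sup_on \<Omega>' (\<lambda>x. \<bar>u x\<bar>) < \<infinity> \<and> M = real_of_ereal (ess_sup_on \<Omega>' (\<lambda>x. \<bar>u x\<bar>)) \<and>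
       0 < r \<and> r \<le> 1 \<and> hball \<xi>0 (2 * r) \<subseteq> \<Omega>'
       \<longrightarrow>
       (let Q = hdim TYPE('n);
            \<omega>0 = 2 * real_of_ereal (ess_sup_on (hball \<xi>0 r) (\<lambda>x. \<bar>u x\<bar>))
              + (r powr (s * p) * set_lebesgue_integral lebesgue (UNIV - hball \<xi>0 r)
                   (\<lambda>\<xi>. (\<bar>u \<xi>\<bar> powr (p - 1) + \<bar>u \<xi>\<bar> powr (q - 1)) / kern \<xi> \<xi>0 powr (Q + s * p)))
                 powr (1 / (p - 1))
              + (r powr (t * q) * set_lebesgue_integral lebesgue (UNIV - hball \<xi>0 r)
                   (\<lambda>\<xi>. \<bar>u \<xi>\<bar> powr (q - 1) / kern \<xi> \<xi>0 powr (Q + t * q)))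
                 powr (1 / (q - 1))
        in \<forall>j::nat. ess_sup_on (hball \<xi>0 (\<sigma> ^ j * r)) u - ess_inf_on (hball \<xi>0 (\<sigma> ^ j * r)) u
                     \<le> ereal (\<sigma> powr (real j * \<beta>) * \<omega>0)))"
proof -
  note pq = assms(1-5)
  \<comment> \<open>M is a parameter at this point and its sign is known only once u is given; the
    absolute value and the summand 1 keep \<Lambda> positive even for M = 0.\<close>
  define \<Lambda> where "\<Lambda> = 4 * \<bar>M\<bar> + 1"
  have \<beta>lt: "\<beta> < s * p / (q - 1)" if "\<beta> * (q - 1) \<le> s * p / 2" for \<beta>
  proof -
    have "0 < s * p" using pq by simp
    hence "\<beta> * (q - 1) < s * p" using that by linarith
    thus ?thesis using pq by (simp add: pos_less_divide_eq)
  qed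
  show ?thesis
  \<comment> \<open>\<open>La\<close> and \<open>Ha\<close> are fixed before the coefficient.
    Negative values admit no coefficient at all, so any \<sigma> and \<beta> in the required ranges
    will do.\<close>
  proof (cases "0 \<le> La \<and> 0 \<le> Ha")
    case False
    have contra: False if a: "(\<lambda>z. a (fst z) (snd z)) \<in> borel_measurable (lebesgue \<Otimes>\<^sub>M lebesgue)"
      "\<forall>\<xi> \<eta>. 0 \<le> a \<xi> \<eta> \<and> a \<xi> \<eta> = a \<eta> \<xi> \<and> a \<xi> \<eta> \<le> La" "holder_cond \<alpha> Ha a" for a :: "'n heis \<Rightarrow> 'n heis \<Rightarrow> real"
    proof -
      interpret double_phase p q s t \<alpha> La Ha a by unfold_locales (use assms a in auto)
      show False using False La_nonneg Ha_nonneg by simp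
    qed
    have "0 < s * p / (2 * (q - 1))" using pq by simp
    moreover have "s * p / (2 * (q - 1)) < s * p / (q - 1)" using pq by (intro \<beta>lt) (simp add: field_simps)
    ultimately show ?thesis
      by (intro exI[of _ "1/4"] exI[of _ "s * p / (2 * (q - 1))"]) (use contra in auto)
  next
    case True
    \<comment> \<open>All constants are obtained before the sets, the coefficient, the solution and
      the ball are introduced. This order expresses that they depend only on the data
      \<open>La\<close>, \<open>Ha\<close>, M, the exponents and the dimension.\<close>
    obtain \<theta> \<delta> \<sigma> \<beta> where \<theta>: "0 < \<theta>" "\<theta> \<le> 1/4" "tail_const TYPE('n) p q s t \<Lambda> * 2 powr q * \<theta> powr (s * p) \<le> tail_threshold TYPE('n) q t La Ha"
      and \<delta>: "0 < \<delta>" "\<delta> \<le> 1/4" "growth_const TYPE('n) p q s t (4 * Ha * ((1 / \<theta>) powr \<alpha> * \<Lambda> powr (q - p))) * 2 powr (p + 2) * \<delta> powr (p - 1)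
        \<le> decay_start TYPE('n) p q s t (4 * Ha * ((1 / \<theta>) powr \<alpha> * \<Lambda> powr (q - p)))"
      and \<sigma>: "0 < \<sigma>" "\<sigma> \<le> \<theta> / 20" and \<beta>: "0 < \<beta>" "\<beta> * (q - 1) \<le> s * p / 2" "1 - \<delta> / 2 \<le> \<sigma> powr \<beta>"
      using decay_constants_exist[where 'n='n, OF pq, of La Ha \<Lambda> \<alpha>] True by blast
    show ?thesis
    proof (rule exI[of _ \<sigma>], rule exI[of _ \<beta>], intro conjI allI impI)
      show "0 < \<sigma>" "\<sigma> \<le> 1/4" "0 < \<beta>" using \<sigma> \<theta> \<beta> by auto
      show "\<beta> < s * p / (q - 1)" by (rule \<beta>lt[OF \<beta>(2)])
      fix \<Omega> \<Omega>' :: "'n heis set" and a :: "'n heis \<Rightarrow> 'n heis \<Rightarrow> real" and u \<xi>0 r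
      assume H: "open \<Omega> \<and> bounded \<Omega> \<and>
       (\<lambda>z. a (fst z) (snd z)) \<in> borel_measurable (lebesgue \<Otimes>\<^sub>M lebesgue) \<and>
       (\<forall>\<xi> \<eta>. 0 \<le> a \<xi> \<eta> \<and> a \<xi> \<eta> = a \<eta> \<xi> \<and> a \<xi> \<eta> \<le> La) \<and> La = a_sup_norm a \<and>
       holder_cond \<alpha> Ha a \<and> Ha = a_holder \<alpha> a \<and>
       open \<Omega>' \<and> compact (closure \<Omega>') \<and> closure \<Omega>' \<subseteq> \<Omega> \<and>
       weak_solution p q s t a \<Omega> u \<and> u \<in> tail_space (q - 1) (s * p) \<and>
       ess_sup_on \<Omega>' (\<lambda>x. \<bar>u x\<bar>) < \<infinity> \<and> M = real_of_ereal (ess_sup_on \<Omega>' (\<lambda>x. \<bar>u x\<bar>)) \<and>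
       0 < r \<and> r \<le> 1 \<and> hball \<xi>0 (2 * r) \<subseteq> \<Omega>'"
      have ws: "weak_solution p q s t a \<Omega> u" and ut: "u \<in> tail_space (q - 1) (s * p)"
        and r: "0 < r" "r \<le> 1" and op: "open \<Omega>" "bounded \<Omega>" "open \<Omega>'" and sub: "closure \<Omega>' \<subseteq> \<Omega>" "hball \<xi>0 (2 * r) \<subseteq> \<Omega>'"
        and fin: "ess_sup_on \<Omega>' (\<lambda>x. \<bar>u x\<bar>) < \<infinity>" and M: "M = real_of_ereal (ess_sup_on \<Omega>' (\<lambda>x. \<bar>u x\<bar>))"
        using H by blast+
      have um [measurable]: "u \<in> borel_measurable lebesgue" using ws unfolding weak_solution_iff Aspace_iff_hpair by auto
      have am: "(\<lambda>x. \<bar>u x\<bar>) \<in> borel_measurable lebesgue" by measurable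
      have Bm: "hball \<xi>0 d \<in> sets lebesgue" for d using open_hball[of \<xi>0 d] by (simp add: borel_open)
      have \<Omega>'m: "\<Omega>' \<in> sets lebesgue" using op by (simp add: borel_open)
      have hr: "hball \<xi>0 r \<subseteq> \<Omega>'" using sub(2) r by (force simp: hball_def)
      have kb: "kball \<xi>0 (r / 5) \<subseteq> hball \<xi>0 r" by (rule kball_subset_hball)
      have kb': "kball \<xi>0 (r / 5) \<subseteq> \<Omega>'" using kb hr by blast
      have r5: "0 < r / 5" using r by simp
      note eM = ess_sup_on_abs[OF \<Omega>'m kb' r5 fin, folded M]
      have M_ae: "AE x in lebesgue. x \<in> hball \<xi>0 r \<longrightarrow> \<bar>u x\<bar> \<le> M"
        using eM(2) by eventually_elim (use hr in blast)
      have le: "ess_sup_on (hball \<xi>0 r) (\<lambda>x. \<bar>u x\<bar>) \<le> ereal M"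
        by (rule ess_sup_on_le[OF am Bm M_ae])
      hence fin': "ess_sup_on (hball \<xi>0 r) (\<lambda>x. \<bar>u x\<bar>) < \<infinity>" by (rule le_less_trans) simp
      define S0 where "S0 = real_of_ereal (ess_sup_on (hball \<xi>0 r) (\<lambda>x. \<bar>u x\<bar>))"
      note eS = ess_sup_on_abs[OF Bm kb r5 fin', folded S0_def]
      have S0M: "S0 \<le> M" using le eS(3) by simp
      let ?Q = "hdim TYPE('n)"
      define w1 where "w1 y = \<bar>u y\<bar> powr (p - 1) + \<bar>u y\<bar> powr (q - 1)" for y
      define w2 where "w2 y = \<bar>u y\<bar> powr (q - 1)" for y
      have e: "0 < s * p" "s * p \<le> t * q" using pq by (auto intro: mult_mono)
      have i1: "set_integrable lebesgue (UNIV - hball \<xi>0 r) (\<lambda>y. w1 y / kern y \<xi>0 powr (?Q + s * p))"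
      proof (rule tail_space_integrable[OF ut pq(1,2) e(1) order_refl r(1)])
        show "w1 y \<le> 1 + 2 * \<bar>u y\<bar> powr (q - 1)" for y
          using powr_le_one_plus[of "\<bar>u y\<bar>" "p - 1" "q - 1"] pq by (simp add: w1_def)
        show "w1 \<in> borel_measurable lebesgue" unfolding w1_def by measurable
      qed (simp add: w1_def)
      have i2: "set_integrable lebesgue (UNIV - hball \<xi>0 r) (\<lambda>y. w2 y / kern y \<xi>0 powr (?Q + t * q))"
      proof (rule tail_space_integrable[OF ut pq(1,2) e(1) e(2) r(1)])
        show "w2 y \<le> 1 + 2 * \<bar>u y\<bar> powr (q - 1)" for y
          using powr_ge_zero[of "\<bar>u y\<bar>" "q - 1"] unfolding w2_def by linarith
        show "w2 \<in> borel_measurable lebesgue" unfolding w2_def by measurable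
      qed (simp add: w2_def)
      define T1 where "T1 = (r powr (s * p) * set_lebesgue_integral lebesgue (UNIV - hball \<xi>0 r) (\<lambda>y. w1 y / kern y \<xi>0 powr (?Q + s * p))) powr (1 / (p - 1))"
      define T2 where "T2 = (r powr (t * q) * set_lebesgue_integral lebesgue (UNIV - hball \<xi>0 r) (\<lambda>y. w2 y / kern y \<xi>0 powr (?Q + t * q))) powr (1 / (q - 1))"
      define \<omega>0 where "\<omega>0 = 2 * S0 + T1 + T2"
      have T: "0 \<le> T1" "0 \<le> T2" by (simp_all add: T1_def T2_def)
      have T\<omega>: "T1 \<le> \<omega>0" "T2 \<le> \<omega>0" "2 * S0 \<le> \<omega>0" using T eS(1) by (simp_all add: \<omega>0_def)
      interpret osc_decay p q s t \<alpha> La Ha a \<Omega> u \<xi>0 r M S0 \<omega>0 \<theta> \<sigma> \<beta> \<delta> \<Lambda>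
      proof (unfold_locales)
        show "hball \<xi>0 r \<subseteq> \<Omega>" using hr sub(1) closure_subset by blast
        show "(\<integral>\<^sup>+y. indicator (- hball \<xi>0 r) y * ennreal (\<bar>u y\<bar> powr (p - 1) * Wt (s * p) \<xi>0 y) \<partial>lebesgue) \<le> ennreal (r powr - (s * p) * \<omega>0 powr (p - 1))"
          by (rule tail_bound_from_omega[OF i1 _ _ _ r(1) _ T\<omega>(1)[unfolded T1_def]]) (use pq in \<open>auto simp: w1_def\<close>)
        show "(\<integral>\<^sup>+y. indicator (- hball \<xi>0 r) y * ennreal (\<bar>u y\<bar> powr (q - 1) * Wt (s * p) \<xi>0 y) \<partial>lebesgue) \<le> ennreal (r powr - (s * p) * \<omega>0 powr (p - 1))"
          by (rule tail_bound_from_omega[OF i1 _ _ _ r(1) _ T\<omega>(1)[unfolded T1_def]]) (use pq in \<open>auto simp: w1_def\<close>)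
        show "(\<integral>\<^sup>+y. indicator (- hball \<xi>0 r) y * ennreal (\<bar>u y\<bar> powr (q - 1) * Wt (t * q) \<xi>0 y) \<partial>lebesgue) \<le> ennreal (r powr - (t * q) * \<omega>0 powr (q - 1))"
          by (rule tail_bound_from_omega[OF i2 _ _ _ r(1) _ T\<omega>(2)[unfolded T2_def]]) (use pq in \<open>auto simp: w2_def\<close>)
        show "4 * M \<le> \<Lambda>" "0 < \<Lambda>" by (simp_all add: \<Lambda>_def)
      qed (use H assms M_ae eS S0M T\<omega> \<theta> \<delta> \<sigma> \<beta> in auto)
      have main: "ess_sup_on (hball \<xi>0 (\<sigma> ^ j * r)) u - ess_inf_on (hball \<xi>0 (\<sigma> ^ j * r)) u
          \<le> ereal (\<sigma> powr (real j * \<beta>) * \<omega>0)" for j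
      proof -
        obtain c where c: "AE y in lebesgue. y \<in> hball \<xi>0 (rr j) \<longrightarrow> c \<le> u y \<and> u y \<le> c + \<omega> j"
          using oscillation by blast
        have "ess_sup_on (hball \<xi>0 (rr j)) u \<le> ereal (c + \<omega> j)"
          by (rule ess_sup_on_le[OF um Bm]) (use c in \<open>auto elim: eventually_mono\<close>)
        moreover have "ess_sup_on (hball \<xi>0 (rr j)) (\<lambda>x. - u x) \<le> ereal (- c)"
          by (rule ess_sup_on_le[OF _ Bm]) (use c in \<open>auto elim: eventually_mono\<close>)
        hence "- ereal (- c) \<le> ess_inf_on (hball \<xi>0 (rr j)) u"
          unfolding ess_inf_on_def by (simp only: ereal_minus_le_minus)
        hence "ereal c \<le> ess_inf_on (hball \<xi>0 (rr j)) u" by simp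
        ultimately have "ess_sup_on (hball \<xi>0 (rr j)) u - ess_inf_on (hball \<xi>0 (rr j)) u \<le> ereal (c + \<omega> j) - ereal c"
          by (rule ereal_minus_mono)
        also have "ereal (c + \<omega> j) - ereal c = ereal (\<omega> j)" by simp
        also have "\<omega> j = \<sigma> powr (real j * \<beta>) * \<omega>0"
          using \<sigma> by (simp add: \<omega>_def \<kappa>_def powr_power mult.commute)
        finally show ?thesis by (simp add: rr_def)
      qed
      show "let Q = hdim TYPE('n);
            \<omega>0 = 2 * real_of_ereal (ess_sup_on (hball \<xi>0 r) (\<lambda>x. \<bar>u x\<bar>))
              + (r powr (s * p) * set_lebesgue_integral lebesgue (UNIV - hball \<xi>0 r)
                   (\<lambda>\<xi>. (\<bar>u \<xi>\<bar> powr (p - 1) + \<bar>u \<xi>\<bar> powr (q - 1)) / kern \<xi> \<xi>0 powr (Q + s * p)))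
                 powr (1 / (p - 1))
              + (r powr (t * q) * set_lebesgue_integral lebesgue (UNIV - hball \<xi>0 r)
                   (\<lambda>\<xi>. \<bar>u \<xi>\<bar> powr (q - 1) / kern \<xi> \<xi>0 powr (Q + t * q)))
                 powr (1 / (q - 1))
        in \<forall>j::nat. ess_sup_on (hball \<xi>0 (\<sigma> ^ j * r)) u - ess_inf_on (hball \<xi>0 (\<sigma> ^ j * r)) u
                     \<le> ereal (\<sigma> powr (real j * \<beta>) * \<omega>0)"
        unfolding Let_def using main unfolding \<omega>0_def S0_def T1_def T2_def w1_def w2_def by blast
    qed
  qed
qed

end
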